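(* For every $c\in\mathbb{R}^+$, $p\in[1,\infty)$ and $q\in(1,\infty]$, the metric spaces $(\mathcal{X}_{p,q,c},d_M)$ and $(\mathcal{X}'_{p,q,c},d_M)$ are compact.
   Context: For a probability space $(\Omega,\mathcal{A},\mu)$, a $P$-operator on $\Omega$ is a linear map $A:L^\infty(\Omega)\to L^1(\Omega)$, written $v\mapsto vA$, with $\|A\|_{\infty\to1}<\infty$, where $\|A\|_{p\to q}:=\sup_{v\in L^\infty(\Omega)}\|vA\|_q/\|v\|_p$ for $p,q\in[1,\infty]$. For measurable $v_1,\dots,v_m$, $\mathcal{D}(v_1,\dots,v_m)$ is their joint distribution on $\mathbb{R}^m$. The $k$-profile $\mathcal{S}_k(A)$ is the set of measures $\mathcal{D}(v_1,\dots,v_k,v_1A,\dots,v_kA)$ on $\mathbb{R}^{2k}$ with $v_1,\dots,v_k$ measurable functions $\Omega\to[-1,1]$. $d_{\rm LP}$ is the Lévy–Prokhorov metric on Borel probability measures on $\mathbb{R}^m$, $d_H$ the associated Hausdorff distance between sets of such measures, and $d_M(A,B):=\sum_{k\ge1}2^{-k}d_H(\mathcal{S}_k(A),\mathcal{S}_k(B))$ for $P$-operators $A,B$ on possibly different spaces. Two $P$-operators are weakly equivalent if $d_M(A,B)=0$; $d_M$ is a metric on weak equivalence classes, and $\|\cdot\|_{p\to q}$ is constant on these classes. $\mathcal{X}_{p,q,c}$ denotes the set of weak equivalence classes of $P$-operators $A$ with $\|A\|_{p\to q}\le c$, and $\mathcal{X}'_{p,q,c}$ the set of those classes of $P$-operators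 defined on atomless probability spaces with $\|A\|_{p\to q}\le c$. *)

theory Defs
  imports "HOL-Probability.Probability"
begin

definition Linf :: "'a measure \<Rightarrow> ('a \<Rightarrow> real) set" where
  "Linf M = {v \<in> borel_measurable M. esssup M (\<lambda>x. ereal \<bar>v x\<bar>) < \<infinity>}"

definition Lp_norm :: "'a measure \<Rightarrow> ereal \<Rightarrow> ('a \<Rightarrow> real) \<Rightarrow> ereal" where
  "Lp_norm M p f =
     (if p = \<infinity> then esssup M (\<lambda>x. ereal \<bar>f x\<bar>)
      else (let I = (\<integral>\<^sup>+ x. ennreal (\<bar>f x\<bar> powr real_of_ereal p) \<partial>M)
            in if I = \<infinity> then \<infinity> else ereal (enn2real I powr (1 / real_of_ereal p))))"

definition op_norm :: "'a measure \<Rightarrow> ereal \<Rightarrow> ereal \<Rightarrow> (('a \<Rightarrow> real) \<Rightarrow> ('a \<Rightarrow> real)) \<Rightarrow> ereal" where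
  "op_norm M p q A = (SUP v \<in> {v \<in> Linf M. Lp_norm M p v \<noteq> 0}. Lp_norm M q (A v) / Lp_norm M p v)"

text \<open>P-operator: a linear map from L-infinity to L^1 (acting on representatives,
  respecting a.e. equality), with finite infinity-to-1 norm.\<close>
definition P_operator :: "'a measure \<Rightarrow> (('a \<Rightarrow> real) \<Rightarrow> ('a \<Rightarrow> real)) \<Rightarrow> bool" where
  "P_operator M A \<longleftrightarrow>
     prob_space M \<and>
     (\<forall>v\<in>Linf M. integrable M (A v)) \<and>
     (\<forall>v\<in>Linf M. \<forall>w\<in>Linf M. (AE x in M. v x = w x) \<longrightarrow> (AE x in M. A v x = A w x)) \<and>
     (\<forall>v\<in>Linf M. \<forall>w\<in>Linf M. \<forall>a b::real.
        AE x in M. A (\<lambda>y. a * v y + b * w y) x = a * A v x + b * A w x) \<and>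
     op_norm M \<infinity> 1 A < \<infinity>"

abbreviation Rspace :: "nat \<Rightarrow> (nat \<Rightarrow> real) measure" where
  "Rspace m \<equiv> PiM {..<m} (\<lambda>_. borel)"

definition profile :: "'a measure \<Rightarrow> (('a \<Rightarrow> real) \<Rightarrow> ('a \<Rightarrow> real)) \<Rightarrow> nat \<Rightarrow> (nat \<Rightarrow> real) measure set" where
  "profile M A k =
     {distr M (Rspace (2*k)) (\<lambda>x. \<lambda>i\<in>{..<2*k}. if i < k then v i x else A (v (i - k)) x) | v.
        \<forall>i<k. v i \<in> borel_measurable M \<and> (\<forall>x\<in>space M. \<bar>v i x\<bar> \<le> 1)}"

definition eucl_dist :: "nat \<Rightarrow> (nat \<Rightarrow> real) \<Rightarrow> (nat \<Rightarrow> real) \<Rightarrow> real" where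
  "eucl_dist m x y = sqrt (\<Sum>i<m. (x i - y i)\<^sup>2)"

definition nbhd :: "nat \<Rightarrow> (nat \<Rightarrow> real) set \<Rightarrow> real \<Rightarrow> (nat \<Rightarrow> real) set" where
  "nbhd m S e = {y \<in> space (Rspace m). \<exists>x\<in>S. eucl_dist m x y < e}"

definition LP_dist :: "nat \<Rightarrow> (nat \<Rightarrow> real) measure \<Rightarrow> (nat \<Rightarrow> real) measure \<Rightarrow> real" where
  "LP_dist m \<mu> \<nu> = Inf {e. 0 < e \<and> (\<forall>S\<in>sets (Rspace m).
       measure \<mu> S \<le> measure \<nu> (nbhd m S e) + e \<and> measure \<nu> S \<le> measure \<mu> (nbhd m S e) + e)}"

definition haus_dist :: "nat \<Rightarrow> (nat \<Rightarrow> real) measure set \<Rightarrow> (nat \<Rightarrow> real) measure set \<Rightarrow> real" where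
  "haus_dist m S T = max (SUP \<mu>\<in>S. INF \<nu>\<in>T. LP_dist m \<mu> \<nu>) (SUP \<nu>\<in>T. INF \<mu>\<in>S. LP_dist m \<mu> \<nu>)"

definition dM :: "'a measure \<Rightarrow> (('a \<Rightarrow> real) \<Rightarrow> ('a \<Rightarrow> real)) \<Rightarrow>
                  'b measure \<Rightarrow> (('b \<Rightarrow> real) \<Rightarrow> ('b \<Rightarrow> real)) \<Rightarrow> real" where
  "dM M A N B = (\<Sum>k. (1/2) ^ Suc k * haus_dist (2 * Suc k) (profile M A (Suc k)) (profile N B (Suc k)))"

definition atomless :: "'a measure \<Rightarrow> bool" where
  "atomless M \<longleftrightarrow> (\<forall>S\<in>sets M. 0 < measure M S \<longrightarrow>
      (\<exists>T\<in>sets M. T \<subseteq> S \<and> 0 < measure M T \<and> measure M T < measure M S))"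

end

theory Submission
  imports Defs "HOL-Complex_Analysis.Great_Picard"
begin

text \<open>
  After passing to a subsequence, every cell of finite \<open>\<epsilon>\<close>-nets of laws is met by the \<open>k\<close>-profiles of
  either almost all or almost none of the operators; in the first case, choose functions
  realising the cell.  The level sets of these countably many functions generate, under finite Boolean
  operations and under taking level sets of the images of indicator functions, a countable family of
  measurable sets, and along a further subsequence the measures of all finite Boolean combinations
  converge.  The limits define a probability measure \<open>N\<close> on a space of \<open>0\<close>-\<open>1\<close> sequences.

  A sequence of functions \<open>f\<^sub>n\<close> converges to a function \<open>g\<close> on \<open>N\<close> if both are close in \<open>L\<^sup>1\<close> to the same
  function of finitely many of these sets; this implies convergence of joint laws and is compatible
  with Lipschitz functions.  Since \<open>q > 1\<close>, images of indicator functions are uniformly integrable, so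
  they are determined up to a small \<open>L\<^sup>1\<close> error by finitely many level sets and hence converge; since \<open>p < \<infinity>\<close>, an
  \<open>L\<^sup>1\<close>-small change of uniformly bounded functions has an \<open>L\<^sup>1\<close>-small effect on their images.  Hence
  \<open>B v = lim A\<^sub>n v\<^sub>n\<close> for any bounded \<open>v\<^sub>n \<rightarrow> v\<close> is well defined.  Laws from profiles
  of \<open>B\<close> are limits of laws from profiles of \<open>A\<^sub>n\<close>, and the chosen functions yield the converse, uniformly
  by the finite nets.  In the atomless case, partitions into \<open>K\<close> sets of measure \<open>1/K\<close> are added to the family.
\<close>

section \<open>The Levy--Prokhorov distance\<close>

text \<open>The operators live on unrelated probability spaces, so neither functions nor images can
  be compared directly; the indices of the sets containing a point are the only common coordinates.
  Weak limits of the images would not do, because a joint law depends on them nonlinearly. Images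
  have to converge strongly, and closing the family under level sets of images of its own sets is
  what forces this: it puts the images among the functions that the coordinates determine. A profile
  is an uncountable set of laws that is not known to be closed. Only its position relative to
  countably many cells of small diameter is followed. This suffices for the Hausdorff distance and
  needs no compactness of a space of laws, only total boundedness, which uniformly bounded first
  moments provide. For \<open>q = \<infinity>\<close>, one finite exponent above 1 drives the
  construction, and all finite exponents together recover the norm bound in the limit.\<close>

definition lp_close :: "nat \<Rightarrow> (nat \<Rightarrow> real) measure \<Rightarrow> (nat \<Rightarrow> real) measure \<Rightarrow> real \<Rightarrow> bool" where
  "lp_close d \<mu> \<nu> e \<longleftrightarrow> (\<forall>S\<in>sets (Rspace d).
       measure \<mu> S \<le> measure \<nu> (nbhd d S e) + e \<and> measure \<nu> S \<le> measure \<mu> (nbhd d S e) + e)"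

lemma lp_close_sym: "lp_close d \<mu> \<nu> e \<Longrightarrow> lp_close d \<nu> \<mu> e"
  by (auto simp: lp_close_def)

lemma eucl_dist_L2_set: "eucl_dist d x y = L2_set (\<lambda>i. x i - y i) {..<d}"
  by (simp add: eucl_dist_def L2_set_def)

lemma eucl_dist_self: "eucl_dist d x x = 0"
  by (simp add: eucl_dist_def)

lemma eucl_dist_commute: "eucl_dist d x y = eucl_dist d y x"
  unfolding eucl_dist_def by (simp add: power2_commute)

lemma eucl_dist_triangle: "eucl_dist d x z \<le> eucl_dist d x y + eucl_dist d y z"
  using L2_set_triangle_ineq[of "\<lambda>i. x i - y i" "\<lambda>i. y i - z i" "{..<d}"]
  by (simp add: eucl_dist_L2_set)

lemma eucl_dist_le_sum: "eucl_dist d x y \<le> (\<Sum>i<d. \<bar>x i - y i\<bar>)"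
  using L2_set_le_sum_abs[of "\<lambda>i. x i - y i" "{..<d}"]
  by (simp add: eucl_dist_L2_set)

lemma measurable_eucl_dist [measurable]:
  assumes "f \<in> M \<rightarrow>\<^sub>M Rspace d" "g \<in> M \<rightarrow>\<^sub>M Rspace d"
  shows "(\<lambda>x. eucl_dist d (f x) (g x)) \<in> borel_measurable M"
proof -
  have "(\<lambda>x. f x i) \<in> borel_measurable M" "(\<lambda>x. g x i) \<in> borel_measurable M" if "i < d" for i
    using measurable_compose[OF assms(1) measurable_component_singleton, of i]
      measurable_compose[OF assms(2) measurable_component_singleton, of i] that by auto
  then show ?thesis
    unfolding eucl_dist_def by (auto intro!: borel_measurable_sum)
qed

lemma eucl_dist_rational_approx:
  assumes "0 < e"
  shows "\<exists>z \<in> PiE {..<d} (\<lambda>_. \<rat>). eucl_dist d y z < e"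
proof -
  have "\<exists>z::real\<in>\<rat>. \<bar>y i - z\<bar> < e / (real d + 1)" for i
  proof -
    obtain z where "z \<in> \<rat>" "y i < z" "z < y i + e / (real d + 1)"
      using Rats_dense_in_real[of "y i" "y i + e / (real d + 1)"] assms by auto
    then show ?thesis by (intro bexI[of _ z]) auto
  qed
  then obtain z where z: "\<And>i. z i \<in> \<rat>" "\<And>i. \<bar>y i - z i\<bar> < e / (real d + 1)" by metis
  have "eucl_dist d y (restrict z {..<d}) \<le> (\<Sum>i<d. \<bar>y i - restrict z {..<d} i\<bar>)"
    by (rule eucl_dist_le_sum)
  also have "\<dots> \<le> (\<Sum>i<d. e / (real d + 1))"
    by (intro sum_mono) (use z(2) in \<open>auto intro: less_imp_le\<close>)
  also have "\<dots> = e * (real d / (real d + 1))" by simp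
  also have "\<dots> < e * 1" using assms by (intro mult_strict_left_mono) auto
  finally show ?thesis using z(1) by (intro bexI[of _ "restrict z {..<d}"]) auto
qed

text \<open>\<open>S\<close> is arbitrary, so the defining union of balls may be uncountable. Every
  point of the neighbourhood lies in a ball with rational centre and radius that stays inside it,
  which makes the union countable. Neighbourhoods can then be fed back into \<open>lp_close\<close>,
  as transitivity requires.\<close>

lemma nbhd_sets: "nbhd d S e \<in> sets (Rspace d)"
proof -
  define D where "D = {(z, r). z \<in> PiE {..<d} (\<lambda>_. \<rat>) \<and> r \<in> (\<rat>::real set) \<and>
     {y\<in>space (Rspace d). eucl_dist d z y < r} \<subseteq> nbhd d S e}"
  have cnt: "countable D"
    by (rule countable_subset[of _ "PiE {..<d} (\<lambda>_. \<rat>) \<times> \<rat>"])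
      (auto simp: D_def intro!: countable_SIGMA countable_PiE countable_rat)
  have "nbhd d S e = (\<Union>(z,r)\<in>D. {y\<in>space (Rspace d). eucl_dist d z y < r})"
  proof (intro equalityI subsetI)
    fix y assume y: "y \<in> nbhd d S e"
    then obtain x where x: "x \<in> S" "eucl_dist d x y < e" and ys: "y \<in> space (Rspace d)"
      by (auto simp: nbhd_def)
    \<comment> \<open>Half of the slack at \<open>y\<close>: the way from \<open>x\<close> to a
      point \<open>w\<close> of the rational ball costs \<open>eucl_dist d x y\<close> plus twice a
      radius below \<open>h\<close>, hence less than \<open>e\<close>.\<close>
    define h where "h = (e - eucl_dist d x y) / 2"
    have h: "0 < h" using x by (simp add: h_def)
    obtain r where r: "r \<in> \<rat>" "0 < r" "r < h" using Rats_dense_in_real[OF h] by auto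
    obtain z where z: "z \<in> PiE {..<d} (\<lambda>_. \<rat>)" "eucl_dist d y z < r"
      using eucl_dist_rational_approx[OF r(2)] by blast
    have "eucl_dist d x w < e" if "eucl_dist d z w < r" for w
      using that z(2) r(3) eucl_dist_triangle[of d x w y] eucl_dist_triangle[of d y w z]
      by (simp add: h_def field_simps)
    then have "(z, r) \<in> D" using x z r by (auto simp: D_def nbhd_def)
    then show "y \<in> (\<Union>(z,r)\<in>D. {y\<in>space (Rspace d). eucl_dist d z y < r})"
      using ys z(2) by (auto intro!: bexI[of _ "(z,r)"] simp: eucl_dist_commute)
  qed (auto simp: D_def)
  moreover have "{y\<in>space (Rspace d). eucl_dist d z y < r} \<in> sets (Rspace d)" if "(z, r) \<in> D" for z r
  proof -
    have [measurable]: "(\<lambda>_. z) \<in> Rspace d \<rightarrow>\<^sub>M Rspace d"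
      using that by (intro measurable_const) (auto simp: D_def space_PiM)
    show ?thesis by measurable
  qed
  ultimately show ?thesis using cnt by (auto intro!: sets.countable_UN')
qed

lemma subset_nbhd: "0 < e \<Longrightarrow> S \<subseteq> space (Rspace d) \<Longrightarrow> S \<subseteq> nbhd d S e"
  by (force simp: nbhd_def eucl_dist_self)

lemma nbhd_nbhd_subset: "nbhd d (nbhd d S e) e' \<subseteq> nbhd d S (e + e')"
proof
  fix y assume "y \<in> nbhd d (nbhd d S e) e'"
  then obtain x z where "x \<in> S" "eucl_dist d x z < e" "eucl_dist d z y < e'" "y \<in> space (Rspace d)"
    by (auto simp: nbhd_def)
  then show "y \<in> nbhd d S (e + e')"
    using eucl_dist_triangle[of d x y z] by (auto simp: nbhd_def intro!: bexI[of _ x])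
qed

lemma lp_close_half_trans:
  assumes S: "S \<in> sets (Rspace d)" and r: "finite_measure \<rho>" "sets \<rho> = sets (Rspace d)"
    and 1: "\<And>S. S \<in> sets (Rspace d) \<Longrightarrow> measure \<mu> S \<le> measure \<nu> (nbhd d S e) + e"
    and 2: "\<And>S. S \<in> sets (Rspace d) \<Longrightarrow> measure \<nu> S \<le> measure \<rho> (nbhd d S e') + e'"
  shows "measure \<mu> S \<le> measure \<rho> (nbhd d S (e + e')) + (e + e')"
proof -
  have "measure \<rho> (nbhd d (nbhd d S e) e') \<le> measure \<rho> (nbhd d S (e + e'))"
    by (intro finite_measure.finite_measure_mono[OF r(1)] nbhd_nbhd_subset) (simp add: r nbhd_sets)
  then show ?thesis using 1[OF S] 2[OF nbhd_sets, of S e] by linarith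
qed

lemma lp_close_trans:
  assumes "lp_close d \<mu> \<nu> e" "lp_close d \<nu> \<rho> e'"
    and "finite_measure \<mu>" "sets \<mu> = sets (Rspace d)" "finite_measure \<rho>" "sets \<rho> = sets (Rspace d)"
  shows "lp_close d \<mu> \<rho> (e + e')"
  unfolding lp_close_def
proof (intro ballI conjI)
  fix S assume S: "S \<in> sets (Rspace d)"
  show "measure \<mu> S \<le> measure \<rho> (nbhd d S (e + e')) + (e + e')"
    by (rule lp_close_half_trans[OF S assms(5,6), where \<nu>=\<nu>]) (use assms in \<open>auto simp: lp_close_def\<close>)
  have "measure \<rho> S \<le> measure \<mu> (nbhd d S (e' + e)) + (e' + e)"
    by (rule lp_close_half_trans[OF S assms(3,4), where \<nu>=\<nu>]) (use assms in \<open>auto simp: lp_close_def\<close>)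
  then show "measure \<rho> S \<le> measure \<mu> (nbhd d S (e + e')) + (e + e')" by (simp add: add.commute)
qed

text \<open>The easy direction of Strassen's theorem: off the event that the two maps are at
  distance at least \<open>e\<close>, a point sent into \<open>S\<close> by one map is sent into the
  neighbourhood of \<open>S\<close> by the other.\<close>

lemma lp_close_coupling:
  assumes "prob_space M" and f[measurable]: "f \<in> M \<rightarrow>\<^sub>M Rspace d" and g[measurable]: "g \<in> M \<rightarrow>\<^sub>M Rspace d"
    and le: "measure M {x\<in>space M. e \<le> eucl_dist d (f x) (g x)} \<le> e"
  shows "lp_close d (distr M (Rspace d) f) (distr M (Rspace d) g) e"
proof -
  interpret prob_space M by fact
  have *: "measure M (f -` S \<inter> space M) \<le> measure M (g -` nbhd d S e \<inter> space M) + e"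
    if S: "S \<in> sets (Rspace d)" and f[measurable]: "f \<in> M \<rightarrow>\<^sub>M Rspace d" and g[measurable]: "g \<in> M \<rightarrow>\<^sub>M Rspace d"
      and le: "measure M {x\<in>space M. e \<le> eucl_dist d (f x) (g x)} \<le> e" for S f g
  proof -
    have m: "g -` nbhd d S e \<inter> space M \<in> sets M" by (rule measurable_sets[OF g nbhd_sets])
    have "f -` S \<inter> space M \<subseteq> (g -` nbhd d S e \<inter> space M) \<union> {x\<in>space M. e \<le> eucl_dist d (f x) (g x)}"
      using measurable_space[OF g] by (force simp: nbhd_def not_less)
    then have "measure M (f -` S \<inter> space M) \<le> measure M ((g -` nbhd d S e \<inter> space M) \<union> {x\<in>space M. e \<le> eucl_dist d (f x) (g x)})"
      by (intro finite_measure_mono) (use m in auto)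
    also have "\<dots> \<le> measure M (g -` nbhd d S e \<inter> space M) + measure M {x\<in>space M. e \<le> eucl_dist d (f x) (g x)}"
      by (intro measure_Un_le m) auto
    finally show ?thesis using le by simp
  qed
  show ?thesis
    unfolding lp_close_def
    using *[OF _ f g le] *[OF _ g f] le by (auto simp: measure_distr nbhd_sets eucl_dist_commute)
qed

text \<open>Markov's inequality at level \<open>e\<close> divides the expected distance by
  \<open>e\<close>; this is the origin of the square \<open>e * e\<close> in the hypothesis.\<close>

lemma lp_close_coupling_L1:
  assumes "prob_space M" "\<And>i. i < d \<Longrightarrow> integrable M (f i)" "\<And>i. i < d \<Longrightarrow> integrable M (g i)"
    and "0 < e" and le: "(\<Sum>i<d. \<integral>x. \<bar>f i x - g i x\<bar> \<partial>M) \<le> e * e"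
  shows "lp_close d (distr M (Rspace d) (\<lambda>x. \<lambda>i\<in>{..<d}. f i x)) (distr M (Rspace d) (\<lambda>x. \<lambda>i\<in>{..<d}. g i x)) e"
proof -
  interpret prob_space M by fact
  have mf[measurable]: "(\<lambda>x. \<lambda>i\<in>{..<d}. f i x) \<in> M \<rightarrow>\<^sub>M Rspace d" "(\<lambda>x. \<lambda>i\<in>{..<d}. g i x) \<in> M \<rightarrow>\<^sub>M Rspace d"
    using assms(2,3) by (auto intro!: measurable_restrict)
  define h where "h x = (\<Sum>i<d. \<bar>f i x - g i x\<bar>)" for x
  have ih: "integrable M h" unfolding h_def using assms(2,3) by (intro Bochner_Integration.integrable_sum) auto
  have Eh: "(\<integral>x. h x \<partial>M) \<le> e * e"
    unfolding h_def using assms(2,3) le by (subst Bochner_Integration.integral_sum) auto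
  have "measure M {x\<in>space M. e \<le> eucl_dist d (\<lambda>i\<in>{..<d}. f i x) (\<lambda>i\<in>{..<d}. g i x)} \<le> measure M {x\<in>space M. e \<le> h x}"
  proof (intro finite_measure_mono subsetI, safe)
    fix x assume "e \<le> eucl_dist d (\<lambda>i\<in>{..<d}. f i x) (\<lambda>i\<in>{..<d}. g i x)"
    then show "e \<le> h x" using eucl_dist_le_sum[of d "\<lambda>i\<in>{..<d}. f i x" "\<lambda>i\<in>{..<d}. g i x"]
      by (simp add: h_def)
  next
    show "{x\<in>space M. e \<le> h x} \<in> sets M" using ih by measurable
  qed
  also have "\<dots> \<le> (\<integral>x. h x \<partial>M) / e"
    using ih \<open>0 < e\<close> by (intro integral_Markov_inequality_measure[where A="{}"]) (auto simp: sum_nonneg h_def[abs_def, symmetric], simp add: h_def sum_nonneg)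
  also have "\<dots> \<le> e" using Eh \<open>0 < e\<close> by (simp add: field_simps)
  finally show ?thesis by (intro lp_close_coupling[OF assms(1)] mf)
qed

text \<open>The two maps may live on different spaces, so no coupling is at hand. Summing over the
  fibres bounds the difference of the probabilities of every set at once, a total variation estimate
  in which no mass has to be moved.\<close>

lemma lp_close_finite_range:
  assumes "prob_space M" "prob_space N" and f[measurable]: "f \<in> M \<rightarrow>\<^sub>M Rspace d" and g[measurable]: "g \<in> N \<rightarrow>\<^sub>M Rspace d"
    and G: "finite G" "\<And>x. x \<in> space M \<Longrightarrow> f x \<in> G" "\<And>x. x \<in> space N \<Longrightarrow> g x \<in> G" and e: "0 < e"
    and ms: "\<And>z. z \<in> G \<Longrightarrow> {x\<in>space M. f x = z} \<in> sets M" "\<And>z. z \<in> G \<Longrightarrow> {x\<in>space N. g x = z} \<in> sets N"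
    and le: "(\<Sum>z\<in>G. \<bar>measure M {x\<in>space M. f x = z} - measure N {x\<in>space N. g x = z}\<bar>) \<le> e"
  shows "lp_close d (distr M (Rspace d) f) (distr N (Rspace d) g) e"
proof -
  interpret M: prob_space M by fact
  interpret N: prob_space N by fact
  have 1: "measure M (f -` S \<inter> space M) = (\<Sum>z\<in>G \<inter> S. measure M {x\<in>space M. f x = z})" for S
  proof -
    have "f -` S \<inter> space M = (\<Union>z\<in>G \<inter> S. {x\<in>space M. f x = z})" using G(2) by auto
    then show ?thesis using G(1) ms by (auto intro!: M.finite_measure_finite_Union simp: disjoint_family_on_def)
  qed
  have 2: "measure N (g -` S \<inter> space N) = (\<Sum>z\<in>G \<inter> S. measure N {x\<in>space N. g x = z})" for S
  proof -
    have "g -` S \<inter> space N = (\<Union>z\<in>G \<inter> S. {x\<in>space N. g x = z})" using G(3) by auto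
    then show ?thesis using G(1) ms by (auto intro!: N.finite_measure_finite_Union simp: disjoint_family_on_def)
  qed
  have 3: "\<bar>measure M (f -` S \<inter> space M) - measure N (g -` S \<inter> space N)\<bar> \<le> e" for S
  proof -
    have "\<bar>measure M (f -` S \<inter> space M) - measure N (g -` S \<inter> space N)\<bar> \<le>
      (\<Sum>z\<in>G \<inter> S. \<bar>measure M {x\<in>space M. f x = z} - measure N {x\<in>space N. g x = z}\<bar>)"
      unfolding 1 2 sum_subtractf[symmetric] by (rule sum_abs)
    also have "\<dots> \<le> (\<Sum>z\<in>G. \<bar>measure M {x\<in>space M. f x = z} - measure N {x\<in>space N. g x = z}\<bar>)"
      using G(1) by (intro sum_mono2) auto
    finally show ?thesis using le by simp
  qed
  have 4: "measure M (f -` S \<inter> space M) \<le> measure M (f -` nbhd d S e \<inter> space M)"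
    "measure N (g -` S \<inter> space N) \<le> measure N (g -` nbhd d S e \<inter> space N)" if "S \<in> sets (Rspace d)" for S
    using subset_nbhd[OF e sets.sets_into_space[OF that]]
    by (auto intro!: M.finite_measure_mono N.finite_measure_mono measurable_sets[OF f] measurable_sets[OF g] nbhd_sets)
  show ?thesis
    unfolding lp_close_def
  proof (intro ballI)
    fix S assume "S \<in> sets (Rspace d)"
    then show "measure (distr M (Rspace d) f) S \<le> measure (distr N (Rspace d) g) (nbhd d S e) + e \<and>
      measure (distr N (Rspace d) g) S \<le> measure (distr M (Rspace d) f) (nbhd d S e) + e"
      using 3[of S] 4[of S] by (simp add: measure_distr nbhd_sets) linarith
  qed
qed

section \<open>From closeness at one radius to the Levy--Prokhorov and Hausdorff distances\<close>

lemma lp_close_1: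
  assumes "prob_space \<mu>" "prob_space \<nu>"
  shows "lp_close d \<mu> \<nu> 1"
  unfolding lp_close_def
  using prob_space.prob_le_1[OF assms(1)] prob_space.prob_le_1[OF assms(2)]
  by (auto intro!: add_increasing)

lemma LP_dist_le: "0 < e \<Longrightarrow> lp_close d \<mu> \<nu> e \<Longrightarrow> LP_dist d \<mu> \<nu> \<le> e"
  unfolding LP_dist_def lp_close_def by (intro cInf_lower) (auto intro!: bdd_belowI[of _ 0])

lemma LP_dist_nonneg:
  assumes "prob_space \<mu>" "prob_space \<nu>"
  shows "0 \<le> LP_dist d \<mu> \<nu>"
proof -
  note lp_close_1[OF assms, of d]
  then show ?thesis unfolding LP_dist_def lp_close_def by (intro cInf_greatest) (auto intro!: exI[of _ 1])
qed

lemma LP_dist_le_1: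
  assumes "prob_space \<mu>" "prob_space \<nu>"
  shows "LP_dist d \<mu> \<nu> \<le> 1"
  by (intro LP_dist_le lp_close_1 assms) auto

text \<open>The infima are taken in the reals, so the families of distances must be bounded below;
  \<open>LP_dist_nonneg\<close> gives this and is the reason for assuming probability
  measures.\<close>

lemma haus_dist_le:
  assumes "S \<noteq> {}" "T \<noteq> {}" "\<And>\<mu>. \<mu> \<in> S \<union> T \<Longrightarrow> prob_space \<mu>" "0 < e"
    and "\<And>\<mu>. \<mu> \<in> S \<Longrightarrow> \<exists>\<nu>\<in>T. lp_close d \<mu> \<nu> e" "\<And>\<nu>. \<nu> \<in> T \<Longrightarrow> \<exists>\<mu>\<in>S. lp_close d \<mu> \<nu> e"
  shows "haus_dist d S T \<le> e"
proof -
  have b: "bdd_below (LP_dist d \<mu> ` T)" if "\<mu> \<in> S" for \<mu>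
    using assms(3) that LP_dist_nonneg by (intro bdd_belowI[of _ 0]) auto
  have b': "bdd_below ((\<lambda>\<mu>. LP_dist d \<mu> \<nu>) ` S)" if "\<nu> \<in> T" for \<nu>
    using assms(3) that LP_dist_nonneg by (intro bdd_belowI[of _ 0]) auto
  show ?thesis
    unfolding haus_dist_def
  proof (intro max.boundedI cSUP_least assms(1,2))
    fix \<mu> assume m: "\<mu> \<in> S"
    then obtain \<nu> where "\<nu> \<in> T" "lp_close d \<mu> \<nu> e" using assms(5) by blast
    then show "(INF \<nu>\<in>T. LP_dist d \<mu> \<nu>) \<le> e" by (intro cINF_lower2[OF b[OF m]] LP_dist_le assms(4))
  next
    fix \<nu> assume m: "\<nu> \<in> T"
    then obtain \<mu> where "\<mu> \<in> S" "lp_close d \<mu> \<nu> e" using assms(6) by blast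
    then show "(INF \<mu>\<in>S. LP_dist d \<mu> \<nu>) \<le> e" by (intro cINF_lower2[OF b'[OF m]] LP_dist_le assms(4))
  qed
qed

text \<open>The uniform bound provides the majorant when a limit is taken inside the series
  \<open>dM\<close>.\<close>

lemma haus_dist_bounds:
  assumes "S \<noteq> {}" "T \<noteq> {}" "\<And>\<mu>. \<mu> \<in> S \<union> T \<Longrightarrow> prob_space \<mu>"
  shows "0 \<le> haus_dist d S T" "haus_dist d S T \<le> 1"
proof -
  show "haus_dist d S T \<le> 1"
    using assms by (intro haus_dist_le) (auto intro!: lp_close_1)
  obtain \<mu> where m: "\<mu> \<in> S" using assms(1) by blast
  have "0 \<le> (INF \<nu>\<in>T. LP_dist d \<mu> \<nu>)"
    using assms m by (intro cINF_greatest LP_dist_nonneg) auto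
  also have "\<dots> \<le> (SUP \<mu>\<in>S. INF \<nu>\<in>T. LP_dist d \<mu> \<nu>)"
  proof (rule cSUP_upper[OF m], rule bdd_aboveI[of _ 1], safe)
    fix \<mu>' assume m': "\<mu>' \<in> S"
    obtain \<nu> where n: "\<nu> \<in> T" using assms(2) by blast
    show "(INF \<nu>\<in>T. LP_dist d \<mu>' \<nu>) \<le> 1"
      by (rule cINF_lower2[OF _ n LP_dist_le_1])
        (use assms(3) m' n LP_dist_nonneg in \<open>auto intro!: bdd_belowI[of _ 0]\<close>)
  qed
  also have "\<dots> \<le> haus_dist d S T" by (simp add: haus_dist_def)
  finally show "0 \<le> haus_dist d S T" .
qed

section \<open>Total boundedness of sets of laws\<close>

text \<open>The rounded value is a function of the set of thresholds below \<open>u\<close>. In this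
  form it can be read off from membership in level sets at finitely many rationals, which is all
  that the coded sets reveal about a function. Monotonicity is recorded because it yields Borel
  measurability.\<close>

lemma rational_rounding:
  fixes m :: nat and e :: real
  assumes "0 < e"
  obtains Q and \<psi> :: "real set \<Rightarrow> real" where "finite Q" "Q \<subseteq> \<rat>"
    "\<And>u::real. \<bar>u\<bar> \<le> m \<Longrightarrow> \<bar>u - \<psi> {r\<in>Q. r < u}\<bar> \<le> e" "\<And>X. X \<subseteq> Q \<Longrightarrow> \<bar>\<psi> X\<bar> \<le> m"
    "mono (\<lambda>u. \<psi> {r\<in>Q. r < u})"
proof -
  obtain K :: nat where K: "0 < K" "1 / real K < e"
    using nat_approx_posE[OF assms] by (metis zero_less_Suc)
  define Q where "Q = (\<lambda>i. of_int i / real K) ` {- int (m * K)..int (m * K)}"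
  \<comment> \<open>The extra element \<open>- real m\<close> is the value when no threshold lies
    below \<open>u\<close>, as for \<open>u = - m\<close>.\<close>
  define \<psi> where "\<psi> X = Max (insert (- real m) X)" for X
  have Q: "finite Q" "Q \<subseteq> \<rat>" by (auto simp: Q_def)
  have Qm: "\<bar>r\<bar> \<le> m" if "r \<in> Q" for r
  proof -
    obtain i :: int where i': "r = of_int i / real K" "i \<in> {- int (m * K)..int (m * K)}"
      using \<open>r \<in> Q\<close> unfolding Q_def by (rule imageE)
    then have i: "r = of_int i / real K" "\<bar>i\<bar> \<le> int (m * K)" by auto
    then have "\<bar>real_of_int i\<bar> \<le> real m * real K" using of_int_le_iff[of "\<bar>i\<bar>" "int (m * K)", where ?'a=real] by simp
    then show ?thesis using K by (simp add: i(1) field_simps)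
  qed
  have psi_le: "\<bar>\<psi> X\<bar> \<le> m" if "X \<subseteq> Q" for X
  proof -
    have "finite X" using that Q finite_subset by blast
    then have "- real m \<le> \<psi> X" "\<psi> X \<le> real m"
      using Qm that by (auto simp: \<psi>_def abs_le_iff)
    then show ?thesis by simp
  qed
  have fin: "finite {r\<in>Q. r < u}" for u using Q by auto
  have "\<bar>u - \<psi> {r\<in>Q. r < u}\<bar> \<le> e" if u: "\<bar>u\<bar> \<le> m" for u :: real
  proof -
    have up: "\<psi> {r\<in>Q. r < u} \<le> u" using u fin by (auto simp: \<psi>_def)
    \<comment> \<open>The largest integer strictly below \<open>u * real K\<close>; strict because
      thresholds are compared by \<open>r < u\<close>.\<close>
    define i where "i = \<lceil>u * real K\<rceil> - 1"
    have i: "of_int i < u * real K" "u * real K \<le> of_int i + 1" unfolding i_def by linarith+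
    have "u - 1 / real K \<le> \<psi> {r\<in>Q. r < u}"
    proof (cases "- int (m * K) \<le> i")
      case True
      have "u * real K \<le> real m * real K" using u by (intro mult_right_mono) auto
      then have "real_of_int i < of_int (int (m * K))" using i(1) by simp
      then have "i \<le> int (m * K)" unfolding of_int_less_iff by simp
      then have "of_int i / real K \<in> {r\<in>Q. r < u}"
        using True i K by (auto simp: Q_def field_simps)
      then have "of_int i / real K \<le> \<psi> {r\<in>Q. r < u}" using fin unfolding \<psi>_def by (intro Max_ge) auto
      then show ?thesis using i(2) K by (simp add: field_simps)
    next
      case False
      then have "i + 1 \<le> - int (m * K)" by simp
      then have "real_of_int (i + 1) \<le> of_int (- int (m * K))" unfolding of_int_le_iff .
      then have "u * real K \<le> - (real m * real K)" using i(2) by simp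
      then have "u \<le> - real m" using K by (metis mult_minus_left mult_right_le_imp_le of_nat_0_less_iff)
      moreover have "- real m \<le> \<psi> {r\<in>Q. r < u}" using fin unfolding \<psi>_def by (intro Max_ge) auto
      moreover have "0 < 1 / real K" using K by simp
      ultimately show ?thesis by linarith
    qed
    then show ?thesis using up K by simp
  qed
  moreover have "mono (\<lambda>u. \<psi> {r\<in>Q. r < u})"
    unfolding \<psi>_def using fin by (auto intro!: monoI Max_mono)
  ultimately show thesis using psi_le by (intro that[OF Q]) auto
qed

text \<open>Bounded first moments make the family uniformly tight by Markov's inequality; this is
  the only property of profiles that total boundedness relies on.\<close>

definition bounded_laws :: "nat \<Rightarrow> real \<Rightarrow> (nat \<Rightarrow> real) measure set" where
  "bounded_laws d C = {\<mu>. prob_space \<mu> \<and> sets \<mu> = sets (Rspace d) \<and>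
     (\<forall>i<d. integrable \<mu> (\<lambda>x. x i) \<and> (\<integral>x. \<bar>x i\<bar> \<partial>\<mu>) \<le> C)}"

text \<open>Rounding moves each coordinate by at most \<open>e / (real d + 1)\<close> unless some
  coordinate reaches \<open>m\<close> in absolute value. Each of the \<open>d\<close> tails has
  probability at most \<open>C / m\<close>, so \<open>real d * C \<le> e * m\<close> makes the
  exceptional event small enough for \<open>lp_close_coupling\<close>.\<close>

lemma lp_close_rounding:
  assumes mu: "\<mu> \<in> bounded_laws d C" and e: "0 < e" and m: "0 < m" "real d * C \<le> e * m"
    and q: "\<And>u. \<bar>u\<bar> \<le> m \<Longrightarrow> \<bar>u - q u\<bar> \<le> e / (real d + 1)" and [measurable]: "q \<in> borel_measurable borel"
  shows "lp_close d \<mu> (distr \<mu> (Rspace d) (\<lambda>x. \<lambda>i\<in>{..<d}. q (x i))) e"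
proof -
  have S[measurable_cong]: "sets \<mu> = sets (Rspace d)" and "prob_space \<mu>" using mu by (auto simp: bounded_laws_def)
  interpret prob_space \<mu> by fact
  let ?r = "\<lambda>x. \<lambda>i\<in>{..<d}. q (x i)"
  have mi[measurable]: "(\<lambda>x. x i) \<in> borel_measurable \<mu>" if "i < d" for i using mu that by (auto simp: bounded_laws_def)
  have r: "?r \<in> \<mu> \<rightarrow>\<^sub>M Rspace d" by (intro measurable_restrict) auto
  have id: "(\<lambda>x. x) \<in> \<mu> \<rightarrow>\<^sub>M Rspace d" by measurable
  have tail: "measure \<mu> {x\<in>space \<mu>. m \<le> \<bar>x i\<bar>} \<le> C / m" if "i < d" for i
  proof -
    have "measure \<mu> {x\<in>space \<mu>. m \<le> \<bar>x i\<bar>} \<le> (\<integral>x. \<bar>x i\<bar> \<partial>\<mu>) / m"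
      using mu that m by (intro integral_Markov_inequality_measure[where A="{}"]) (auto simp: bounded_laws_def)
    also have "\<dots> \<le> C / m" using mu that m by (intro divide_right_mono) (auto simp: bounded_laws_def)
    finally show ?thesis .
  qed
  have "measure \<mu> {x\<in>space \<mu>. e \<le> eucl_dist d x (?r x)} \<le> measure \<mu> (\<Union>i<d. {x\<in>space \<mu>. m \<le> \<bar>x i\<bar>})"
  proof (intro finite_measure_mono subsetI)
    show "(\<Union>i<d. {x\<in>space \<mu>. m \<le> \<bar>x i\<bar>}) \<in> sets \<mu>" by (intro sets.finite_UN) auto
    fix x assume x: "x \<in> {x\<in>space \<mu>. e \<le> eucl_dist d x (?r x)}"
    show "x \<in> (\<Union>i<d. {x\<in>space \<mu>. m \<le> \<bar>x i\<bar>})"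
    proof (rule ccontr)
      assume "x \<notin> (\<Union>i<d. {x\<in>space \<mu>. m \<le> \<bar>x i\<bar>})"
      then have b: "\<bar>x i\<bar> \<le> m" if "i < d" for i using x that by force
      have "eucl_dist d x (?r x) \<le> (\<Sum>i<d. \<bar>x i - ?r x i\<bar>)" by (rule eucl_dist_le_sum)
      also have "\<dots> \<le> (\<Sum>i<d. e / (real d + 1))" using b q by (intro sum_mono) auto
      also have "\<dots> = e * (real d / (real d + 1))" by simp
      also have "\<dots> < e * 1" using e by (intro mult_strict_left_mono) auto
      finally show False using x by simp
    qed
  qed
  also have "\<dots> \<le> (\<Sum>i<d. measure \<mu> {x\<in>space \<mu>. m \<le> \<bar>x i\<bar>})"
    by (intro finite_measure_subadditive_finite) auto
  also have "\<dots> \<le> (\<Sum>i<d. C / m)" by (intro sum_mono tail) auto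
  also have "\<dots> \<le> e" using m by (simp add: field_simps)
  finally have "lp_close d (distr \<mu> (Rspace d) (\<lambda>x. x)) (distr \<mu> (Rspace d) ?r) e"
    by (intro lp_close_coupling id r \<open>prob_space \<mu>\<close>)
  then show ?thesis using distr_id2[OF S[symmetric]] by simp
qed

text \<open>After rounding the coordinates to a finite grid \<open>G\<close>, and the probabilities
  of grid points down to multiples of \<open>1 / K\<close>, only finitely many data
  \<open>\<tau> \<mu>\<close> remain. Laws with equal data have roundings that differ by at most
  \<open>card G / K\<close> in total. The chain from a law to its rounding, to the other rounding,
  to the other law costs \<open>e / 3\<close> per link.\<close>

lemma bounded_laws_totally_bounded:
  assumes e: "0 < e"
  obtains \<U> where "finite \<U>" "bounded_laws d C \<subseteq> \<Union>\<U>"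
    "\<And>U \<mu> \<nu>. U \<in> \<U> \<Longrightarrow> \<mu> \<in> U \<Longrightarrow> \<nu> \<in> U \<Longrightarrow> lp_close d \<mu> \<nu> e"
proof -
  define e' where "e' = e / 3"
  have e': "0 < e'" using e by (simp add: e'_def)
  obtain m :: nat where m: "0 < m" "real d * C \<le> e' * m"
  proof -
    obtain m :: nat where "max 1 (real d * C / e') < m" using reals_Archimedean2 by blast
    then show thesis using that[of m] e' by (auto simp: field_simps)
  qed
  obtain Q \<psi> where Q: "finite Q" "Q \<subseteq> \<rat>" and
    q: "\<And>u::real. \<bar>u\<bar> \<le> m \<Longrightarrow> \<bar>u - \<psi> {r\<in>Q. r < u}\<bar> \<le> e' / (real d + 1)"
    and mono: "mono (\<lambda>u. \<psi> {r\<in>Q. r < u} :: real)"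
    by (rule rational_rounding[of "e' / (real d + 1)" m]) (use e' in auto)
  define q where "q u = \<psi> {r\<in>Q. r < u}" for u
  have [measurable]: "q \<in> borel_measurable borel" using mono by (auto simp: q_def[abs_def] intro: borel_measurable_mono)
  define G where "G = PiE {..<d} (\<lambda>_. \<psi> ` Pow Q)"
  have G: "finite G" unfolding G_def using Q by (intro finite_PiE) auto
  define r where "r x = (\<lambda>i\<in>{..<d}. q (x i))" for x :: "nat \<Rightarrow> real"
  have rG: "r x \<in> G" for x by (auto simp: G_def r_def q_def)
  obtain K :: nat where K: "0 < K" "real (card G) / K \<le> e'"
  proof -
    obtain K :: nat where "max 1 (real (card G) / e') < K" using reals_Archimedean2 by blast
    then show thesis using that[of K] e' by (auto simp: field_simps)
  qed
  define \<tau> where "\<tau> \<mu> = (\<lambda>z\<in>G. \<lfloor>K * measure \<mu> {x\<in>space \<mu>. r x = z}\<rfloor>)" for \<mu>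
  define \<U> where "\<U> = (\<lambda>g. {\<mu> \<in> bounded_laws d C. \<tau> \<mu> = g}) ` PiE G (\<lambda>_. {0..int K})"
  show thesis
  proof (rule that)
    show "finite \<U>" unfolding \<U>_def using G by (intro finite_imageI finite_PiE) auto
    have "\<tau> \<mu> \<in> PiE G (\<lambda>_. {0..int K})" if "\<mu> \<in> bounded_laws d C" for \<mu>
    proof -
      have "prob_space \<mu>" using that by (auto simp: bounded_laws_def)
      then have "measure \<mu> A \<le> 1" for A by (rule prob_space.prob_le_1)
      then have "real K * measure \<mu> A \<le> real K * 1" for A by (intro mult_left_mono) auto
      then have "\<lfloor>real K * measure \<mu> A\<rfloor> \<le> int K" for A
        unfolding floor_le_iff by (rule le_less_trans) simp
      then show ?thesis by (auto simp: \<tau>_def)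
    qed
    then show "bounded_laws d C \<subseteq> \<Union>\<U>" by (auto simp: \<U>_def)
    fix U \<mu> \<nu> assume "U \<in> \<U>" "\<mu> \<in> U" "\<nu> \<in> U"
    then have mu: "\<mu> \<in> bounded_laws d C" "\<nu> \<in> bounded_laws d C" and eq: "\<tau> \<mu> = \<tau> \<nu>" by (auto simp: \<U>_def)
    then have P: "prob_space \<mu>" "prob_space \<nu>" and S[measurable_cong]: "sets \<mu> = sets (Rspace d)" "sets \<nu> = sets (Rspace d)"
      by (auto simp: bounded_laws_def)
    have mr: "r \<in> \<mu> \<rightarrow>\<^sub>M Rspace d" "r \<in> \<nu> \<rightarrow>\<^sub>M Rspace d"
      unfolding r_def[abs_def] by (auto intro!: measurable_restrict)
    have d: "\<bar>measure \<mu> {x\<in>space \<mu>. r x = z} - measure \<nu> {x\<in>space \<nu>. r x = z}\<bar> \<le> 1 / K" if "z \<in> G" for z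
    proof -
      have "\<lfloor>K * measure \<mu> {x\<in>space \<mu>. r x = z}\<rfloor> = \<lfloor>K * measure \<nu> {x\<in>space \<nu>. r x = z}\<rfloor>"
        using eq that by (auto simp: \<tau>_def dest: fun_cong[of _ _ z])
      then have "\<bar>K * measure \<mu> {x\<in>space \<mu>. r x = z} - K * measure \<nu> {x\<in>space \<nu>. r x = z}\<bar> \<le> 1"
        by linarith
      then have "real K * \<bar>measure \<mu> {x\<in>space \<mu>. r x = z} - measure \<nu> {x\<in>space \<nu>. r x = z}\<bar> \<le> 1"
        by (simp add: abs_mult right_diff_distrib[symmetric])
      then show ?thesis using K by (simp add: field_simps)
    qed
    have "(\<Sum>z\<in>G. \<bar>measure \<mu> {x\<in>space \<mu>. r x = z} - measure \<nu> {x\<in>space \<nu>. r x = z}\<bar>) \<le> (\<Sum>z\<in>G. 1 / K)"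
      by (intro sum_mono d)
    also have "\<dots> \<le> e'" using K by simp
    finally have 2: "lp_close d (distr \<mu> (Rspace d) r) (distr \<nu> (Rspace d) r) e'"
    proof (intro lp_close_finite_range[OF P mr G rG rG e'])
      have "{x\<in>space \<mu>. r x = z} = space \<mu> \<inter> (\<Inter>i<d. {x\<in>space \<mu>. q (x i) = z i})" if "z \<in> G" for z
        using that by (auto simp: r_def G_def PiE_def extensional_def fun_eq_iff)
      moreover have "{x\<in>space \<mu>. q (x i) = z i} \<in> sets \<mu>" if "i < d" for i z
      proof -
        have [measurable]: "(\<lambda>x. x i) \<in> borel_measurable \<mu>" using mu that by (auto simp: bounded_laws_def)
        show ?thesis by measurable
      qed
      ultimately show "{x\<in>space \<mu>. r x = z} \<in> sets \<mu>" if "z \<in> G" for z using that by auto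
      have "{x\<in>space \<nu>. r x = z} = space \<nu> \<inter> (\<Inter>i<d. {x\<in>space \<nu>. q (x i) = z i})" if "z \<in> G" for z
        using that by (auto simp: r_def G_def PiE_def extensional_def fun_eq_iff)
      moreover have "{x\<in>space \<nu>. q (x i) = z i} \<in> sets \<nu>" if "i < d" for i z
      proof -
        have [measurable]: "(\<lambda>x. x i) \<in> borel_measurable \<nu>" using mu that by (auto simp: bounded_laws_def)
        show ?thesis by measurable
      qed
      ultimately show "{x\<in>space \<nu>. r x = z} \<in> sets \<nu>" if "z \<in> G" for z using that by auto
    qed
    have 1: "lp_close d \<mu> (distr \<mu> (Rspace d) r) e'" "lp_close d \<nu> (distr \<nu> (Rspace d) r) e'"
      unfolding r_def[abs_def] using m q
      by (auto intro!: lp_close_rounding[OF _ e', where m = "real m"] mu simp: q_def[symmetric])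
    have f: "finite_measure \<mu>" "finite_measure \<nu>" "finite_measure (distr \<mu> (Rspace d) r)" "finite_measure (distr \<nu> (Rspace d) r)"
      using P prob_space.prob_space_distr[OF P(1) mr(1)] prob_space.prob_space_distr[OF P(2) mr(2)]
      by (auto intro: prob_space.finite_measure)
    have "lp_close d \<mu> (distr \<nu> (Rspace d) r) (e' + e')"
      by (rule lp_close_trans[OF 1(1) 2]) (use f S in auto)
    then have "lp_close d \<mu> \<nu> (e' + e' + e')"
      by (rule lp_close_trans[OF _ lp_close_sym[OF 1(2)]]) (use f S in auto)
    then show "lp_close d \<mu> \<nu> e" by (simp add: e'_def)
  qed
qed

section \<open>Functions of finitely many sets\<close>

text \<open>The increments have summable norms, so their series converges absolutely almost
  everywhere, and its tails bound the distance to the limit.\<close>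

lemma L1_fast_Cauchy:
  fixes f :: "nat \<Rightarrow> 'a \<Rightarrow> real"
  assumes f: "\<And>k. integrable M (f k)" and le: "\<And>k. (\<integral>x. \<bar>f (Suc k) x - f k x\<bar> \<partial>M) \<le> C * (1/2) ^ k"
  shows "\<exists>g. integrable M g \<and> (\<lambda>k. \<integral>x. \<bar>f k x - g x\<bar> \<partial>M) \<longlonglongrightarrow> 0"
proof -
  define h where "h k x = f (Suc k) x - f k x" for k x
  have h: "integrable M (h k)" for k using f by (auto simp: h_def[abs_def])
  have sC: "summable (\<lambda>k. C * (1/2::real) ^ k)" by (intro summable_mult summable_geometric) auto
  have s1: "summable (\<lambda>k. \<integral>x. norm (h k x) \<partial>M)"
    by (rule summable_comparison_test'[OF sC, of 0]) (use le in \<open>auto simp: h_def\<close>)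
  have "(\<integral>\<^sup>+x. (\<Sum>k. ennreal (norm (h k x))) \<partial>M) = (\<Sum>k. \<integral>\<^sup>+x. ennreal (norm (h k x)) \<partial>M)"
    using h by (intro nn_integral_suminf) auto
  also have "\<dots> = (\<Sum>k. ennreal (\<integral>x. norm (h k x) \<partial>M))"
    using h by (intro suminf_cong nn_integral_eq_integral) auto
  also have "\<dots> \<noteq> \<infinity>" using s1 by (auto simp: suminf_ennreal2)
  finally have "AE x in M. (\<Sum>k. ennreal (norm (h k x))) \<noteq> \<infinity>"
    using h by (intro nn_integral_PInf_AE) auto
  then have s2: "AE x in M. summable (\<lambda>k. norm (h k x))"
    by eventually_elim (rule summable_suminf_not_top, auto)
  define g where "g x = f 0 x + (\<Sum>k. h k x)" for x
  have g: "integrable M g"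
    unfolding g_def using integrable_suminf[OF h s2 s1] f by auto
  have "(\<integral>x. \<bar>f k x - g x\<bar> \<partial>M) \<le> (\<Sum>i. \<integral>x. norm (h (i + k) x) \<partial>M)" for k
  proof -
    have s1': "summable (\<lambda>i. \<integral>x. norm (h (i + k) x) \<partial>M)" using s1 by (rule summable_ignore_initial_segment)
    have s2': "AE x in M. summable (\<lambda>i. norm (h (i + k) x))"
      using s2 by eventually_elim (rule summable_ignore_initial_segment)
    have n: "integrable M (\<lambda>x. norm (h (i + k) x))" for i using h by auto
    have s2'': "AE x in M. summable (\<lambda>i. norm (norm (h (i + k) x)))" using s2' by simp
    have s1'': "summable (\<lambda>i. \<integral>x. norm (norm (h (i + k) x)) \<partial>M)" using s1' by simp
    have "(\<integral>x. \<bar>f k x - g x\<bar> \<partial>M) \<le> (\<integral>x. (\<Sum>i. norm (h (i + k) x)) \<partial>M)"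
    proof (rule integral_mono_AE)
      show "integrable M (\<lambda>x. \<Sum>i. norm (h (i + k) x))"
        by (rule integrable_suminf[OF n s2'' s1''])
      show "AE x in M. \<bar>f k x - g x\<bar> \<le> (\<Sum>i. norm (h (i + k) x))"
        using s2
      proof eventually_elim
        fix x assume s: "summable (\<lambda>k. norm (h k x))"
        have "(\<Sum>i<k. h i x) = f k x - f 0 x" unfolding h_def by (induction k) auto
        then have "g x - f k x = (\<Sum>i. h (i + k) x)"
          using suminf_split_initial_segment[OF summable_norm_cancel[OF s], of k] by (simp add: g_def)
        moreover have "norm (\<Sum>i. h (i + k) x) \<le> (\<Sum>i. norm (h (i + k) x))"
          by (intro summable_norm summable_ignore_initial_segment s)
        ultimately show "\<bar>f k x - g x\<bar> \<le> (\<Sum>i. norm (h (i + k) x))"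
          by (metis abs_minus_commute real_norm_def)
      qed
    qed (use f g in auto)
    also have "\<dots> = (\<Sum>i. \<integral>x. norm (h (i + k) x) \<partial>M)"
      by (rule integral_suminf[OF n s2'' s1''])
    finally show ?thesis .
  qed
  moreover have "(\<lambda>k. \<Sum>i. \<integral>x. norm (h (i + k) x) \<partial>M) \<longlonglongrightarrow> 0"
    by (rule suminf_exist_split2[OF s1])
  ultimately have "(\<lambda>k. \<integral>x. \<bar>f k x - g x\<bar> \<partial>M) \<longlonglongrightarrow> 0"
    by - (rule tendsto_sandwich[OF always_eventually always_eventually tendsto_const], simp_all)
  then show ?thesis using g by blast
qed

text \<open>An argument \<open>s\<close> is meant to be the set of indices of those coded sets that
  contain a given point; the bound \<open>J\<close> says that only finitely many of the sets
  matter.\<close>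

definition finitary :: "(nat set \<Rightarrow> real) \<Rightarrow> bool" where
  "finitary \<Phi> \<longleftrightarrow> (\<exists>J. \<forall>s. \<Phi> s = \<Phi> (s \<inter> {..<J}))"

lemma finitary_const [intro, simp]: "finitary (\<lambda>_. c)"
  by (simp add: finitary_def)

lemma finitary_comp: "finitary \<Phi> \<Longrightarrow> finitary (\<lambda>s. f (\<Phi> s))"
  unfolding finitary_def by metis

lemma finitary_comp2:
  assumes "finitary \<Phi>" "finitary \<Psi>"
  shows "finitary (\<lambda>s. f (\<Phi> s) (\<Psi> s))"
proof -
  obtain J K where J: "\<And>s. \<Phi> s = \<Phi> (s \<inter> {..<J})" and K: "\<And>s. \<Psi> s = \<Psi> (s \<inter> {..<K})"
    using assms unfolding finitary_def by blast
  have "s \<inter> {..<max J K} \<inter> {..<J} = s \<inter> {..<J}" "s \<inter> {..<max J K} \<inter> {..<K} = s \<inter> {..<K}" for s by auto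
  then have "\<Phi> s = \<Phi> (s \<inter> {..<max J K})" "\<Psi> s = \<Psi> (s \<inter> {..<max J K})" for s
    using J[of s] J[of "s \<inter> {..<max J K}"] K[of s] K[of "s \<inter> {..<max J K}"] by simp_all
  then show ?thesis unfolding finitary_def by metis
qed

lemma finitary_sum: "finite I \<Longrightarrow> (\<And>i. i \<in> I \<Longrightarrow> finitary (\<Phi> i)) \<Longrightarrow> finitary (\<lambda>s. \<Sum>i\<in>I. \<Phi> i s)"
  by (induction I rule: finite_induct) (auto intro: finitary_comp2)

lemma finitary_mem: "finitary (\<lambda>s. \<Phi> (i \<in> s))"
  unfolding finitary_def by (intro exI[of _ "Suc i"]) auto

lemma finitary_finite_set:
  assumes "finite Q"
  shows "finitary (\<lambda>s. \<Phi> (s \<inter> Q))"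
proof -
  obtain J where "Q \<subseteq> {..<J}" using assms finite_nat_bounded by blast
  then have "s \<inter> {..<J} \<inter> Q = s \<inter> Q" for s by auto
  then show ?thesis unfolding finitary_def by metis
qed

lemma finitary_decomp:
  assumes "\<And>s. \<Phi> s = \<Phi> (s \<inter> {..<J})"
  shows "\<Phi> t = (\<Sum>s\<in>Pow {..<J::nat}. \<Phi> s * indicator {t. t \<inter> {..<J} = s} t :: real)"
proof -
  have "(\<Sum>s\<in>Pow {..<J}. \<Phi> s * indicator {t. t \<inter> {..<J} = s} t) =
     (\<Sum>s\<in>Pow {..<J}. if s = t \<inter> {..<J} then \<Phi> s else 0)"
    by (intro sum.cong) (auto simp: indicator_def)
  also have "\<dots> = \<Phi> (t \<inter> {..<J})" by (subst sum.delta) auto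
  finally show ?thesis using assms by metis
qed

lemma finitary_bounded:
  assumes "finitary \<Phi>"
  obtains R where "0 \<le> R" "\<And>s. \<bar>\<Phi> s\<bar> \<le> R"
proof -
  obtain J where J: "\<And>s. \<Phi> s = \<Phi> (s \<inter> {..<J})" using assms unfolding finitary_def by blast
  define R where "R = Max ((\<lambda>s. \<bar>\<Phi> s\<bar>) ` Pow {..<J})"
  have "\<bar>\<Phi> s\<bar> \<le> R" for s
    unfolding R_def by (subst J, intro Max_ge) auto
  then show thesis using that[of R] by (meson abs_ge_zero order_trans)
qed

lemma finitary_finite_range: "finitary \<Phi> \<Longrightarrow> finite (range \<Phi>)"
proof -
  assume "finitary \<Phi>"
  then obtain J where J: "\<And>s. \<Phi> s = \<Phi> (s \<inter> {..<J})" unfolding finitary_def by blast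
  then have "range \<Phi> \<subseteq> \<Phi> ` Pow {..<J}" by auto
  then show ?thesis by (rule finite_subset) auto
qed

definition code_measurable :: "'a measure \<Rightarrow> ('a \<Rightarrow> nat set) \<Rightarrow> bool" where
  "code_measurable M \<kappa> \<longleftrightarrow> (\<forall>j. {x\<in>space M. j \<in> \<kappa> x} \<in> sets M)"

lemma sets_code_cylinder:
  assumes "code_measurable M \<kappa>"
  shows "{x\<in>space M. \<kappa> x \<inter> {..<J} = s} \<in> sets M"
proof (cases "s \<subseteq> {..<J}")
  case True
  have "{x\<in>space M. j \<in> \<kappa> x \<longleftrightarrow> j \<in> s} \<in> sets M" for j
  proof (cases "j \<in> s")
    case False
    have "{x\<in>space M. j \<in> \<kappa> x \<longleftrightarrow> j \<in> s} = space M - {x\<in>space M. j \<in> \<kappa> x}" using False by auto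
    then show ?thesis using assms by (auto simp: code_measurable_def)
  qed (use assms in \<open>auto simp: code_measurable_def\<close>)
  moreover have "{x\<in>space M. \<kappa> x \<inter> {..<J} = s} = space M \<inter> (\<Inter>j<J. {x\<in>space M. j \<in> \<kappa> x \<longleftrightarrow> j \<in> s})"
    using True by auto
  ultimately show ?thesis by auto
next
  case False
  then have "{x\<in>space M. \<kappa> x \<inter> {..<J} = s} = {}" by auto
  then show ?thesis by (metis sets.empty_sets)
qed

lemma measurable_finitary:
  assumes "code_measurable M \<kappa>" "finitary \<Phi>"
  shows "(\<lambda>x. \<Phi> (\<kappa> x)) \<in> borel_measurable M"
proof -
  obtain J where J: "\<And>s. \<Phi> s = \<Phi> (s \<inter> {..<J})" using assms unfolding finitary_def by blast
  have [measurable]: "{x\<in>space M. \<kappa> x \<inter> {..<J} = s} \<in> sets M" for s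
    by (rule sets_code_cylinder[OF assms(1)])
  have "(\<lambda>x. \<Sum>s\<in>Pow {..<J}. \<Phi> s * indicator {x\<in>space M. \<kappa> x \<inter> {..<J} = s} x :: real) \<in> borel_measurable M"
    by (intro borel_measurable_sum borel_measurable_times borel_measurable_const borel_measurable_indicator)
      measurable
  then show ?thesis
    by (rule measurable_cong[THEN iffD1, rotated])
      (subst finitary_decomp[of \<Phi>, OF J], auto intro!: sum.cong simp: indicator_def)
qed

lemma integrable_finitary:
  assumes "prob_space M" "code_measurable M \<kappa>" "finitary \<Phi>"
  shows "integrable M (\<lambda>x. \<Phi> (\<kappa> x))"
proof -
  interpret prob_space M by fact
  obtain R where "\<And>s. \<bar>\<Phi> s\<bar> \<le> R" using finitary_bounded[OF assms(3)] by blast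
  then show ?thesis
    by (intro integrable_const_bound[where B=R] measurable_finitary assms) auto
qed

lemma integral_finitary:
  assumes "prob_space M" "code_measurable M \<kappa>" "\<And>s. \<Phi> s = \<Phi> (s \<inter> {..<J})"
  shows "(\<integral>x. \<Phi> (\<kappa> x) \<partial>M) = (\<Sum>s\<in>Pow {..<J}. \<Phi> s * measure M {x\<in>space M. \<kappa> x \<inter> {..<J} = s})"
proof -
  interpret prob_space M by fact
  have [measurable]: "{x\<in>space M. \<kappa> x \<inter> {..<J} = s} \<in> sets M" for s
    by (rule sets_code_cylinder[OF assms(2)])
  then have [simp]: "integrable M (indicat_real {x\<in>space M. \<kappa> x \<inter> {..<J} = s})" for s
    by (intro integrable_real_indicator) (auto simp: emeasure_eq_measure)
  have "(\<integral>x. \<Phi> (\<kappa> x) \<partial>M) = (\<integral>x. (\<Sum>s\<in>Pow {..<J}. \<Phi> s * indicator {x\<in>space M. \<kappa> x \<inter> {..<J} = s} x) \<partial>M)"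
    by (intro Bochner_Integration.integral_cong refl)
      (subst finitary_decomp[of \<Phi>, OF assms(3)], auto intro!: sum.cong simp: indicator_def)
  also have "\<dots> = (\<Sum>s\<in>Pow {..<J}. \<Phi> s * measure M {x\<in>space M. \<kappa> x \<inter> {..<J} = s})"
    by (subst Bochner_Integration.integral_sum) auto
  finally show ?thesis .
qed

definition code_cylinders :: "'a set \<Rightarrow> ('a \<Rightarrow> nat set) \<Rightarrow> 'a set set" where
  "code_cylinders \<Omega> \<kappa> = range (\<lambda>(J, s). {x\<in>\<Omega>. \<kappa> x \<inter> {..<J} = s})"

lemma Int_stable_code_cylinders: "Int_stable (code_cylinders \<Omega> \<kappa>)"
proof (rule Int_stableI)
  have *: "{x\<in>\<Omega>. \<kappa> x \<inter> {..<J} = s} \<inter> {x\<in>\<Omega>. \<kappa> x \<inter> {..<K} = t} \<in> code_cylinders \<Omega> \<kappa>" if "J \<le> K" for J K s t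
  proof (cases "t \<inter> {..<J} = s")
    case True
    have "{x\<in>\<Omega>. \<kappa> x \<inter> {..<J} = s} \<inter> {x\<in>\<Omega>. \<kappa> x \<inter> {..<K} = t} = {x\<in>\<Omega>. \<kappa> x \<inter> {..<K} = t}"
      using True that by auto
    then show ?thesis by (auto simp: code_cylinders_def intro!: image_eqI[of _ _ "(K, t)"])
  next
    case False
    have "\<kappa> x \<inter> {..<K} = t \<Longrightarrow> \<kappa> x \<inter> {..<J} = t \<inter> {..<J}" for x using that by auto
    \<comment> \<open>A cylinder with an impossible pattern: the intersection with the empty set
      \<open>{..<0}\<close> is never \<open>{0}\<close>. It presents the empty set as a member of
      \<open>code_cylinders\<close>.\<close>
    then have "{x\<in>\<Omega>. \<kappa> x \<inter> {..<J} = s} \<inter> {x\<in>\<Omega>. \<kappa> x \<inter> {..<K} = t} = {x\<in>\<Omega>. \<kappa> x \<inter> {..<0} = {0}}"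
      using False by auto
    then show ?thesis by (auto simp: code_cylinders_def intro!: image_eqI[of _ _ "(0, {0})"])
  qed
  fix A B assume "A \<in> code_cylinders \<Omega> \<kappa>" "B \<in> code_cylinders \<Omega> \<kappa>"
  then obtain J s K t where AB: "A = {x\<in>\<Omega>. \<kappa> x \<inter> {..<J} = s}" "B = {x\<in>\<Omega>. \<kappa> x \<inter> {..<K} = t}"
    by (auto simp: code_cylinders_def)
  show "A \<inter> B \<in> code_cylinders \<Omega> \<kappa>"
    using *[of J K s t] *[of K J t s] unfolding AB by (metis Int_commute nle_le)
qed

text \<open>Induction over a sigma-algebra with an intersection-stable generator. Indicators of
  cylinders are finitary themselves, complements replace \<open>\<Phi>\<close> by
  \<open>1 - \<Phi>\<close>, and a disjoint union is cut off after \<open>n\<close> sets, where the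
  remaining measure is below \<open>e / 2\<close>.\<close>

lemma finitary_dense_sets:
  assumes "prob_space N" and cm: "code_measurable N \<kappa>" and gen: "sets N = sigma_sets (space N) (code_cylinders (space N) \<kappa>)"
    and A: "A \<in> sets N" and "0 < e"
  shows "\<exists>\<Phi>. finitary \<Phi> \<and> (\<integral>x. \<bar>indicator A x - \<Phi> (\<kappa> x)\<bar> \<partial>N) < e"
proof -
  interpret prob_space N by fact
  have A': "A \<in> sigma_sets (space N) (code_cylinders (space N) \<kappa>)" using A gen by simp
  have "code_cylinders (space N) \<kappa> \<subseteq> Pow (space N)" by (auto simp: code_cylinders_def)
  from Int_stable_code_cylinders this A' have "\<forall>e>0. \<exists>\<Phi>. finitary \<Phi> \<and> (\<integral>x. \<bar>indicator A x - \<Phi> (\<kappa> x)\<bar> \<partial>N) < e"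
  proof (induction rule: sigma_sets_induct_disjoint)
    case (basic A)
    then obtain J s where A: "A = {x\<in>space N. \<kappa> x \<inter> {..<J} = s}" by (auto simp: code_cylinders_def)
    define \<Phi> :: "nat set \<Rightarrow> real" where "\<Phi> t = indicator {s} (t \<inter> {..<J})" for t
    have "finitary \<Phi>" unfolding \<Phi>_def by (intro finitary_finite_set) auto
    moreover have "(\<integral>x. \<bar>indicator A x - \<Phi> (\<kappa> x)\<bar> \<partial>N) = (\<integral>x. 0 \<partial>N)"
      by (intro Bochner_Integration.integral_cong) (auto simp: A \<Phi>_def indicator_def)
    ultimately show ?case by (intro allI impI exI[of _ \<Phi>]) auto
  next
    case empty
    show ?case by (intro allI impI exI[of _ "\<lambda>_. 0"]) auto
  next
    case (compl A)
    show ?case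
    proof (intro allI impI)
      fix e :: real assume "0 < e"
      then obtain \<Phi> where P: "finitary \<Phi>" "(\<integral>x. \<bar>indicator A x - \<Phi> (\<kappa> x)\<bar> \<partial>N) < e" using compl by blast
      have "(\<integral>x. \<bar>indicator (space N - A) x - (1 - \<Phi> (\<kappa> x))\<bar> \<partial>N) = (\<integral>x. \<bar>indicator A x - \<Phi> (\<kappa> x)\<bar> \<partial>N)"
        by (intro Bochner_Integration.integral_cong) (auto simp: indicator_def)
      then show "\<exists>\<Phi>. finitary \<Phi> \<and> (\<integral>x. \<bar>indicator (space N - A) x - \<Phi> (\<kappa> x)\<bar> \<partial>N) < e"
        using P by (intro exI[of _ "\<lambda>s. 1 - \<Phi> s"]) (auto intro: finitary_comp)
    qed
  next
    case (union A)
    have A: "A i \<in> sets N" for i using union gen by auto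
    show ?case
    proof (intro allI impI)
      fix e :: real assume e: "0 < e"
      have "(\<lambda>n. \<Sum>i<n. prob (A i)) \<longlonglongrightarrow> prob (\<Union>i. A i)"
        using finite_measure_UNION[OF _ union(1)] A by (auto simp: sums_def)
      then obtain n where n: "\<bar>(\<Sum>i<n. prob (A i)) - prob (\<Union>i. A i)\<bar> < e / 2"
        using e by (metis LIMSEQ_D half_gt_zero order_refl real_norm_def)
      have "\<exists>\<Phi>. finitary \<Phi> \<and> (\<integral>x. \<bar>indicator (A i) x - \<Phi> (\<kappa> x)\<bar> \<partial>N) < e / (2 * (real n + 1))" for i
        using union(3) e by simp
      then obtain \<Phi> where P: "\<And>i. finitary (\<Phi> i)"
        "\<And>i. (\<integral>x. \<bar>indicator (A i) x - \<Phi> i (\<kappa> x)\<bar> \<partial>N) < e / (2 * (real n + 1))" by metis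
      have iP: "integrable N (\<lambda>x. \<Phi> i (\<kappa> x))" for i by (intro integrable_finitary P cm) fact
      have iA: "integrable N (indicator (A i) :: _ \<Rightarrow> real)" for i
        using A by (intro integrable_real_indicator) (auto simp: emeasure_eq_measure)
      have iU: "integrable N (indicator (\<Union>i. A i) :: _ \<Rightarrow> real)"
        using A by (intro integrable_real_indicator) (auto simp: emeasure_eq_measure)
      have eq: "indicator (\<Union>i. A i) x - (\<Sum>i<n. indicator (A i) x) \<ge> (0::real)" for x
      proof -
        have "(\<Sum>i<n. indicator (A i) x :: real) = indicator (\<Union>i<n. A i) x"
          using union(1) by (intro indicator_UN_disjoint[symmetric]) (auto simp: disjoint_family_on_def)
        also have "\<dots> \<le> indicator (\<Union>i. A i) x" by (auto simp: indicator_def)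
        finally show ?thesis by simp
      qed
      have "(\<integral>x. \<bar>indicator (\<Union>i. A i) x - (\<Sum>i<n. \<Phi> i (\<kappa> x))\<bar> \<partial>N) \<le>
        (\<integral>x. (indicator (\<Union>i. A i) x - (\<Sum>i<n. indicator (A i) x)) + (\<Sum>i<n. \<bar>indicator (A i) x - \<Phi> i (\<kappa> x)\<bar>) \<partial>N)"
      proof (rule integral_mono)
        fix x
        have "\<bar>\<Sum>i<n. indicator (A i) x - \<Phi> i (\<kappa> x)\<bar> \<le> (\<Sum>i<n. \<bar>indicator (A i) x - \<Phi> i (\<kappa> x)\<bar>)" by (rule sum_abs)
        then show "\<bar>indicator (\<Union>i. A i) x - (\<Sum>i<n. \<Phi> i (\<kappa> x))\<bar> \<le>
          (indicator (\<Union>i. A i) x - (\<Sum>i<n. indicator (A i) x)) + (\<Sum>i<n. \<bar>indicator (A i) x - \<Phi> i (\<kappa> x)\<bar>)"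
          using eq[of x] unfolding sum_subtractf by linarith
      qed (use iU iP iA in \<open>auto intro!: Bochner_Integration.integrable_add Bochner_Integration.integrable_diff Bochner_Integration.integrable_sum integrable_abs\<close>)
      also have "\<dots> = (\<integral>x. indicat_real (\<Union>i. A i) x - (\<Sum>i<n. indicat_real (A i) x) \<partial>N) + (\<integral>x. (\<Sum>i<n. \<bar>indicat_real (A i) x - \<Phi> i (\<kappa> x)\<bar>) \<partial>N)"
        using iU iP iA by (intro Bochner_Integration.integral_add Bochner_Integration.integrable_diff Bochner_Integration.integrable_sum integrable_abs) auto
      finally have "(\<integral>x. \<bar>indicator (\<Union>i. A i) x - (\<Sum>i<n. \<Phi> i (\<kappa> x))\<bar> \<partial>N) \<le> (\<integral>x. indicat_real (\<Union>i. A i) x - (\<Sum>i<n. indicat_real (A i) x) \<partial>N) + (\<integral>x. (\<Sum>i<n. \<bar>indicat_real (A i) x - \<Phi> i (\<kappa> x)\<bar>) \<partial>N)" .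
      moreover have "(\<integral>x. indicat_real (\<Union>i. A i) x - (\<Sum>i<n. indicat_real (A i) x) \<partial>N) = (\<integral>x. indicat_real (\<Union>i. A i) x \<partial>N) - (\<integral>x. (\<Sum>i<n. indicat_real (A i) x) \<partial>N)"
        using iU iA by (intro Bochner_Integration.integral_diff Bochner_Integration.integrable_sum) auto
      moreover have "(\<integral>x. (\<Sum>i<n. indicat_real (A i) x) \<partial>N) = (\<Sum>i<n. prob (A i))"
        using iA A by (subst Bochner_Integration.integral_sum) (auto simp: Int_absorb1 sets.sets_into_space)
      moreover have "(\<integral>x. indicat_real (\<Union>i. A i) x \<partial>N) = prob (\<Union>i. A i)"
        using A by (auto simp: Int_absorb1 sets.sets_into_space sets.countable_UN)
      moreover have "(\<integral>x. (\<Sum>i<n. \<bar>indicat_real (A i) x - \<Phi> i (\<kappa> x)\<bar>) \<partial>N) = (\<Sum>i<n. \<integral>x. \<bar>indicat_real (A i) x - \<Phi> i (\<kappa> x)\<bar> \<partial>N)"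
        using iP iA by (intro Bochner_Integration.integral_sum integrable_abs Bochner_Integration.integrable_diff) auto
      ultimately have "(\<integral>x. \<bar>indicator (\<Union>i. A i) x - (\<Sum>i<n. \<Phi> i (\<kappa> x))\<bar> \<partial>N) \<le>
        (prob (\<Union>i. A i) - (\<Sum>i<n. prob (A i))) + (\<Sum>i<n. \<integral>x. \<bar>indicator (A i) x - \<Phi> i (\<kappa> x)\<bar> \<partial>N)"
        by (simp only:)
      also have "\<dots> < e / 2 + e / 2"
      proof (rule add_less_le_mono)
        have "(\<Sum>i<n. \<integral>x. \<bar>indicator (A i) x - \<Phi> i (\<kappa> x)\<bar> \<partial>N) \<le> (\<Sum>i<n. e / (2 * (real n + 1)))"
          using P(2) by (intro sum_mono less_imp_le)
        also have "\<dots> \<le> e / 2" using e by (simp add: field_simps)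
        finally show "(\<Sum>i<n. \<integral>x. \<bar>indicator (A i) x - \<Phi> i (\<kappa> x)\<bar> \<partial>N) \<le> e / 2" .
      qed (use n in linarith)
      finally have "(\<integral>x. \<bar>indicator (\<Union>i. A i) x - (\<Sum>i<n. \<Phi> i (\<kappa> x))\<bar> \<partial>N) < e" by simp
      then show "\<exists>\<Phi>. finitary \<Phi> \<and> (\<integral>x. \<bar>indicator (\<Union>i. A i) x - \<Phi> (\<kappa> x)\<bar> \<partial>N) < e"
        by (intro exI[of _ "\<lambda>s. \<Sum>i<n. \<Phi> i s"]) (auto intro!: finitary_sum P)
    qed
  qed
  then show ?thesis using \<open>0 < e\<close> by blast
qed

lemma finitary_dense:
  assumes "prob_space N" and cm: "code_measurable N \<kappa>" and gen: "sets N = sigma_sets (space N) (code_cylinders (space N) \<kappa>)"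
    and g: "integrable N g" and "0 < e"
  shows "\<exists>\<Phi>. finitary \<Phi> \<and> (\<integral>x. \<bar>g x - \<Phi> (\<kappa> x)\<bar> \<partial>N) < e"
proof -
  interpret prob_space N by fact
  have "\<forall>e>0. \<exists>\<Phi>. finitary \<Phi> \<and> (\<integral>x. \<bar>g x - \<Phi> (\<kappa> x)\<bar> \<partial>N) < e"
    using g
  proof (induction g rule: integrable_induct)
    case (base A c)
    show ?case
    proof (intro allI impI)
      fix e :: real assume e: "0 < e"
      obtain \<Phi> where P: "finitary \<Phi>" "(\<integral>x. \<bar>indicator A x - \<Phi> (\<kappa> x)\<bar> \<partial>N) < e / (\<bar>c\<bar> + 1)"
        using finitary_dense_sets[OF assms(1) cm gen base(1), of "e / (\<bar>c\<bar> + 1)"] e by auto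
      have "(\<integral>x. \<bar>indicator A x *\<^sub>R c - c * \<Phi> (\<kappa> x)\<bar> \<partial>N) = (\<integral>x. \<bar>c\<bar> * \<bar>indicator A x - \<Phi> (\<kappa> x)\<bar> \<partial>N)"
        by (intro Bochner_Integration.integral_cong refl) (simp add: abs_mult[symmetric] algebra_simps)
      also have "\<dots> = \<bar>c\<bar> * (\<integral>x. \<bar>indicator A x - \<Phi> (\<kappa> x)\<bar> \<partial>N)" by simp
      also have "\<dots> \<le> \<bar>c\<bar> * (e / (\<bar>c\<bar> + 1))" using P(2) by (intro mult_left_mono) auto
      also have "\<dots> < e" using e by (simp add: field_simps)
      finally show "\<exists>\<Phi>. finitary \<Phi> \<and> (\<integral>x. \<bar>indicator A x *\<^sub>R c - \<Phi> (\<kappa> x)\<bar> \<partial>N) < e"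
        using P(1) by (intro exI[of _ "\<lambda>s. c * \<Phi> s"]) (auto intro: finitary_comp)
    qed
  next
    case (add f g)
    show ?case
    proof (intro allI impI)
      fix e :: real assume e: "0 < e"
      obtain \<Phi> where P: "finitary \<Phi>" "(\<integral>x. \<bar>f x - \<Phi> (\<kappa> x)\<bar> \<partial>N) < e / 2" using add e half_gt_zero by blast
      obtain \<Psi> where Q: "finitary \<Psi>" "(\<integral>x. \<bar>g x - \<Psi> (\<kappa> x)\<bar> \<partial>N) < e / 2" using add e half_gt_zero by blast
      note i = integrable_finitary[OF assms(1) cm P(1)] integrable_finitary[OF assms(1) cm Q(1)]
      have "(\<integral>x. \<bar>f x + g x - (\<Phi> (\<kappa> x) + \<Psi> (\<kappa> x))\<bar> \<partial>N) \<le> (\<integral>x. \<bar>f x - \<Phi> (\<kappa> x)\<bar> + \<bar>g x - \<Psi> (\<kappa> x)\<bar> \<partial>N)"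
        using i add by (intro integral_mono) auto
      also have "\<dots> = (\<integral>x. \<bar>f x - \<Phi> (\<kappa> x)\<bar> \<partial>N) + (\<integral>x. \<bar>g x - \<Psi> (\<kappa> x)\<bar> \<partial>N)"
        using i add by (intro Bochner_Integration.integral_add) auto
      finally show "\<exists>\<Phi>. finitary \<Phi> \<and> (\<integral>x. \<bar>f x + g x - \<Phi> (\<kappa> x)\<bar> \<partial>N) < e"
        using P Q by (intro exI[of _ "\<lambda>s. \<Phi> s + \<Psi> s"]) (auto intro: finitary_comp2)
    qed
  next
    case (lim f s)
    show ?case
    proof (intro allI impI)
      fix e :: real assume e: "0 < e"
      have "(\<lambda>i. \<integral>x. \<bar>f x - s i x\<bar> \<partial>N) \<longlonglongrightarrow> (\<integral>x. 0 \<partial>N)"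
      \<comment> \<open>The induction rule supplies approximants bounded by twice \<open>f\<close>
        in absolute value, whence the majorant with factor 3.\<close>
      proof (rule integral_dominated_convergence[where w="\<lambda>x. 3 * \<bar>f x\<bar>"])
        show "AE x in N. (\<lambda>i. \<bar>f x - s i x\<bar>) \<longlonglongrightarrow> 0"
        proof (rule AE_I2)
          fix x assume "x \<in> space N"
          then have "(\<lambda>i. \<bar>f x - s i x\<bar>) \<longlonglongrightarrow> \<bar>f x - f x\<bar>" using lim by (intro tendsto_intros) auto
          then show "(\<lambda>i. \<bar>f x - s i x\<bar>) \<longlonglongrightarrow> 0" by simp
        qed
        show "AE x in N. norm \<bar>f x - s i x\<bar> \<le> 3 * \<bar>f x\<bar>" for i
        proof (rule AE_I2)
          fix x assume "x \<in> space N"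
          then have "norm (s i x) \<le> 2 * norm (f x)" using lim by auto
          then show "norm \<bar>f x - s i x\<bar> \<le> 3 * \<bar>f x\<bar>" by simp
        qed
      qed (use lim in \<open>auto intro!: borel_measurable_integrable\<close>)
      then obtain i where i: "\<bar>\<integral>x. \<bar>f x - s i x\<bar> \<partial>N\<bar> < e / 2"
        using e by (auto dest!: LIMSEQ_D[where r="e/2"])
      obtain \<Phi> where P: "finitary \<Phi>" "(\<integral>x. \<bar>s i x - \<Phi> (\<kappa> x)\<bar> \<partial>N) < e / 2" using lim e half_gt_zero by blast
      note ii = integrable_finitary[OF assms(1) cm P(1)]
      have "(\<integral>x. \<bar>f x - \<Phi> (\<kappa> x)\<bar> \<partial>N) \<le> (\<integral>x. \<bar>f x - s i x\<bar> + \<bar>s i x - \<Phi> (\<kappa> x)\<bar> \<partial>N)"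
        using ii lim by (intro integral_mono) auto
      also have "\<dots> = (\<integral>x. \<bar>f x - s i x\<bar> \<partial>N) + (\<integral>x. \<bar>s i x - \<Phi> (\<kappa> x)\<bar> \<partial>N)"
        using ii lim by (intro Bochner_Integration.integral_add) auto
      finally show "\<exists>\<Phi>. finitary \<Phi> \<and> (\<integral>x. \<bar>f x - \<Phi> (\<kappa> x)\<bar> \<partial>N) < e"
        using P i by (intro exI[of _ \<Phi>]) auto
    qed
  qed
  then show ?thesis using \<open>0 < e\<close> by blast
qed

section \<open>The limit space\<close>

text \<open>The intervals \<open>[left_end p J s, left_end p J s + p J s)\<close> with \<open>s \<subseteq> {..<J}\<close> form, for increasing \<open>J\<close>,
  successively finer partitions of \<open>[0, 1)\<close>.\<close>

primrec left_end :: "(nat \<Rightarrow> nat set \<Rightarrow> real) \<Rightarrow> nat \<Rightarrow> nat set \<Rightarrow> real" where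
  "left_end p 0 s = 0"
| "left_end p (Suc J) s = left_end p J (s \<inter> {..<J}) + (if J \<in> s then p (Suc J) (s \<inter> {..<J}) else 0)"

text \<open>A descent through the nested partitions: at each level the interval containing
  \<open>u\<close> splits into a left part, where \<open>J\<close> is left out, and a right part,
  where \<open>J\<close> is inserted.\<close>

primrec prefix_code :: "(nat \<Rightarrow> nat set \<Rightarrow> real) \<Rightarrow> real \<Rightarrow> nat \<Rightarrow> nat set" where
  "prefix_code p u 0 = {}"
| "prefix_code p u (Suc J) = (let s = prefix_code p u J in
     if left_end p J s + p (Suc J) s \<le> u then insert J s else s)"

lemma prefix_code_subset: "prefix_code p u J \<subseteq> {..<J}"
  by (induction J) (auto simp: Let_def less_Suc_eq split: if_splits)

lemma prefix_code_Int: "J \<le> K \<Longrightarrow> prefix_code p u K \<inter> {..<J} = prefix_code p u J"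
proof (induction K rule: dec_induct)
  case base
  then show ?case using prefix_code_subset[of p u J] by auto
next
  case (step K)
  then show ?case by (auto simp: Let_def)
qed

lemma borel_prefix_code: "{u. prefix_code p u J = s} \<in> sets borel"
proof (induction J arbitrary: s)
  case (Suc J)
  show ?case
  proof (cases "J \<in> s")
    case True
    have "{u. prefix_code p u (Suc J) = s} =
        {u. prefix_code p u J = s - {J}} \<inter> {left_end p J (s - {J}) + p (Suc J) (s - {J})..}"
    proof (rule Collect_cong[THEN trans])
      fix u
      have "J \<notin> prefix_code p u J" using prefix_code_subset[of p u J] by blast
      then have "insert J (prefix_code p u J) = s \<longleftrightarrow> prefix_code p u J = s - {J}" "prefix_code p u J \<noteq> s"
        using True by blast+
      then show "prefix_code p u (Suc J) = s \<longleftrightarrow>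
          prefix_code p u J = s - {J} \<and> left_end p J (s - {J}) + p (Suc J) (s - {J}) \<le> u"
        by (simp add: Let_def) metis
    qed auto
    then show ?thesis using Suc by auto
  next
    case False
    have "{u. prefix_code p u (Suc J) = s} =
        {u. prefix_code p u J = s} \<inter> {..<left_end p J s + p (Suc J) s}"
      using False by (auto simp: Let_def split: if_splits)
    then show ?thesis using Suc by auto
  qed
qed auto

text \<open>Additivity of \<open>p\<close> says that the two children of an interval fill it
  exactly, the right one beginning where the left one ends. So the prefix of a point of
  \<open>[0, 1)\<close> is the label of the interval that contains it.\<close>

lemma prefix_code_interval:
  assumes p: "\<And>J s. s \<subseteq> {..<J} \<Longrightarrow> 0 \<le> p J s" "p 0 {} = 1"
      "\<And>J s. s \<subseteq> {..<J} \<Longrightarrow> p J s = p (Suc J) s + p (Suc J) (insert J s)"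
    and s: "s \<subseteq> {..<J}"
  shows "0 \<le> left_end p J s \<and> left_end p J s + p J s \<le> 1 \<and>
    (\<forall>u\<in>{0..<1}. prefix_code p u J = s \<longleftrightarrow> left_end p J s \<le> u \<and> u < left_end p J s + p J s)"
  using s
proof (induction J arbitrary: s)
  case 0
  then show ?case using p(2) by auto
next
  case (Suc J)
  define t where "t = s \<inter> {..<J}"
  have t: "t \<subseteq> {..<J}" "J \<notin> t" by (auto simp: t_def)
  note IH = Suc.IH[OF t(1)]
  have pt: "p J t = p (Suc J) t + p (Suc J) (insert J t)" "0 \<le> p (Suc J) t" "0 \<le> p (Suc J) (insert J t)"
    using p(3)[OF t(1)] p(1)[of t "Suc J"] p(1)[of "insert J t" "Suc J"] t
    by (simp_all add: lessThan_Suc subset_insertI2)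
  have nJ: "J \<notin> prefix_code p u J" for u using prefix_code_subset[of p u J] by auto
  have e: "insert J (prefix_code p u J) = insert J t \<longleftrightarrow> prefix_code p u J = t"
      "insert J (prefix_code p u J) \<noteq> t" "prefix_code p u J \<noteq> insert J t" for u
    using insert_ident[OF nJ[of u] t(2)] nJ[of u] t(2) by (blast, blast, blast)
  show ?case
  proof (cases "J \<in> s")
    case True
    then have s: "s = insert J t" using Suc.prems by (auto simp: t_def less_Suc_eq)
    have "prefix_code p u (Suc J) = s \<longleftrightarrow> prefix_code p u J = t \<and> left_end p J t + p (Suc J) t \<le> u" for u
      by (simp add: Let_def s e) (metis not_le)
    moreover have l: "left_end p (Suc J) s = left_end p J t + p (Suc J) t" using True by (simp add: t_def)
    ultimately show ?thesis using IH pt s by (auto simp: l simp del: left_end.simps prefix_code.simps)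
  next
    case False
    then have s: "s = t" using Suc.prems by (auto simp: t_def less_Suc_eq)
    have "prefix_code p u (Suc J) = s \<longleftrightarrow> prefix_code p u J = t \<and> u < left_end p J t + p (Suc J) t" for u
      by (simp add: Let_def s e) (metis not_le)
    moreover have l: "left_end p (Suc J) s = left_end p J t" using False by (simp add: t_def)
    ultimately show ?thesis using IH pt s by (auto simp: l simp del: left_end.simps prefix_code.simps)
  qed
qed

text \<open>The uniform measure on \<open>[0, 1)\<close> is pushed forward along the digit map; the
  points with prefix \<open>s\<close> form an interval of length \<open>p J s\<close>. Sequences are
  real-valued to fit the type of the limit in the theorem, and the sigma-algebra is kept to the one
  generated by cylinders so that finitary functions are dense.\<close>

lemma measure_of_cylinder_probabilities:
  assumes p: "\<And>J s. s \<subseteq> {..<J} \<Longrightarrow> 0 \<le> p J s" "p 0 {} = 1"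
      "\<And>J s. s \<subseteq> {..<J} \<Longrightarrow> p J s = p (Suc J) s + p (Suc J) (insert J s)"
  obtains N :: "(nat \<Rightarrow> real) measure" where "prob_space N"
    "sets N = sigma_sets (space N) (code_cylinders (space N) (\<lambda>w. {j. w j = 1}))"
    "\<And>J s. s \<subseteq> {..<J} \<Longrightarrow> measure N {w\<in>space N. {j. w j = 1} \<inter> {..<J} = s} = p J s"
proof -
  define \<kappa> where "\<kappa> w = {j. w j = (1::real)}" for w :: "nat \<Rightarrow> real"
  define U where "U = uniform_measure lborel {0..<1::real}"
  define B where "B = sigma (UNIV :: (nat \<Rightarrow> real) set) (code_cylinders UNIV \<kappa>)"
  \<comment> \<open>Coordinate \<open>j\<close> of the digit sequence is settled from stage
    \<open>Suc j\<close> on, since later prefixes only add larger indices.\<close>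
  define h where "h u j = (if j \<in> prefix_code p u (Suc j) then 1 else 0 :: real)" for u j
  define N where "N = distr U B h"
  have U: "prob_space U" unfolding U_def by (rule prob_space_uniform_measure) auto
  have sU: "space U = UNIV" "sets U = sets borel" by (auto simp: U_def)
  have mem: "j \<in> prefix_code p u (Suc j) \<longleftrightarrow> j \<in> prefix_code p u J" if "j < J" for j J u
    using prefix_code_Int[of "Suc j" J p u] that by (metis Int_iff Suc_leI lessI lessThan_iff)
  have kh: "\<kappa> (h u) \<inter> {..<J} = prefix_code p u J" for u J
    using prefix_code_subset[of p u J] mem by (auto simp: \<kappa>_def h_def)
  have cyl: "{w. \<kappa> w \<inter> {..<J} = s} \<in> code_cylinders UNIV \<kappa>" for J s
    by (auto simp: code_cylinders_def intro!: image_eqI[of _ _ "(J, s)"])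
  have B: "space B = UNIV" "sets B = sigma_sets UNIV (code_cylinders UNIV \<kappa>)" by (auto simp: B_def)
  have h: "h \<in> U \<rightarrow>\<^sub>M B"
    unfolding B_def
  proof (rule measurable_sigma_sets)
    fix A assume "A \<in> code_cylinders UNIV \<kappa>"
    then obtain J s where A: "A = {w. \<kappa> w \<inter> {..<J} = s}" by (auto simp: code_cylinders_def)
    have "h -` A \<inter> space U = {u. prefix_code p u J = s}" by (auto simp: A kh sU)
    then show "h -` A \<inter> space U \<in> sets U" using borel_prefix_code by (simp add: sU)
  qed auto
  have "measure N {w\<in>space N. \<kappa> w \<inter> {..<J} = s} = p J s" if s: "s \<subseteq> {..<J}" for J s
  proof -
    have "measure N {w\<in>space N. \<kappa> w \<inter> {..<J} = s} = measure U {u. prefix_code p u J = s}"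
      unfolding N_def using cyl
      by (subst measure_distr[OF h]) (auto simp: B kh sU intro!: arg_cong[where f="measure U"] sigma_sets.Basic)
    also have "\<dots> = measure lborel ({0..<1} \<inter> {u. prefix_code p u J = s})"
      unfolding U_def by (subst measure_uniform_measure) (auto simp: borel_prefix_code)
    also have "{0..<1} \<inter> {u. prefix_code p u J = s} = {left_end p J s..<left_end p J s + p J s}"
      using prefix_code_interval[of p, OF p s] by auto
    also have "measure lborel \<dots> = p J s" using p(1)[OF s] by simp
    finally show ?thesis .
  qed
  moreover have "prob_space N" unfolding N_def by (intro prob_space.prob_space_distr U h)
  moreover have "sets N = sigma_sets (space N) (code_cylinders (space N) \<kappa>)" by (simp add: N_def B)
  moreover have "\<kappa> = (\<lambda>w. {j. w j = 1})" by (simp add: \<kappa>_def fun_eq_iff)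
  ultimately show thesis by (intro that[of N]) auto
qed

section \<open>Estimates in \<open>L^1\<close>, in particular for Lipschitz functions of two
  variables\<close>

lemma integrable_Lipschitz2:
  fixes \<phi> :: "real \<Rightarrow> real \<Rightarrow> real"
  assumes "prob_space P" "integrable P u" "integrable P v" and L: "0 < L"
    and lip: "\<And>a b a' b'. \<bar>\<phi> a b - \<phi> a' b'\<bar> \<le> L * (\<bar>a - a'\<bar> + \<bar>b - b'\<bar>)"
    and [measurable]: "(\<lambda>z. \<phi> (fst z) (snd z)) \<in> borel_measurable (borel :: (real \<times> real) measure)"
  shows "integrable P (\<lambda>x. \<phi> (u x) (v x))"
proof (rule Bochner_Integration.integrable_bound)
  interpret prob_space P by fact
  have [measurable]: "u \<in> borel_measurable P" "v \<in> borel_measurable P" using assms by auto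
  have "(\<lambda>x. \<phi> (fst (u x, v x)) (snd (u x, v x))) \<in> borel_measurable P" by measurable
  then show "(\<lambda>x. \<phi> (u x) (v x)) \<in> borel_measurable P" by simp
  show "integrable P (\<lambda>x. \<bar>\<phi> 0 0\<bar> + L * (\<bar>u x\<bar> + \<bar>v x\<bar>))"
    using assms by auto
  show "AE x in P. norm (\<phi> (u x) (v x)) \<le> norm (\<bar>\<phi> 0 0\<bar> + L * (\<bar>u x\<bar> + \<bar>v x\<bar>))"
  proof (rule AE_I2)
    fix x
    have "0 \<le> L * (\<bar>u x\<bar> + \<bar>v x\<bar>)" using L by simp
    then show "norm (\<phi> (u x) (v x)) \<le> norm (\<bar>\<phi> 0 0\<bar> + L * (\<bar>u x\<bar> + \<bar>v x\<bar>))"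
      using lip[of "u x" "v x" 0 0] unfolding real_norm_def diff_0_right by linarith
  qed
qed

lemma L1_Lipschitz2_less:
  fixes \<phi> :: "real \<Rightarrow> real \<Rightarrow> real"
  assumes P: "prob_space P" and i: "integrable P u" "integrable P v" "integrable P u'" "integrable P v'" and L: "0 < L"
    and lip: "\<And>a b a' b'. \<bar>\<phi> a b - \<phi> a' b'\<bar> \<le> L * (\<bar>a - a'\<bar> + \<bar>b - b'\<bar>)"
    and m: "(\<lambda>z. \<phi> (fst z) (snd z)) \<in> borel_measurable (borel :: (real \<times> real) measure)"
    and le: "(\<integral>x. \<bar>u x - u' x\<bar> \<partial>P) < e / (2 * L)" "(\<integral>x. \<bar>v x - v' x\<bar> \<partial>P) < e / (2 * L)"
  shows "(\<integral>x. \<bar>\<phi> (u x) (v x) - \<phi> (u' x) (v' x)\<bar> \<partial>P) < e"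
proof -
  note int = integrable_Lipschitz2[OF P _ _ L lip m]
  have "(\<integral>x. \<bar>\<phi> (u x) (v x) - \<phi> (u' x) (v' x)\<bar> \<partial>P) \<le> (\<integral>x. L * (\<bar>u x - u' x\<bar> + \<bar>v x - v' x\<bar>) \<partial>P)"
    using i by (intro integral_mono lip integrable_abs Bochner_Integration.integrable_diff int integrable_mult_right Bochner_Integration.integrable_add)
  also have "\<dots> = L * ((\<integral>x. \<bar>u x - u' x\<bar> \<partial>P) + (\<integral>x. \<bar>v x - v' x\<bar> \<partial>P))" using i by simp
  also have "\<dots> < L * (e / (2 * L) + e / (2 * L))" using le L by (intro mult_strict_left_mono add_strict_mono) auto
  also have "\<dots> = e" using L by simp
  finally show ?thesis .
qed

lemma L1_triangle:
  fixes u v w :: "'a \<Rightarrow> real"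
  assumes "integrable P u" "integrable P v" "integrable P w"
  shows "(\<integral>x. \<bar>u x - w x\<bar> \<partial>P) \<le> (\<integral>x. \<bar>u x - v x\<bar> \<partial>P) + (\<integral>x. \<bar>v x - w x\<bar> \<partial>P)"
proof -
  have "(\<integral>x. \<bar>u x - w x\<bar> \<partial>P) \<le> (\<integral>x. \<bar>u x - v x\<bar> + \<bar>v x - w x\<bar> \<partial>P)"
    using assms by (intro integral_mono) auto
  then show ?thesis using assms by simp
qed

lemma abs_integral_diff_le:
  fixes f g :: "'a \<Rightarrow> real"
  assumes "integrable P f" "integrable P g"
  shows "\<bar>(\<integral>x. f x \<partial>P) - (\<integral>x. g x \<partial>P)\<bar> \<le> (\<integral>x. \<bar>f x - g x\<bar> \<partial>P)"
  using integral_abs_bound[of P "\<lambda>x. f x - g x"] assms by simp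

text \<open>The spaces are linked by nothing but the codes of their points. \<open>gen_N\<close>
  makes the finitary functions dense in \<open>L^1\<close> of \<open>N\<close>, and
  \<open>cyl_tendsto\<close> makes their integrals converge.\<close>

locale limit_space =
  fixes M :: "nat \<Rightarrow> 'a measure" and \<kappa> :: "nat \<Rightarrow> 'a \<Rightarrow> nat set"
    and N :: "'b measure" and \<kappa>' :: "'b \<Rightarrow> nat set"
  assumes prob_M: "\<And>n. prob_space (M n)" and prob_N: "prob_space N"
    and code_M: "\<And>n. code_measurable (M n) (\<kappa> n)"
    and gen_N: "sets N = sigma_sets (space N) (code_cylinders (space N) \<kappa>')"
    and cyl_tendsto: "\<And>J s. s \<subseteq> {..<J} \<Longrightarrow>
      (\<lambda>n. measure (M n) {x\<in>space (M n). \<kappa> n x \<inter> {..<J} = s}) \<longlonglongrightarrow> measure N {x\<in>space N. \<kappa>' x \<inter> {..<J} = s}"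

text \<open>There are countably many pairs \<open>(J, s)\<close>, so one diagonal subsequence serves
  all cylinders. The additivity of each measure survives in the limits and makes them
  consistent.\<close>

lemma exists_limit_space:
  fixes M :: "nat \<Rightarrow> 'a measure"
  assumes pM: "\<And>n. prob_space (M n)" and cM: "\<And>n. code_measurable (M n) (\<kappa> n)"
  obtains r and N :: "(nat \<Rightarrow> real) measure" where "strict_mono r"
    "limit_space (\<lambda>n. M (r n)) (\<lambda>n. \<kappa> (r n)) N (\<lambda>w. {j. w j = 1})"
proof -
  define m where "m n J s = measure (M n) {x\<in>space (M n). \<kappa> n x \<inter> {..<J} = s}" for n J s
  have m1: "norm (m n J s) \<le> 1" for n J s
    unfolding m_def using prob_space.prob_le_1[OF pM[of n]] by simp
  have "countable (SIGMA J:UNIV. Pow {..<J::nat})" by (intro countable_SIGMA) (auto intro: countable_finite)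
  then obtain r where r: "strict_mono r"
    and lim: "\<And>Js. Js \<in> (SIGMA J:UNIV. Pow {..<J::nat}) \<Longrightarrow> \<exists>l. (\<lambda>n. (\<lambda>n (J, s). m n J s) (r n) Js) \<longlonglongrightarrow> l"
    by (rule function_convergent_subsequence[of _ "\<lambda>n (J, s). m n J s" 1]) (use m1 in \<open>auto split: prod.splits\<close>)
  define p where "p J s = lim (\<lambda>n. m (r n) J s)" for J s
  have p: "(\<lambda>n. m (r n) J s) \<longlonglongrightarrow> p J s" if "s \<subseteq> {..<J}" for J s
    using lim[of "(J, s)"] that unfolding p_def by (auto simp: convergent_LIMSEQ_iff[symmetric] convergent_def)
  obtain N :: "(nat \<Rightarrow> real) measure" where N: "prob_space N"
    "sets N = sigma_sets (space N) (code_cylinders (space N) (\<lambda>w. {j. w j = 1}))"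
    "\<And>J s. s \<subseteq> {..<J} \<Longrightarrow> measure N {w\<in>space N. {j. w j = 1} \<inter> {..<J} = s} = p J s"
  proof (rule measure_of_cylinder_probabilities[of p])
    show "0 \<le> p J s" if "s \<subseteq> {..<J}" for J s
      by (rule LIMSEQ_le_const[OF p[OF that]]) (auto simp: m_def)
    have "m n 0 {} = 1" for n by (simp add: m_def prob_space.prob_space[OF pM])
    then show "p 0 {} = 1" using p[of "{}" 0] by (simp add: LIMSEQ_const_iff)
    show "p J s = p (Suc J) s + p (Suc J) (insert J s)" if s: "s \<subseteq> {..<J}" for J s
    proof -
      have "m n J s = m n (Suc J) s + m n (Suc J) (insert J s)" for n
      proof -
        interpret prob_space "M n" by (rule pM)
        have Js: "J \<notin> s" using s by auto
        have "{x\<in>space (M n). \<kappa> n x \<inter> {..<J} = s} = {x\<in>space (M n). \<kappa> n x \<inter> {..<Suc J} = s} \<union>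
            {x\<in>space (M n). \<kappa> n x \<inter> {..<Suc J} = insert J s}"
          using Js by (auto simp: lessThan_Suc Int_insert_right split: if_splits)
        then show ?thesis
          unfolding m_def using Js
          by (simp, subst finite_measure_Union) (auto intro: sets_code_cylinder[OF cM])
      qed
      then have "(\<lambda>n. m (r n) J s) \<longlonglongrightarrow> p (Suc J) s + p (Suc J) (insert J s)"
        using s by (auto intro!: tendsto_add p simp: less_Suc_eq)
      then show ?thesis using p[OF s] LIMSEQ_unique by blast
    qed
  qed (use that in blast)
  have "limit_space (\<lambda>n. M (r n)) (\<lambda>n. \<kappa> (r n)) N (\<lambda>w. {j. w j = 1})"
  proof (rule limit_space.intro)
    show "(\<lambda>n. measure (M (r n)) {x\<in>space (M (r n)). \<kappa> (r n) x \<inter> {..<J} = s})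
        \<longlonglongrightarrow> measure N {w\<in>space N. {j. w j = 1} \<inter> {..<J} = s}" if "s \<subseteq> {..<J}" for J s
      using p[OF that] unfolding N(3)[OF that] m_def .
  qed (fact pM cM N)+
  then show thesis using that r by blast
qed

section \<open>Convergence of functions from the spaces \<open>M n\<close> to
  \<open>N\<close>\<close>

context limit_space
begin

lemma code_N: "code_measurable N \<kappa>'"
  unfolding code_measurable_def
proof
  fix j
  have "{x\<in>space N. j \<in> \<kappa>' x} = (\<Union>s\<in>{s\<in>Pow {..<Suc j}. j \<in> s}. {x\<in>space N. \<kappa>' x \<inter> {..<Suc j} = s})"
  proof (intro equalityI subsetI)
    fix x assume "x \<in> {x\<in>space N. j \<in> \<kappa>' x}"
    then show "x \<in> (\<Union>s\<in>{s\<in>Pow {..<Suc j}. j \<in> s}. {x\<in>space N. \<kappa>' x \<inter> {..<Suc j} = s})"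
      by (intro UN_I[of "\<kappa>' x \<inter> {..<Suc j}"]) auto
  qed blast
  also have "\<dots> \<in> sets N"
  proof (rule sets.finite_UN)
    have "{x\<in>space N. \<kappa>' x \<inter> {..<Suc j} = s} \<in> code_cylinders (space N) \<kappa>'" for s
      by (auto simp: code_cylinders_def intro!: image_eqI[of _ _ "(Suc j, s)"])
    then show "{x\<in>space N. \<kappa>' x \<inter> {..<Suc j} = s} \<in> sets N" for s by (simp add: gen_N)
  qed auto
  finally show "{x\<in>space N. j \<in> \<kappa>' x} \<in> sets N" .
qed

lemma finitary_tendsto:
  assumes "finitary \<Phi>"
  shows "(\<lambda>n. \<integral>x. \<Phi> (\<kappa> n x) \<partial>M n) \<longlonglongrightarrow> (\<integral>x. \<Phi> (\<kappa>' x) \<partial>N)"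
proof -
  obtain J where J: "\<And>s. \<Phi> s = \<Phi> (s \<inter> {..<J})" using assms unfolding finitary_def by blast
  show ?thesis
    unfolding integral_finitary[of _ _ \<Phi>, OF prob_M code_M J] integral_finitary[of _ _ \<Phi>, OF prob_N code_N J]
    by (intro tendsto_intros cyl_tendsto) auto
qed

lemmas integrable_finitary_M = integrable_finitary[OF prob_M code_M]
lemmas integrable_finitary_N = integrable_finitary[OF prob_N code_N]

text \<open>The approximant \<open>\<Phi>\<close> must be the same function of the code on every
  space, as it is the only bridge between them. Integrability is demanded separately because the
  Bochner integral of a non-integrable function is 0 and would satisfy the estimates
  vacuously.\<close>

definition cv :: "(nat \<Rightarrow> 'a \<Rightarrow> real) \<Rightarrow> ('b \<Rightarrow> real) \<Rightarrow> bool" where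
  "cv f g \<longleftrightarrow> (\<forall>n. integrable (M n) (f n)) \<and> integrable N g \<and>
    (\<forall>e>0. \<exists>\<Phi>. finitary \<Phi> \<and> (\<forall>\<^sub>F n in sequentially. (\<integral>x. \<bar>f n x - \<Phi> (\<kappa> n x)\<bar> \<partial>M n) < e) \<and>
       (\<integral>x. \<bar>g x - \<Phi> (\<kappa>' x)\<bar> \<partial>N) < e)"

lemma cv_integrable: "cv f g \<Longrightarrow> integrable (M n) (f n)" "cv f g \<Longrightarrow> integrable N g"
  by (auto simp: cv_def)

lemma cv_finitary: "finitary \<Phi> \<Longrightarrow> cv (\<lambda>n x. \<Phi> (\<kappa> n x)) (\<lambda>x. \<Phi> (\<kappa>' x))"
  unfolding cv_def
  by (intro conjI allI impI integrable_finitary_M integrable_finitary_N exI[of _ \<Phi>]) simp_all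

text \<open>A Lipschitz condition in two variables covers sums as well as compositions with Lipschitz functions.\<close>

lemma cv_comp2:
  assumes f: "cv f g" and f': "cv f' g'" and L: "0 < L"
    and lip: "\<And>a b a' b'. \<bar>\<phi> a b - \<phi> a' b'\<bar> \<le> L * (\<bar>a - a'\<bar> + \<bar>b - b'\<bar>)"
    and [measurable]: "(\<lambda>z. \<phi> (fst z) (snd z)) \<in> borel_measurable (borel :: (real \<times> real) measure)"
  shows "cv (\<lambda>n x. \<phi> (f n x) (f' n x) :: real) (\<lambda>x. \<phi> (g x) (g' x))"
proof -
  note int = integrable_Lipschitz2[OF _ _ _ L lip assms(5)]
  note le = L1_Lipschitz2_less[OF _ _ _ _ _ L lip assms(5)]
  show ?thesis
    unfolding cv_def
  proof (intro conjI allI impI)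
    show "integrable (M n) (\<lambda>x. \<phi> (f n x) (f' n x))" for n using f f' prob_M by (intro int) (auto simp: cv_def)
    show "integrable N (\<lambda>x. \<phi> (g x) (g' x))" using f f' prob_N by (intro int) (auto simp: cv_def)
    fix e :: real assume "0 < e"
    then have e: "0 < e / (2 * L)" using L by simp
    obtain \<Phi> where P: "finitary \<Phi>" "\<forall>\<^sub>F n in sequentially. (\<integral>x. \<bar>f n x - \<Phi> (\<kappa> n x)\<bar> \<partial>M n) < e / (2 * L)"
       "(\<integral>x. \<bar>g x - \<Phi> (\<kappa>' x)\<bar> \<partial>N) < e / (2 * L)" using f e unfolding cv_def by blast
    obtain \<Psi> where Q: "finitary \<Psi>" "\<forall>\<^sub>F n in sequentially. (\<integral>x. \<bar>f' n x - \<Psi> (\<kappa> n x)\<bar> \<partial>M n) < e / (2 * L)"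
       "(\<integral>x. \<bar>g' x - \<Psi> (\<kappa>' x)\<bar> \<partial>N) < e / (2 * L)" using f' e unfolding cv_def by blast
    have "\<forall>\<^sub>F n in sequentially. (\<integral>x. \<bar>\<phi> (f n x) (f' n x) - \<phi> (\<Phi> (\<kappa> n x)) (\<Psi> (\<kappa> n x))\<bar> \<partial>M n) < e"
      using P(2) Q(2) by eventually_elim (rule le, auto intro: integrable_finitary_M P Q prob_M cv_integrable[OF f] cv_integrable[OF f'])
    moreover have "(\<integral>x. \<bar>\<phi> (g x) (g' x) - \<phi> (\<Phi> (\<kappa>' x)) (\<Psi> (\<kappa>' x))\<bar> \<partial>N) < e"
      by (rule le) (auto intro: integrable_finitary_N P Q prob_N cv_integrable[OF f] cv_integrable[OF f'])
    ultimately show "\<exists>\<Phi>. finitary \<Phi> \<and> (\<forall>\<^sub>F n in sequentially. (\<integral>x. \<bar>\<phi> (f n x) (f' n x) - \<Phi> (\<kappa> n x)\<bar> \<partial>M n) < e) \<and>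
        (\<integral>x. \<bar>\<phi> (g x) (g' x) - \<Phi> (\<kappa>' x)\<bar> \<partial>N) < e"
      using finitary_comp2[OF P(1) Q(1), of \<phi>] by blast
  qed
qed

lemma cv_comp:
  assumes f: "cv f g" and "0 < L" and lip: "\<And>a b. \<bar>\<phi> a - \<phi> b\<bar> \<le> L * \<bar>a - b\<bar>"
    and "\<phi> \<in> borel_measurable borel"
  shows "cv (\<lambda>n x. \<phi> (f n x)) (\<lambda>x. \<phi> (g x))"
proof (rule cv_comp2[OF f f \<open>0 < L\<close>, of "\<lambda>a _. \<phi> a"])
  fix a b a' b' :: real
  have "L * \<bar>a - a'\<bar> \<le> L * (\<bar>a - a'\<bar> + \<bar>b - b'\<bar>)" using \<open>0 < L\<close> by (intro mult_left_mono) auto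
  then show "\<bar>\<phi> a - \<phi> a'\<bar> \<le> L * (\<bar>a - a'\<bar> + \<bar>b - b'\<bar>)" using lip[of a a'] by simp
  show "(\<lambda>z::real \<times> real. \<phi> (fst z)) \<in> borel_measurable borel"
    by (rule measurable_compose[OF _ assms(4)]) (intro borel_measurable_continuous_onI linear_continuous_on bounded_linear_fst)
qed

lemma cv_lin: "cv f g \<Longrightarrow> cv f' g' \<Longrightarrow> cv (\<lambda>n x. a * f n x + b * f' n x) (\<lambda>x. a * g x + b * g' x)"
proof (rule cv_comp2[of _ _ _ _ "\<bar>a\<bar> + \<bar>b\<bar> + 1" "\<lambda>u v. a * u + b * v"])
  fix u v u' v' :: real
  have "\<bar>a * u + b * v - (a * u' + b * v')\<bar> = \<bar>a * (u - u') + b * (v - v')\<bar>" by (simp add: algebra_simps)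
  also have "\<dots> \<le> \<bar>a\<bar> * \<bar>u - u'\<bar> + \<bar>b\<bar> * \<bar>v - v'\<bar>" by (metis abs_mult abs_triangle_ineq)
  also have "\<dots> \<le> (\<bar>a\<bar> + \<bar>b\<bar> + 1) * \<bar>u - u'\<bar> + (\<bar>a\<bar> + \<bar>b\<bar> + 1) * \<bar>v - v'\<bar>"
    by (intro add_mono mult_right_mono) auto
  finally show "\<bar>a * u + b * v - (a * u' + b * v')\<bar> \<le> (\<bar>a\<bar> + \<bar>b\<bar> + 1) * (\<bar>u - u'\<bar> + \<bar>v - v'\<bar>)"
    by (simp add: distrib_left)
qed (auto intro!: borel_measurable_continuous_onI continuous_intros)

lemma cv_diff: "cv f g \<Longrightarrow> cv f' g' \<Longrightarrow> cv (\<lambda>n x. f n x - f' n x) (\<lambda>x. g x - g' x)"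
  using cv_lin[of f g f' g' 1 "-1"] by simp

lemma cv_abs: "cv f g \<Longrightarrow> cv (\<lambda>n x. \<bar>f n x\<bar>) (\<lambda>x. \<bar>g x\<bar>)"
  by (rule cv_comp[of _ _ 1]) auto

lemma cv_integral:
  assumes f: "cv f g"
  shows "(\<lambda>n. \<integral>x. f n x \<partial>M n) \<longlonglongrightarrow> (\<integral>x. g x \<partial>N)"
proof (rule tendstoI)
  fix e :: real assume "0 < e"
  then have e: "0 < e / 3" by simp
  obtain \<Phi> where P: "finitary \<Phi>" "\<forall>\<^sub>F n in sequentially. (\<integral>x. \<bar>f n x - \<Phi> (\<kappa> n x)\<bar> \<partial>M n) < e / 3"
     "(\<integral>x. \<bar>g x - \<Phi> (\<kappa>' x)\<bar> \<partial>N) < e / 3" using f e unfolding cv_def by blast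
  have "\<forall>\<^sub>F n in sequentially. dist (\<integral>x. \<Phi> (\<kappa> n x) \<partial>M n) (\<integral>x. \<Phi> (\<kappa>' x) \<partial>N) < e / 3"
    using finitary_tendsto[OF P(1)] e by (rule tendstoD)
  with P(2) show "\<forall>\<^sub>F n in sequentially. dist (\<integral>x. f n x \<partial>M n) (\<integral>x. g x \<partial>N) < e"
  proof eventually_elim
    case (elim n)
    then show ?case
      using abs_integral_diff_le[OF cv_integrable(1)[OF f, of n] integrable_finitary_M[OF P(1), of n]]
        abs_integral_diff_le[OF cv_integrable(2)[OF f] integrable_finitary_N[OF P(1)]] P(3)
      unfolding dist_real_def by linarith
  qed
qed

text \<open>The functions \<open>\<bar>f n x - f n x\<bar>\<close> vanish and converge to
  \<open>\<bar>g x - g' x\<bar>\<close>, whose integral is therefore a limit of zeros.\<close>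

lemma cv_unique:
  assumes "cv f g" "cv f g'"
  shows "AE x in N. g x = g' x"
proof -
  have i: "integrable N (\<lambda>x. \<bar>g x - g' x\<bar>)" using assms[THEN cv_integrable(2)] by auto
  have "cv (\<lambda>n x. \<bar>f n x - f n x\<bar>) (\<lambda>x. \<bar>g x - g' x\<bar>)" by (intro cv_abs cv_diff assms)
  from cv_integral[OF this] have "(\<integral>x. \<bar>g x - g' x\<bar> \<partial>N) = 0" by (simp add: LIMSEQ_const_iff)
  then show ?thesis using i by (subst (asm) integral_nonneg_eq_0_iff_AE) auto
qed

lemma cv_cong_AE:
  assumes f: "cv f g" and i: "\<And>n. integrable (M n) (f' n)" "integrable N g'"
    and e: "\<And>n. AE x in M n. f n x = f' n x" "AE x in N. g x = g' x"
  shows "cv f' g'"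
proof -
  have "(\<integral>x. \<bar>f' n x - \<Phi> (\<kappa> n x)\<bar> \<partial>M n) = (\<integral>x. \<bar>f n x - \<Phi> (\<kappa> n x)\<bar> \<partial>M n)" if "finitary \<Phi>" for n \<Phi>
    using e(1)[of n] integrable_finitary_M[OF that] i cv_integrable[OF f] by (intro integral_cong_AE) auto
  moreover have "(\<integral>x. \<bar>g' x - \<Phi> (\<kappa>' x)\<bar> \<partial>N) = (\<integral>x. \<bar>g x - \<Phi> (\<kappa>' x)\<bar> \<partial>N)" if "finitary \<Phi>" for \<Phi>
    using e(2) integrable_finitary_N[OF that] i cv_integrable[OF f] by (intro integral_cong_AE) auto
  ultimately have *: "finitary \<Phi> \<Longrightarrow> (\<forall>\<^sub>F n in sequentially. (\<integral>x. \<bar>f n x - \<Phi> (\<kappa> n x)\<bar> \<partial>M n) < e) \<and>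
       (\<integral>x. \<bar>g x - \<Phi> (\<kappa>' x)\<bar> \<partial>N) < e \<Longrightarrow> (\<forall>\<^sub>F n in sequentially. (\<integral>x. \<bar>f' n x - \<Phi> (\<kappa> n x)\<bar> \<partial>M n) < e) \<and>
       (\<integral>x. \<bar>g' x - \<Phi> (\<kappa>' x)\<bar> \<partial>N) < e" for \<Phi> e by simp
  show ?thesis
    unfolding cv_def
  proof (intro conjI allI impI i)
    fix e :: real assume "0 < e"
    then obtain \<Phi> where "finitary \<Phi>" "(\<forall>\<^sub>F n in sequentially. (\<integral>x. \<bar>f n x - \<Phi> (\<kappa> n x)\<bar> \<partial>M n) < e) \<and>
       (\<integral>x. \<bar>g x - \<Phi> (\<kappa>' x)\<bar> \<partial>N) < e" using f unfolding cv_def by blast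
    with * show "\<exists>\<Phi>. finitary \<Phi> \<and> (\<forall>\<^sub>F n in sequentially. (\<integral>x. \<bar>f' n x - \<Phi> (\<kappa> n x)\<bar> \<partial>M n) < e) \<and>
       (\<integral>x. \<bar>g' x - \<Phi> (\<kappa>' x)\<bar> \<partial>N) < e" by blast
  qed
qed

lemma cv_perturb:
  assumes i: "\<And>n. integrable (M n) (f n)" "integrable N g"
    and ex: "\<And>e. 0 < e \<Longrightarrow> \<exists>f' g'. cv f' g' \<and> (\<forall>\<^sub>F n in sequentially. (\<integral>x. \<bar>f n x - f' n x\<bar> \<partial>M n) < e) \<and>
      (\<integral>x. \<bar>g x - g' x\<bar> \<partial>N) < e"
  shows "cv f g"
  unfolding cv_def
proof (intro conjI allI impI i)
  fix e :: real assume "0 < e"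
  then have e: "0 < e / 2" by simp
  obtain f' g' where f': "cv f' g'" "\<forall>\<^sub>F n in sequentially. (\<integral>x. \<bar>f n x - f' n x\<bar> \<partial>M n) < e / 2"
      "(\<integral>x. \<bar>g x - g' x\<bar> \<partial>N) < e / 2" using ex[OF e] by blast
  obtain \<Phi> where P: "finitary \<Phi>" "\<forall>\<^sub>F n in sequentially. (\<integral>x. \<bar>f' n x - \<Phi> (\<kappa> n x)\<bar> \<partial>M n) < e / 2"
     "(\<integral>x. \<bar>g' x - \<Phi> (\<kappa>' x)\<bar> \<partial>N) < e / 2" using f'(1) e unfolding cv_def by blast
  have "\<forall>\<^sub>F n in sequentially. (\<integral>x. \<bar>f n x - \<Phi> (\<kappa> n x)\<bar> \<partial>M n) < e"
    using f'(2) P(2)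
  proof eventually_elim
    case (elim n)
    then show ?case
      using L1_triangle[OF i(1) cv_integrable(1)[OF f'(1)] integrable_finitary_M[OF P(1)], of n] by simp
  qed
  moreover have "(\<integral>x. \<bar>g x - \<Phi> (\<kappa>' x)\<bar> \<partial>N) < e"
    using L1_triangle[OF i(2) cv_integrable(2)[OF f'(1)] integrable_finitary_N[OF P(1)]] f' P by simp
  ultimately show "\<exists>\<Phi>. finitary \<Phi> \<and> (\<forall>\<^sub>F n in sequentially. (\<integral>x. \<bar>f n x - \<Phi> (\<kappa> n x)\<bar> \<partial>M n) < e) \<and>
       (\<integral>x. \<bar>g x - \<Phi> (\<kappa>' x)\<bar> \<partial>N) < e" using P(1) by blast
qed

end

lemma finitary_prod: "finite I \<Longrightarrow> (\<And>i. i \<in> I \<Longrightarrow> finitary (\<Phi> i)) \<Longrightarrow> finitary (\<lambda>s. \<Prod>i\<in>I. \<Phi> i s)"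
  by (induction I rule: finite_induct) (auto intro: finitary_comp2)

text \<open>Trades the part of an integral above height \<open>m\<close> for the \<open>q\<close>-th
  moment, with a factor that is small for large \<open>m\<close> when \<open>q > 1\<close>: uniform
  integrability in quantitative form.\<close>

lemma abs_le_powr_tail:
  fixes u m q :: real
  assumes "1 \<le> q" "0 < m" "m \<le> \<bar>u\<bar>"
  shows "\<bar>u\<bar> \<le> m powr (1 - q) * \<bar>u\<bar> powr q"
proof -
  have "\<bar>u\<bar> = \<bar>u\<bar> powr (1 - q) * \<bar>u\<bar> powr q" using assms by (simp flip: powr_add)
  also have "\<dots> \<le> m powr (1 - q) * \<bar>u\<bar> powr q"
    using assms by (intro mult_right_mono powr_mono2') auto
  finally show ?thesis .
qed

context limit_space
begin

text \<open>Approximability on the spaces \<open>M n\<close> alone suffices: approximants of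
  accuracy \<open>(1/2) ^ k\<close> are close to each other on \<open>M n\<close>, their mutual
  distances pass to \<open>N\<close> by \<open>finitary_tendsto\<close>, and
  \<open>L1_fast_Cauchy\<close> supplies the limit there.\<close>

lemma cv_exists:
  assumes i: "\<And>n. integrable (M n) (f n)"
    and ex: "\<And>e. 0 < e \<Longrightarrow> \<exists>\<Phi>. finitary \<Phi> \<and> (\<forall>\<^sub>F n in sequentially. (\<integral>x. \<bar>f n x - \<Phi> (\<kappa> n x)\<bar> \<partial>M n) < e)"
  shows "\<exists>g. cv f g"
proof -
  have "\<forall>k::nat. \<exists>\<Phi>. finitary \<Phi> \<and> (\<forall>\<^sub>F n in sequentially. (\<integral>x. \<bar>f n x - \<Phi> (\<kappa> n x)\<bar> \<partial>M n) < (1/2) ^ k)"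
    by (intro allI ex) simp
  from choice[OF this] obtain \<Phi> where P: "\<And>k. finitary (\<Phi> k)"
    "\<And>k::nat. \<forall>\<^sub>F n in sequentially. (\<integral>x. \<bar>f n x - \<Phi> k (\<kappa> n x)\<bar> \<partial>M n) < (1/2) ^ k" by blast
  note iP = integrable_finitary_M[OF P(1)] and iN = integrable_finitary_N[OF P(1)]
  have "(\<integral>x. \<bar>\<Phi> (Suc k) (\<kappa>' x) - \<Phi> k (\<kappa>' x)\<bar> \<partial>N) \<le> 2 * (1/2) ^ k" for k
  proof (rule LIMSEQ_le_const2)
    show "(\<lambda>n. \<integral>x. \<bar>\<Phi> (Suc k) (\<kappa> n x) - \<Phi> k (\<kappa> n x)\<bar> \<partial>M n) \<longlonglongrightarrow> (\<integral>x. \<bar>\<Phi> (Suc k) (\<kappa>' x) - \<Phi> k (\<kappa>' x)\<bar> \<partial>N)"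
      by (rule finitary_tendsto[of "\<lambda>s. \<bar>\<Phi> (Suc k) s - \<Phi> k s\<bar>"]) (intro finitary_comp2[of _ _ "\<lambda>a b. \<bar>a - b\<bar>"] P)
    have "\<forall>\<^sub>F n in sequentially. (\<integral>x. \<bar>\<Phi> (Suc k) (\<kappa> n x) - \<Phi> k (\<kappa> n x)\<bar> \<partial>M n) \<le> 2 * (1/2) ^ k"
      using P(2)[of k] P(2)[of "Suc k"]
    proof eventually_elim
      case (elim n)
      have "(\<integral>x. \<bar>f n x - \<Phi> (Suc k) (\<kappa> n x)\<bar> \<partial>M n) = (\<integral>x. \<bar>\<Phi> (Suc k) (\<kappa> n x) - f n x\<bar> \<partial>M n)"
        by (simp add: abs_minus_commute)
      moreover have "0 \<le> (1/2::real) ^ k" by simp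
      ultimately show ?case
        using L1_triangle[OF iP[of n "Suc k"] i[of n] iP[of n k]] elim unfolding power_Suc by linarith
    qed
    then show "\<exists>N. \<forall>n\<ge>N. (\<integral>x. \<bar>\<Phi> (Suc k) (\<kappa> n x) - \<Phi> k (\<kappa> n x)\<bar> \<partial>M n) \<le> 2 * (1/2) ^ k"
      by (simp add: eventually_sequentially)
  qed
  from L1_fast_Cauchy[OF iN this] obtain g where g: "integrable N g"
    "(\<lambda>k. \<integral>x. \<bar>\<Phi> k (\<kappa>' x) - g x\<bar> \<partial>N) \<longlonglongrightarrow> 0" by blast
  have "cv f g"
    unfolding cv_def
  proof (intro conjI allI impI i g)
    fix e :: real assume e: "0 < e"
    have "\<forall>\<^sub>F k in sequentially. (1/2::real) ^ k < e"
      using e by (intro order_tendstoD(2)[OF LIMSEQ_power_zero]) auto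
    moreover have "\<forall>\<^sub>F k in sequentially. (\<integral>x. \<bar>\<Phi> k (\<kappa>' x) - g x\<bar> \<partial>N) < e"
      using g(2) e by (rule order_tendstoD)
    ultimately have "\<forall>\<^sub>F k in sequentially. (1/2::real) ^ k < e \<and> (\<integral>x. \<bar>\<Phi> k (\<kappa>' x) - g x\<bar> \<partial>N) < e"
      by (rule eventually_conj)
    then obtain k where k: "(1/2::real) ^ k < e" "(\<integral>x. \<bar>\<Phi> k (\<kappa>' x) - g x\<bar> \<partial>N) < e"
      by (auto simp: eventually_sequentially)
    have "\<forall>\<^sub>F n in sequentially. (\<integral>x. \<bar>f n x - \<Phi> k (\<kappa> n x)\<bar> \<partial>M n) < e"
      using P(2)[of k] by eventually_elim (use k in linarith)
    then show "\<exists>\<Phi>. finitary \<Phi> \<and> (\<forall>\<^sub>F n in sequentially. (\<integral>x. \<bar>f n x - \<Phi> (\<kappa> n x)\<bar> \<partial>M n) < e) \<and>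
       (\<integral>x. \<bar>g x - \<Phi> (\<kappa>' x)\<bar> \<partial>N) < e"
      using P(1) k by (intro exI[of _ "\<Phi> k"]) (simp add: abs_minus_commute)
  qed
  then show ?thesis by blast
qed

text \<open>Clipping an approximant to \<open>[- R, R]\<close> brings it no further from
  \<open>v\<close>.\<close>

lemma bounded_finitary_dense:
  assumes v: "integrable N v" "AE x in N. \<bar>v x\<bar> \<le> R" and "0 < e"
  shows "\<exists>\<Phi>. finitary \<Phi> \<and> (\<forall>s. \<bar>\<Phi> s\<bar> \<le> R) \<and> (\<integral>x. \<bar>v x - \<Phi> (\<kappa>' x)\<bar> \<partial>N) < e"
proof -
  interpret N: prob_space N by (rule prob_N)
  have R: "0 \<le> R"
  proof -
    have "AE x in N. 0 \<le> R" using v(2) by eventually_elim simp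
    then show ?thesis by simp
  qed
  obtain \<Phi> where P: "finitary \<Phi>" "(\<integral>x. \<bar>v x - \<Phi> (\<kappa>' x)\<bar> \<partial>N) < e"
    using finitary_dense[OF prob_N code_N gen_N v(1) \<open>0 < e\<close>] by blast
  define \<Psi> where "\<Psi> s = max (- R) (min R (\<Phi> s))" for s
  have Psi: "finitary \<Psi>" unfolding \<Psi>_def by (rule finitary_comp[OF P(1)])
  have "(\<integral>x. \<bar>v x - \<Psi> (\<kappa>' x)\<bar> \<partial>N) \<le> (\<integral>x. \<bar>v x - \<Phi> (\<kappa>' x)\<bar> \<partial>N)"
  proof (rule integral_mono_AE)
    show "AE x in N. \<bar>v x - \<Psi> (\<kappa>' x)\<bar> \<le> \<bar>v x - \<Phi> (\<kappa>' x)\<bar>"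
      using v(2) by eventually_elim (auto simp: \<Psi>_def)
  qed (use v integrable_finitary_N[OF Psi] integrable_finitary_N[OF P(1)] in auto)
  then show ?thesis using P(2) Psi R by (intro exI[of _ \<Psi>]) (auto simp: \<Psi>_def)
qed

text \<open>A diagonal sequence built from finitary approximations of \<open>v\<close>.\<close>

lemma cv_lift:
  assumes v: "integrable N v" "AE x in N. \<bar>v x\<bar> \<le> R"
  obtains \<Psi> where "\<And>n. finitary (\<Psi> n)" "\<And>n s. \<bar>\<Psi> n s\<bar> \<le> R" "cv (\<lambda>n x. \<Psi> n (\<kappa> n x)) v"
proof -
  define e where "e i = 1 / (real i + 1)" for i
  have e: "0 < e i" "i \<le> j \<Longrightarrow> e j \<le> e i" for i j by (auto simp: e_def field_simps)
  have "\<forall>i. \<exists>\<Phi>. finitary \<Phi> \<and> (\<forall>s. \<bar>\<Phi> s\<bar> \<le> R) \<and> (\<integral>x. \<bar>v x - \<Phi> (\<kappa>' x)\<bar> \<partial>N) < e i"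
    by (intro allI bounded_finitary_dense[OF v e(1)])
  from choice[OF this] obtain \<Phi> where P: "\<And>i. finitary (\<Phi> i)" "\<And>i s. \<bar>\<Phi> i s\<bar> \<le> R"
    "\<And>i. (\<integral>x. \<bar>v x - \<Phi> i (\<kappa>' x)\<bar> \<partial>N) < e i" by blast
  note iM = integrable_finitary_M[OF P(1)] and iN = integrable_finitary_N[OF P(1)]
  define D where "D n i j = (\<integral>x. \<bar>\<Phi> j (\<kappa> n x) - \<Phi> i (\<kappa> n x)\<bar> \<partial>M n)" for n i j
  \<comment> \<open>On \<open>M n\<close> the \<open>j\<close>-th approximant is as close to each
    earlier one as on \<open>N\<close>, where the distance is below
    \<open>e i + e j \<le> 2 * e i\<close>. Each \<open>A n j\<close> holds for all large
    \<open>n\<close>, so the largest admissible index \<open>J n\<close> tends to infinity;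
    \<open>A n 0\<close> and the restriction \<open>j \<le> n\<close> make this maximum
    exist.\<close>
  define A where "A n j \<longleftrightarrow> (\<forall>i\<le>j. D n i j < 2 * e i)" for n j
  have ev: "\<forall>\<^sub>F n in sequentially. A n j" for j
  proof -
    have "\<forall>\<^sub>F n in sequentially. D n i j < 2 * e i" if "i \<le> j" for i
    proof (rule order_tendstoD(2))
      show "(\<lambda>n. D n i j) \<longlonglongrightarrow> (\<integral>x. \<bar>\<Phi> j (\<kappa>' x) - \<Phi> i (\<kappa>' x)\<bar> \<partial>N)"
        unfolding D_def
        by (rule finitary_tendsto[of "\<lambda>s. \<bar>\<Phi> j s - \<Phi> i s\<bar>"]) (intro finitary_comp2[of _ _ "\<lambda>a b. \<bar>a - b\<bar>"] P)
      show "(\<integral>x. \<bar>\<Phi> j (\<kappa>' x) - \<Phi> i (\<kappa>' x)\<bar> \<partial>N) < 2 * e i"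
        using L1_triangle[OF iN[of j] v(1) iN[of i]] P(3)[of i] P(3)[of j] e(2)[OF that]
        by (simp add: abs_minus_commute)
    qed
    then have "\<forall>\<^sub>F n in sequentially. \<forall>i\<in>{..j}. D n i j < 2 * e i"
      by (intro eventually_ball_finite) auto
    then show ?thesis unfolding A_def by eventually_elim simp
  qed
  have A0: "A n 0" for n by (simp add: A_def D_def e_def)
  define J where "J n = Max {j. j \<le> n \<and> A n j}" for n
  have fin: "finite {j. j \<le> n \<and> A n j}" for n by (rule finite_subset[of _ "{..n}"]) auto
  have AJ: "A n (J n)" for n
  proof -
    have "J n \<in> {j. j \<le> n \<and> A n j}" unfolding J_def using A0 by (intro Max_in fin) auto
    then show ?thesis by simp
  qed
  have cv: "cv (\<lambda>n x. \<Phi> (J n) (\<kappa> n x)) v"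
    unfolding cv_def
  proof (intro conjI allI impI v iM)
    fix \<epsilon> :: real assume "0 < \<epsilon>"
    then obtain i where i: "2 * e i < \<epsilon>"
    proof -
      obtain i :: nat where "2 / \<epsilon> < i" using reals_Archimedean2 by blast
      then show thesis using that[of i] \<open>0 < \<epsilon>\<close> by (simp add: e_def field_simps)
    qed
    have "\<forall>\<^sub>F n in sequentially. (\<integral>x. \<bar>\<Phi> (J n) (\<kappa> n x) - \<Phi> i (\<kappa> n x)\<bar> \<partial>M n) < \<epsilon>"
      using ev[of i] eventually_ge_at_top[of i]
    proof eventually_elim
      case (elim n)
      then have "i \<le> J n" unfolding J_def by (intro Max_ge fin) auto
      then have "D n i (J n) < 2 * e i" using AJ[of n] by (auto simp: A_def)
      then show ?case using i by (simp add: D_def)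
    qed
    moreover have "(\<integral>x. \<bar>v x - \<Phi> i (\<kappa>' x)\<bar> \<partial>N) < \<epsilon>" using P(3)[of i] e(1)[of i] i by simp
    ultimately show "\<exists>\<Phi>'. finitary \<Phi>' \<and> (\<forall>\<^sub>F n in sequentially. (\<integral>x. \<bar>\<Phi> (J n) (\<kappa> n x) - \<Phi>' (\<kappa> n x)\<bar> \<partial>M n) < \<epsilon>) \<and>
       (\<integral>x. \<bar>v x - \<Phi>' (\<kappa>' x)\<bar> \<partial>N) < \<epsilon>" using P(1) by blast
  qed
  show thesis by (rule that[of "\<lambda>n. \<Phi> (J n)"]) (rule P cv)+
qed

text \<open>Values up to height \<open>m\<close> are recovered within \<open>e / 2\<close> from
  finitely many rational level sets. Above that height both the function and its rounding are at
  most \<open>\<bar>f n x\<bar>\<close> in absolute value, which gives the factor 2, and the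
  \<open>q\<close>-th moment pays for the tail. The indices of the level sets do not depend on
  \<open>n\<close>, hence neither does \<open>\<Phi>\<close>.\<close>

lemma finitary_approx_of_level_sets:
  assumes q: "1 < q" and f: "\<And>n. integrable (M n) (f n)" "\<And>n. integrable (M n) (\<lambda>x. \<bar>f n x\<bar> powr q)"
      "\<And>n. (\<integral>x. \<bar>f n x\<bar> powr q \<partial>M n) \<le> C"
    and lev: "\<And>r. r \<in> \<rat> \<Longrightarrow> \<exists>j. \<forall>n. \<forall>x\<in>space (M n). j \<in> \<kappa> n x \<longleftrightarrow> r < f n x" and "0 < e"
  shows "\<exists>\<Phi>. finitary \<Phi> \<and> (\<forall>n. (\<integral>x. \<bar>f n x - \<Phi> (\<kappa> n x)\<bar> \<partial>M n) < e)"
proof -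
  have "((\<lambda>m::nat. 2 * (real m powr (1 - q)) * C) \<longlongrightarrow> 2 * 0 * C) sequentially"
    using q by (intro tendsto_intros tendsto_neg_powr filterlim_real_sequentially) auto
  then have "\<forall>\<^sub>F m in sequentially. 2 * (real m powr (1 - q)) * C < e / 2"
    using \<open>0 < e\<close> by (intro order_tendstoD(2)) auto
  then have "\<forall>\<^sub>F m::nat in sequentially. 2 * (real m powr (1 - q)) * C < e / 2 \<and> 0 < m"
    using eventually_gt_at_top[of 0] by (rule eventually_conj)
  then obtain m :: nat where m: "2 * (real m powr (1 - q)) * C < e / 2" "0 < m"
    by (auto simp: eventually_sequentially)
  obtain Q and \<psi> :: "real set \<Rightarrow> real" where Q: "finite Q" "Q \<subseteq> \<rat>" and
    psi: "\<And>u::real. \<bar>u\<bar> \<le> m \<Longrightarrow> \<bar>u - \<psi> {r\<in>Q. r < u}\<bar> \<le> e / 2" "\<And>X. X \<subseteq> Q \<Longrightarrow> \<bar>\<psi> X\<bar> \<le> m"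
    by (rule rational_rounding[of "e / 2" m]) (use \<open>0 < e\<close> in auto)
  have "\<forall>r\<in>Q. \<exists>j. \<forall>n. \<forall>x\<in>space (M n). j \<in> \<kappa> n x \<longleftrightarrow> r < f n x" using lev Q by blast
  then obtain j where j: "\<And>r n x. r \<in> Q \<Longrightarrow> x \<in> space (M n) \<Longrightarrow> j r \<in> \<kappa> n x \<longleftrightarrow> r < f n x" by metis
  define \<Phi> where "\<Phi> s = \<psi> {r\<in>Q. j r \<in> s}" for s
  have "\<Phi> s = \<Phi> (s \<inter> j ` Q)" for s unfolding \<Phi>_def by (intro arg_cong[where f=\<psi>]) auto
  moreover have "finitary (\<lambda>s. \<Phi> (s \<inter> j ` Q))" using Q by (intro finitary_finite_set) auto
  ultimately have fin: "finitary \<Phi>" by simp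
  have val: "\<Phi> (\<kappa> n x) = \<psi> {r\<in>Q. r < f n x}" if "x \<in> space (M n)" for n x
    unfolding \<Phi>_def using j that by (intro arg_cong[where f=\<psi>]) auto
  have "(\<integral>x. \<bar>f n x - \<Phi> (\<kappa> n x)\<bar> \<partial>M n) < e" for n
  proof -
    interpret prob_space "M n" by (rule prob_M)
    have "(\<integral>x. \<bar>f n x - \<Phi> (\<kappa> n x)\<bar> \<partial>M n) \<le> (\<integral>x. e / 2 + 2 * (real m powr (1 - q)) * \<bar>f n x\<bar> powr q \<partial>M n)"
    proof (rule integral_mono)
      fix x assume x: "x \<in> space (M n)"
      show "\<bar>f n x - \<Phi> (\<kappa> n x)\<bar> \<le> e / 2 + 2 * (real m powr (1 - q)) * \<bar>f n x\<bar> powr q"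
      proof (cases "\<bar>f n x\<bar> \<le> m")
        case True
        have "0 \<le> 2 * (real m powr (1 - q)) * \<bar>f n x\<bar> powr q" by simp
        then show ?thesis using psi(1)[OF True] unfolding val[OF x] by linarith
      next
        case False
        have "\<bar>f n x - \<Phi> (\<kappa> n x)\<bar> \<le> 2 * \<bar>f n x\<bar>" using False psi(2)[of "{r\<in>Q. r < f n x}"] val[OF x] by auto
        also have "\<dots> \<le> 2 * (m powr (1 - q) * \<bar>f n x\<bar> powr q)"
          using False m q by (intro mult_left_mono abs_le_powr_tail) auto
        finally show ?thesis using \<open>0 < e\<close> by simp
      qed
    qed (use f integrable_finitary_M[OF fin] in auto)
    also have "\<dots> = e / 2 + 2 * (real m powr (1 - q)) * (\<integral>x. \<bar>f n x\<bar> powr q \<partial>M n)"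
      using f(2)[of n] by (simp add: prob_space)
    also have "\<dots> \<le> e / 2 + 2 * (real m powr (1 - q)) * C"
      using f(3)[of n] by (intro add_left_mono mult_left_mono) auto
    finally show ?thesis using m by simp
  qed
  then show ?thesis using fin by blast
qed

text \<open>Finitary approximants take finitely many values, with probabilities that converge. The
  laws are linked through them by \<open>L^1\<close> coupling on \<open>M n\<close>, comparison of
  point probabilities, and \<open>L^1\<close> coupling on \<open>N\<close>, at cost
  \<open>e / 3\<close> each.\<close>

lemma cv_law:
  assumes cv: "\<And>i. i < d \<Longrightarrow> cv (f i) (g i)" and "0 < e"
  shows "\<forall>\<^sub>F n in sequentially. lp_close d (distr (M n) (Rspace d) (\<lambda>x. \<lambda>i\<in>{..<d}. f i n x))
    (distr N (Rspace d) (\<lambda>x. \<lambda>i\<in>{..<d}. g i x)) e"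
proof -
  define e' where "e' = e / 3"
  \<comment> \<open>So small that \<open>d\<close> coordinate errors add up to at most
    \<open>e' * e'\<close>, the bound that \<open>lp_close_coupling_L1\<close> asks for.\<close>
  define \<delta> where "\<delta> = e' * e' / (real d + 1)"
  have e': "0 < e'" "0 < \<delta>" using \<open>0 < e\<close> by (auto simp: e'_def \<delta>_def)
  have sum_le: "(\<Sum>i<d. \<delta>) \<le> e' * e'"
  proof -
    have "(\<Sum>i<d. \<delta>) = e' * e' * (real d / (real d + 1))" by (simp add: \<delta>_def)
    also have "\<dots> \<le> e' * e' * 1" by (intro mult_left_mono) auto
    finally show ?thesis by simp
  qed
  have "\<forall>i\<in>{..<d}. \<exists>\<Phi>. finitary \<Phi> \<and> (\<forall>\<^sub>F n in sequentially. (\<integral>x. \<bar>f i n x - \<Phi> (\<kappa> n x)\<bar> \<partial>M n) < \<delta>) \<and>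
       (\<integral>x. \<bar>g i x - \<Phi> (\<kappa>' x)\<bar> \<partial>N) < \<delta>" using cv e'(2) unfolding cv_def by blast
  from bchoice[OF this] obtain \<Phi> where P: "\<And>i. i < d \<Longrightarrow> finitary (\<Phi> i)"
    "\<And>i. i < d \<Longrightarrow> \<forall>\<^sub>F n in sequentially. (\<integral>x. \<bar>f i n x - \<Phi> i (\<kappa> n x)\<bar> \<partial>M n) < \<delta>"
    "\<And>i. i < d \<Longrightarrow> (\<integral>x. \<bar>g i x - \<Phi> i (\<kappa>' x)\<bar> \<partial>N) < \<delta>" by auto
  define G where "G = PiE {..<d} (\<lambda>i. range (\<Phi> i))"
  have G: "finite G" unfolding G_def using P(1) by (intro finite_PiE finitary_finite_range) auto
  define \<rho> where "\<rho> s = (\<lambda>i\<in>{..<d}. \<Phi> i s)" for s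
  have rG: "\<rho> s \<in> G" for s by (auto simp: \<rho>_def G_def)
  \<comment> \<open>The indicator of the event that the approximants take the values
    \<open>z\<close>, written as a product so that it is visibly finitary.\<close>
  define \<Psi> where "\<Psi> z s = (\<Prod>i<d. if \<Phi> i s = z i then 1 else 0 :: real)" for z s
  have fin: "finitary (\<Psi> z)" for z
    unfolding \<Psi>_def
    using P(1) by (intro finitary_prod finitary_comp[where f="\<lambda>a. if a = z i then 1 else 0" for i]) auto
  have Psi: "\<Psi> z s = (if \<rho> s = z then 1 else 0)" if "z \<in> G" for z s
  proof (cases "\<rho> s = z")
    case False
    moreover have "z \<in> extensional {..<d}" using that by (auto simp: G_def PiE_def)
    ultimately obtain i where "i < d" "\<Phi> i s \<noteq> z i"
      by (metis (mono_tags, lifting) \<rho>_def extensionalityI lessThan_iff restrict_apply' restrict_extensional)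
    then show ?thesis using False by (auto simp: \<Psi>_def)
  qed (auto simp: \<Psi>_def \<rho>_def)
  have sets: "{x\<in>space P. \<rho> (k x) = z} \<in> sets P" and meas: "measure P {x\<in>space P. \<rho> (k x) = z} = (\<integral>x. \<Psi> z (k x) \<partial>P)"
    if "prob_space P" "code_measurable P k" "z \<in> G" for P :: "'c measure" and k z
  proof -
    interpret prob_space P by fact
    have "(\<lambda>x. \<Psi> z (k x)) \<in> borel_measurable P" by (intro measurable_finitary that fin)
    then have "{x\<in>space P. \<Psi> z (k x) = 1} \<in> sets P" by measurable
    moreover have "{x\<in>space P. \<Psi> z (k x) = 1} = {x\<in>space P. \<rho> (k x) = z}" using that by (auto simp: Psi)
    ultimately show s: "{x\<in>space P. \<rho> (k x) = z} \<in> sets P" by simp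
    have "(\<integral>x. \<Psi> z (k x) \<partial>P) = (\<integral>x. indicator {x\<in>space P. \<rho> (k x) = z} x \<partial>P)"
      using that by (intro Bochner_Integration.integral_cong) (auto simp: Psi indicator_def)
    then show "measure P {x\<in>space P. \<rho> (k x) = z} = (\<integral>x. \<Psi> z (k x) \<partial>P)"
      using s by (simp add: Int_absorb1 sets.sets_into_space)
  qed
  have mr: "(\<lambda>x. \<rho> (k x)) \<in> P \<rightarrow>\<^sub>M Rspace d" if "code_measurable P k" for P :: "'c measure" and k
    unfolding \<rho>_def using P(1) by (intro measurable_restrict measurable_finitary that) auto
  have "(\<lambda>n. \<Sum>z\<in>G. \<bar>(\<integral>x. \<Psi> z (\<kappa> n x) \<partial>M n) - (\<integral>x. \<Psi> z (\<kappa>' x) \<partial>N)\<bar>) \<longlonglongrightarrow>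
      (\<Sum>z\<in>G. \<bar>(\<integral>x. \<Psi> z (\<kappa>' x) \<partial>N) - (\<integral>x. \<Psi> z (\<kappa>' x) \<partial>N)\<bar>)"
    by (intro tendsto_intros finitary_tendsto fin)
  then have "\<forall>\<^sub>F n in sequentially. (\<Sum>z\<in>G. \<bar>(\<integral>x. \<Psi> z (\<kappa> n x) \<partial>M n) - (\<integral>x. \<Psi> z (\<kappa>' x) \<partial>N)\<bar>) < e'"
    by (rule order_tendstoD(2)) (use e' in auto)
  moreover have "\<forall>\<^sub>F n in sequentially. \<forall>i\<in>{..<d}. (\<integral>x. \<bar>f i n x - \<Phi> i (\<kappa> n x)\<bar> \<partial>M n) < \<delta>"
    using P(2) by (intro eventually_ball_finite) auto
  ultimately show ?thesis
  proof eventually_elim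
    case (elim n)
    let ?A = "distr (M n) (Rspace d) (\<lambda>x. \<lambda>i\<in>{..<d}. f i n x)"
    let ?B = "distr (M n) (Rspace d) (\<lambda>x. \<rho> (\<kappa> n x))"
    let ?C = "distr N (Rspace d) (\<lambda>x. \<rho> (\<kappa>' x))"
    let ?D = "distr N (Rspace d) (\<lambda>x. \<lambda>i\<in>{..<d}. g i x)"
    have "(\<Sum>i<d. \<integral>x. \<bar>f i n x - \<Phi> i (\<kappa> n x)\<bar> \<partial>M n) \<le> (\<Sum>i<d. \<delta>)" using elim by (intro sum_mono less_imp_le) auto
    with sum_le have AB: "lp_close d ?A ?B e'"
      unfolding \<rho>_def
      by (intro lp_close_coupling_L1 prob_M e' cv_integrable(1)[OF cv] integrable_finitary_M P(1)) auto
    have "(\<Sum>i<d. \<integral>x. \<bar>g i x - \<Phi> i (\<kappa>' x)\<bar> \<partial>N) \<le> (\<Sum>i<d. \<delta>)" using P(3) by (intro sum_mono less_imp_le) auto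
    with sum_le have DC: "lp_close d ?D ?C e'"
      unfolding \<rho>_def
      by (intro lp_close_coupling_L1 prob_N e' cv_integrable(2)[OF cv] integrable_finitary_N P(1)) auto
    have BC: "lp_close d ?B ?C e'"
    proof (rule lp_close_finite_range[OF prob_M prob_N mr[OF code_M] mr[OF code_N] G rG rG e'(1)])
      show "{x\<in>space (M n). \<rho> (\<kappa> n x) = z} \<in> sets (M n)" if "z \<in> G" for z by (intro sets prob_M code_M that)
      show "{x\<in>space N. \<rho> (\<kappa>' x) = z} \<in> sets N" if "z \<in> G" for z by (intro sets prob_N code_N that)
      have "(\<Sum>z\<in>G. \<bar>measure (M n) {x\<in>space (M n). \<rho> (\<kappa> n x) = z} - measure N {x\<in>space N. \<rho> (\<kappa>' x) = z}\<bar>) =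
         (\<Sum>z\<in>G. \<bar>(\<integral>x. \<Psi> z (\<kappa> n x) \<partial>M n) - (\<integral>x. \<Psi> z (\<kappa>' x) \<partial>N)\<bar>)"
        by (intro sum.cong refl arg_cong2[where f="\<lambda>a b. \<bar>a - b\<bar>"] meas prob_M prob_N code_M code_N)
      then show "(\<Sum>z\<in>G. \<bar>measure (M n) {x\<in>space (M n). \<rho> (\<kappa> n x) = z} - measure N {x\<in>space N. \<rho> (\<kappa>' x) = z}\<bar>) \<le> e'"
        using elim by simp
    qed
    have fm: "finite_measure ?A" "finite_measure ?B" "finite_measure ?C" "finite_measure ?D"
      by (intro prob_space.finite_measure prob_space.prob_space_distr prob_M prob_N mr code_M code_N
          measurable_restrict borel_measurable_integrable cv_integrable[OF cv]; simp)+
    have "lp_close d ?A ?C (e' + e')" by (rule lp_close_trans[OF AB BC]) (use fm in auto)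
    then have "lp_close d ?A ?D (e' + e' + e')" by (rule lp_close_trans[OF _ lp_close_sym[OF DC]]) (use fm in auto)
    then show ?case by (simp add: e'_def)
  qed
qed

end

section \<open>Norms of operators\<close>

abbreviation Lnorm :: "'a measure \<Rightarrow> real \<Rightarrow> ('a \<Rightarrow> real) \<Rightarrow> real" where
  "Lnorm M p v \<equiv> (\<integral>x. \<bar>v x\<bar> powr p \<partial>M) powr (1 / p)"

lemma Linf_iff: "v \<in> Linf M \<longleftrightarrow> v \<in> borel_measurable M \<and> (\<exists>R. AE x in M. \<bar>v x\<bar> \<le> R)"
proof (intro iffI conjI; (elim conjE)?)
  assume v: "v \<in> Linf M"
  then show "v \<in> borel_measurable M" by (simp add: Linf_def)
  have AE: "AE x in M. ereal \<bar>v x\<bar> \<le> esssup M (\<lambda>x. ereal \<bar>v x\<bar>)" by (rule esssup_AE)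
  show "\<exists>R. AE x in M. \<bar>v x\<bar> \<le> R"
  proof (cases "esssup M (\<lambda>x. ereal \<bar>v x\<bar>)")
    case (real r)
    then show ?thesis using AE by auto
  next
    case PInf
    then show ?thesis using v by (simp add: Linf_def)
  next
    case MInf
    then show ?thesis using AE by auto
  qed
next
  assume v: "v \<in> borel_measurable M" and "\<exists>R. AE x in M. \<bar>v x\<bar> \<le> R"
  then obtain R where "AE x in M. \<bar>v x\<bar> \<le> R" by blast
  then have "esssup M (\<lambda>x. ereal \<bar>v x\<bar>) \<le> ereal R" using v by (intro esssup_I) auto
  then show "v \<in> Linf M" using v by (auto simp: Linf_def intro: le_less_trans)
qed

lemma Linf_bounded: "v \<in> borel_measurable M \<Longrightarrow> (\<And>x. x \<in> space M \<Longrightarrow> \<bar>v x\<bar> \<le> R) \<Longrightarrow> v \<in> Linf M"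
  unfolding Linf_iff by (auto intro!: exI[of _ R])

lemma Linf_lin: 
  assumes "v \<in> Linf M" "w \<in> Linf M"
  shows "(\<lambda>x. a * v x + b * w x) \<in> Linf M"
proof -
  obtain R S where R: "AE x in M. \<bar>v x\<bar> \<le> R" "AE x in M. \<bar>w x\<bar> \<le> S" using assms unfolding Linf_iff by blast
  have "AE x in M. \<bar>a * v x + b * w x\<bar> \<le> \<bar>a\<bar> * R + \<bar>b\<bar> * S"
    using R
  proof eventually_elim
    case (elim x)
    have "\<bar>a * v x + b * w x\<bar> \<le> \<bar>a\<bar> * \<bar>v x\<bar> + \<bar>b\<bar> * \<bar>w x\<bar>" by (metis abs_mult abs_triangle_ineq)
    also have "\<dots> \<le> \<bar>a\<bar> * R + \<bar>b\<bar> * S" using elim by (intro add_mono mult_left_mono) auto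
    finally show ?case .
  qed
  then show ?thesis using assms unfolding Linf_iff by auto
qed

context prob_space
begin

lemma integrable_AE_bounded:
  fixes f :: "'a \<Rightarrow> real"
  assumes "f \<in> borel_measurable M" "AE x in M. \<bar>f x\<bar> \<le> R"
  shows "integrable M f"
  using assms by (intro integrable_const_bound[where B=R]) auto

lemma integrable_Linf: "v \<in> Linf M \<Longrightarrow> integrable M v"
  unfolding Linf_iff by (auto intro: integrable_AE_bounded)

lemma AE_bounded_powr:
  fixes v :: "'a \<Rightarrow> real" and R p :: real
  assumes "v \<in> borel_measurable M" "AE x in M. \<bar>v x\<bar> \<le> R" "0 \<le> p"
  shows "integrable M (\<lambda>x. \<bar>v x\<bar> powr p)" "(\<integral>x. \<bar>v x\<bar> powr p \<partial>M) \<le> R powr p"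
proof -
  have le: "AE x in M. \<bar>v x\<bar> powr p \<le> R powr p" using assms(2) by eventually_elim (use assms(3) in \<open>auto intro: powr_mono2\<close>)
  show i: "integrable M (\<lambda>x. \<bar>v x\<bar> powr p)"
    using assms(1) le by (intro integrable_AE_bounded[where R="R powr p"]) auto
  have "(\<integral>x. \<bar>v x\<bar> powr p \<partial>M) \<le> (\<integral>x. R powr p \<partial>M)" using le i by (intro integral_mono_AE) auto
  then show "(\<integral>x. \<bar>v x\<bar> powr p \<partial>M) \<le> R powr p" by (simp add: prob_space)
qed

lemma integrable_Linf_powr: "v \<in> Linf M \<Longrightarrow> 0 \<le> p \<Longrightarrow> integrable M (\<lambda>x. \<bar>v x\<bar> powr p)"
  unfolding Linf_iff using AE_bounded_powr(1) by blast

lemma Lnorm_le_bound: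
  fixes R :: real
  assumes "v \<in> borel_measurable M" "AE x in M. \<bar>v x\<bar> \<le> R" "1 \<le> p" "0 \<le> R"
  shows "Lnorm M p v \<le> R"
proof -
  have "Lnorm M p v \<le> (R powr p) powr (1 / p)"
    using AE_bounded_powr[OF assms(1,2), of p] assms(3) by (intro powr_mono2) auto
  also have "\<dots> = R" using assms by (simp add: powr_powr)
  finally show ?thesis .
qed

text \<open>Among functions bounded by \<open>R\<close>, smallness in \<open>L^1\<close> entails
  smallness in \<open>L^p\<close>. The supremum norm has no such property, which is what the
  finiteness of \<open>p\<close> is for.\<close>

lemma integral_powr_le_L1:
  fixes v :: "'a \<Rightarrow> real" and R p :: real
  assumes v: "v \<in> borel_measurable M" "AE x in M. \<bar>v x\<bar> \<le> R" "1 \<le> p"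
  shows "(\<integral>x. \<bar>v x\<bar> powr p \<partial>M) \<le> R powr (p - 1) * (\<integral>x. \<bar>v x\<bar> \<partial>M)"
proof -
  have "(\<integral>x. \<bar>v x\<bar> powr p \<partial>M) \<le> (\<integral>x. R powr (p - 1) * \<bar>v x\<bar> \<partial>M)"
  proof (rule integral_mono_AE)
    show "integrable M (\<lambda>x. \<bar>v x\<bar> powr p)" using v by (intro AE_bounded_powr) auto
    show "integrable M (\<lambda>x. R powr (p - 1) * \<bar>v x\<bar>)" using integrable_AE_bounded[OF v(1,2)] by auto
    show "AE x in M. \<bar>v x\<bar> powr p \<le> R powr (p - 1) * \<bar>v x\<bar>"
      using v(2)
    proof eventually_elim
      case (elim x)
      have "\<bar>v x\<bar> powr p = \<bar>v x\<bar> powr (p - 1) * \<bar>v x\<bar> powr 1"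
        using powr_add[of "\<bar>v x\<bar>" "p - 1" 1] by simp
      also have "\<dots> \<le> R powr (p - 1) * \<bar>v x\<bar>" using elim v(3) by (auto intro!: mult_right_mono powr_mono2)
      finally show ?case .
    qed
  qed
  then show ?thesis by simp
qed

text \<open>The constant \<open>2\<close> is not optimal; it spares an appeal to Jensen's inequality.\<close>

lemma L1_le_Lq:
  fixes g :: "'a \<Rightarrow> real" and q b :: real
  assumes q: "1 < q" and g: "integrable M g" "integrable M (\<lambda>x. \<bar>g x\<bar> powr q)"
    and b: "0 \<le> b" "(\<integral>x. \<bar>g x\<bar> powr q \<partial>M) \<le> b powr q"
  shows "(\<integral>x. \<bar>g x\<bar> \<partial>M) \<le> 2 * b"
proof (rule field_le_epsilon)
  fix e :: real assume "0 < e"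
  \<comment> \<open>A positive substitute for \<open>b\<close>, which may be 0; the estimate at
    level \<open>l\<close> gives \<open>2 * l = 2 * b + e\<close>.\<close>
  define l where "l = b + e / 2"
  have l: "0 < l" "b \<le> l" using b \<open>0 < e\<close> by (auto simp: l_def)
  have "(\<integral>x. \<bar>g x\<bar> \<partial>M) \<le> (\<integral>x. l + l powr (1 - q) * \<bar>g x\<bar> powr q \<partial>M)"
  proof (rule integral_mono)
    fix x
    have "0 \<le> l powr (1 - q) * \<bar>g x\<bar> powr q" by simp
    then show "\<bar>g x\<bar> \<le> l + l powr (1 - q) * \<bar>g x\<bar> powr q"
      using abs_le_powr_tail[of q l "g x"] q l by linarith
  qed (use g in auto)
  also have "\<dots> = l + l powr (1 - q) * (\<integral>x. \<bar>g x\<bar> powr q \<partial>M)" using g by (simp add: prob_space)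
  also have "\<dots> \<le> l + l powr (1 - q) * l powr q"
    using b l q by (intro add_left_mono mult_left_mono order.trans[OF b(2)] powr_mono2) auto
  also have "\<dots> = 2 * b + e" using l by (simp add: l_def flip: powr_add)
  finally show "(\<integral>x. \<bar>g x\<bar> \<partial>M) \<le> 2 * b + e" .
qed

lemma Lp_norm_integrable:
  assumes "integrable M (\<lambda>x. \<bar>f x\<bar> powr p)"
  shows "Lp_norm M (ereal p) f = ereal (Lnorm M p f)"
proof -
  have "(\<integral>\<^sup>+ x. ennreal (\<bar>f x\<bar> powr p) \<partial>M) = ennreal (\<integral>x. \<bar>f x\<bar> powr p \<partial>M)"
    using assms by (intro nn_integral_eq_integral) auto
  then show ?thesis by (simp add: Lp_norm_def integral_nonneg_AE)
qed

lemma Lp_norm_le_iff: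
  assumes f: "f \<in> borel_measurable M" and q: "0 < q" and b: "0 \<le> b"
  shows "Lp_norm M (ereal q) f \<le> ereal b \<longleftrightarrow> integrable M (\<lambda>x. \<bar>f x\<bar> powr q) \<and> (\<integral>x. \<bar>f x\<bar> powr q \<partial>M) \<le> b powr q"
proof (cases "integrable M (\<lambda>x. \<bar>f x\<bar> powr q)")
  case True
  have nn: "0 \<le> (\<integral>x. \<bar>f x\<bar> powr q \<partial>M)" by (rule Bochner_Integration.integral_nonneg) simp
  have "Lnorm M q f \<le> b \<longleftrightarrow> (\<integral>x. \<bar>f x\<bar> powr q \<partial>M) \<le> b powr q"
  proof
    assume "Lnorm M q f \<le> b"
    then have "Lnorm M q f powr q \<le> b powr q" using q by (intro powr_mono2) auto
    then show "(\<integral>x. \<bar>f x\<bar> powr q \<partial>M) \<le> b powr q" using q nn by (simp add: powr_powr)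
  next
    assume "(\<integral>x. \<bar>f x\<bar> powr q \<partial>M) \<le> b powr q"
    then have "Lnorm M q f \<le> (b powr q) powr (1 / q)" using q nn by (intro powr_mono2) auto
    then show "Lnorm M q f \<le> b" using q b by (simp add: powr_powr)
  qed
  then show ?thesis using True by (simp add: Lp_norm_integrable)
next
  case False
  have "(\<integral>\<^sup>+ x. ennreal (\<bar>f x\<bar> powr q) \<partial>M) = \<infinity>"
    using False f by (auto simp: integrable_iff_bounded less_top[symmetric])
  then show ?thesis using False by (simp add: Lp_norm_def)
qed

lemma Lp_norm_infty_le_iff:
  assumes f: "f \<in> borel_measurable M"
  shows "Lp_norm M \<infinity> f \<le> ereal b \<longleftrightarrow> (AE x in M. \<bar>f x\<bar> \<le> b)"
proof
  assume "Lp_norm M \<infinity> f \<le> ereal b"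
  then have le: "esssup M (\<lambda>x. ereal \<bar>f x\<bar>) \<le> ereal b" by (simp add: Lp_norm_def)
  have "AE x in M. ereal \<bar>f x\<bar> \<le> esssup M (\<lambda>x. ereal \<bar>f x\<bar>)" by (rule esssup_AE)
  then show "AE x in M. \<bar>f x\<bar> \<le> b"
  proof eventually_elim
    case (elim x)
    from order.trans[OF elim le] show ?case by simp
  qed
next
  assume "AE x in M. \<bar>f x\<bar> \<le> b"
  then show "Lp_norm M \<infinity> f \<le> ereal b" using f by (auto simp: Lp_norm_def intro!: esssup_I)
qed

text \<open>Markov's inequality with exponent \<open>n + 2\<close> bounds the probability that
  \<open>\<bar>f x\<bar>\<close> is at least \<open>l\<close> by \<open>(b / l) ^ (n + 2)\<close>,
  which tends to 0 for every \<open>l > b\<close>. The shift by 2 keeps the exponents above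
  1.\<close>

lemma AE_bounded_if_Lq_bounded:
  fixes f :: "'a \<Rightarrow> real" and b :: real
  assumes f: "f \<in> borel_measurable M" and b: "0 \<le> b"
    and le: "\<And>q. 1 < q \<Longrightarrow> integrable M (\<lambda>x. \<bar>f x\<bar> powr q) \<and> (\<integral>x. \<bar>f x\<bar> powr q \<partial>M) \<le> b powr q"
  shows "AE x in M. \<bar>f x\<bar> \<le> b"
proof -
  note [measurable] = f
  have "AE x in M. \<bar>f x\<bar> < l" if l: "b < l" for l
  proof -
    have [measurable]: "{x\<in>space M. l \<le> \<bar>f x\<bar>} \<in> sets M" by measurable
    have "prob {x\<in>space M. l \<le> \<bar>f x\<bar>} \<le> (b / l) ^ (n + 2)" for n
    proof -
      define q where "q = real (n + 2)"
      have q: "1 < q" by (simp add: q_def)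
      have "{x\<in>space M. l \<le> \<bar>f x\<bar>} \<subseteq> {x\<in>space M. l powr q \<le> \<bar>f x\<bar> powr q}"
        using l b q by (auto intro: powr_mono2)
      then have "prob {x\<in>space M. l \<le> \<bar>f x\<bar>} \<le> prob {x\<in>space M. l powr q \<le> \<bar>f x\<bar> powr q}"
        by (intro finite_measure_mono) auto
      also have "\<dots> \<le> (\<integral>x. \<bar>f x\<bar> powr q \<partial>M) / l powr q"
        using le[OF q] l b by (intro integral_Markov_inequality_measure[where A="{}"]) auto
      also have "\<dots> \<le> b powr q / l powr q" using le[OF q] by (intro divide_right_mono) auto
      also have "\<dots> = (b / l) powr q" using l b by (simp add: powr_divide)
      also have "\<dots> = (b / l) ^ (n + 2)" unfolding q_def by (rule powr_realpow') (use l b in auto)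
      finally show ?thesis .
    qed
    moreover have "(\<lambda>n. (b / l) ^ (n + 2)) \<longlonglongrightarrow> 0"
      using l b by (intro LIMSEQ_ignore_initial_segment LIMSEQ_power_zero) auto
    ultimately have "prob {x\<in>space M. l \<le> \<bar>f x\<bar>} \<le> 0" by (intro LIMSEQ_le_const) auto
    then have "prob {x\<in>space M. l \<le> \<bar>f x\<bar>} = 0" by (simp add: measure_le_0_iff)
    then have "{x\<in>space M. l \<le> \<bar>f x\<bar>} \<in> null_sets M" by (auto simp: null_sets_def emeasure_eq_measure)
    then show ?thesis by (rule AE_I') (auto simp: not_less)
  qed
  then have "AE x in M. \<forall>n::nat. \<bar>f x\<bar> < b + 1 / real (Suc n)" by (subst AE_all_countable) auto
  then show ?thesis
  proof eventually_elim
    case (elim x)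
    show ?case
    proof (rule ccontr)
      assume "\<not> \<bar>f x\<bar> \<le> b"
      then obtain n :: nat where "1 / real (Suc n) < \<bar>f x\<bar> - b" using nat_approx_posE[of "\<bar>f x\<bar> - b"] by auto
      then show False using elim[rule_format, of n] by simp
    qed
  qed
qed

end

definition AE_linear :: "'a measure \<Rightarrow> (('a \<Rightarrow> real) \<Rightarrow> 'a \<Rightarrow> real) \<Rightarrow> bool" where
  "AE_linear M A \<longleftrightarrow>
     (\<forall>v\<in>Linf M. integrable M (A v)) \<and>
     (\<forall>v\<in>Linf M. \<forall>w\<in>Linf M. (AE x in M. v x = w x) \<longrightarrow> (AE x in M. A v x = A w x)) \<and>
     (\<forall>v\<in>Linf M. \<forall>w\<in>Linf M. \<forall>a b::real.
        AE x in M. A (\<lambda>y. a * v y + b * w y) x = a * A v x + b * A w x)"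

lemma AE_linear_integrable: "AE_linear M A \<Longrightarrow> v \<in> Linf M \<Longrightarrow> integrable M (A v)"
  by (simp add: AE_linear_def)

lemma AE_linear_cong:
  "AE_linear M A \<Longrightarrow> v \<in> Linf M \<Longrightarrow> w \<in> Linf M \<Longrightarrow> AE x in M. v x = w x \<Longrightarrow> AE x in M. A v x = A w x"
  by (simp add: AE_linear_def)

lemma AE_linear_lin:
  "AE_linear M A \<Longrightarrow> v \<in> Linf M \<Longrightarrow> w \<in> Linf M \<Longrightarrow>
    AE x in M. A (\<lambda>y. a * v y + b * w y) x = a * A v x + b * A w x"
  by (simp add: AE_linear_def)

lemma P_operator_AE_linear: "P_operator M A \<longleftrightarrow> prob_space M \<and> AE_linear M A \<and> op_norm M \<infinity> 1 A < \<infinity>"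
  unfolding P_operator_def AE_linear_def by blast

text \<open>Phrased with \<open>q\<close>-th powers of real integrals, which keeps extended reals
  out of the limit arguments. Functions of norm zero are included although \<open>op_norm\<close>
  omits them.\<close>

definition Lq_bounded :: "'a measure \<Rightarrow> real \<Rightarrow> real \<Rightarrow> real \<Rightarrow> (('a \<Rightarrow> real) \<Rightarrow> 'a \<Rightarrow> real) \<Rightarrow> bool" where
  "Lq_bounded M p q c A \<longleftrightarrow> (\<forall>v\<in>Linf M. integrable M (\<lambda>x. \<bar>A v x\<bar> powr q) \<and>
     (\<integral>x. \<bar>A v x\<bar> powr q \<partial>M) \<le> (c * Lnorm M p v) powr q)"

text \<open>The case \<open>q = \<infinity>\<close> is expressed by uniform bounds for all finite exponents.\<close>

definition finite_exponents :: "ereal \<Rightarrow> real set" where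
  "finite_exponents q = (if q = \<infinity> then {1<..} else {real_of_ereal q})"

lemma finite_exponents_gt_1: "1 < q \<Longrightarrow> r \<in> finite_exponents q \<Longrightarrow> 1 < r"
  by (cases q) (auto simp: finite_exponents_def one_ereal_def split: if_splits)

lemma finite_exponents_nonempty: "finite_exponents q \<noteq> {}"
  by (auto simp: finite_exponents_def intro: exI[of _ 2])

lemma Lp_norm_le_iff_exponents:
  assumes "prob_space M" "f \<in> borel_measurable M" "1 < q" "0 \<le> b"
  shows "Lp_norm M q f \<le> ereal b \<longleftrightarrow>
    (\<forall>r\<in>finite_exponents q. integrable M (\<lambda>x. \<bar>f x\<bar> powr r) \<and> (\<integral>x. \<bar>f x\<bar> powr r \<partial>M) \<le> b powr r)"
proof -
  interpret prob_space M by fact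
  show ?thesis
  proof (cases q)
    case (real r)
    then show ?thesis using assms Lp_norm_le_iff[of f r b] by (auto simp: finite_exponents_def)
  next
    case PInf
    show ?thesis
      unfolding PInf Lp_norm_infty_le_iff[OF assms(2)]
      using AE_bounded_powr[OF assms(2)] AE_bounded_if_Lq_bounded[OF assms(2,4)]
      by (auto simp: finite_exponents_def)
  qed (use assms in auto)
qed

text \<open>The supremum in \<open>op_norm\<close> skips functions of norm zero. For these
  \<open>v = 0\<close> almost everywhere, so \<open>A v = 0\<close> almost everywhere by linearity,
  and the bound holds there as well.\<close>

lemma op_norm_bound_iff:
  assumes "prob_space M" and lin: "AE_linear M A" and p: "1 \<le> p" and q: "1 < q" and c: "0 < c"
  shows "op_norm M (ereal p) q A \<le> ereal c \<longleftrightarrow> (\<forall>r\<in>finite_exponents q. Lq_bounded M p r c A)"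
proof -
  interpret prob_space M by fact
  have Av: "A v \<in> borel_measurable M" if "v \<in> Linf M" for v
    using lin that by (auto simp: AE_linear_def)
  have n: "Lp_norm M (ereal p) v = ereal (Lnorm M p v)" if "v \<in> Linf M" for v
    using that p by (intro Lp_norm_integrable integrable_Linf_powr) auto
  have zero: "Lp_norm M q (A v) \<le> ereal 0" if v: "v \<in> Linf M" and "Lnorm M p v = 0" for v
  proof -
    have "(\<integral>x. \<bar>v x\<bar> powr p \<partial>M) = 0" using that by simp
    then have "AE x in M. \<bar>v x\<bar> powr p = 0"
      using v p by (subst (asm) integral_nonneg_eq_0_iff_AE) (auto intro: integrable_Linf_powr)
    then have v0: "AE x in M. v x = (\<lambda>_. 0) x" by eventually_elim simp
    have z: "(\<lambda>_. 0) \<in> Linf M" by (rule Linf_bounded[where R=0]) auto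
    have "AE x in M. A (\<lambda>y. 0 * 0 + 0 * 0) x = 0 * A (\<lambda>_. 0) x + 0 * A (\<lambda>_. 0) x"
      by (rule AE_linear_lin[OF lin z z])
    moreover have "AE x in M. A v x = A (\<lambda>_. 0) x" by (rule AE_linear_cong[OF lin v z v0])
    ultimately have A0: "AE x in M. A v x = 0" by eventually_elim simp
    have "integrable M (\<lambda>x. \<bar>A v x\<bar> powr r) \<and> (\<integral>x. \<bar>A v x\<bar> powr r \<partial>M) \<le> 0 powr r" if "1 < r" for r
      using AE_bounded_powr[OF Av[OF v], of 0 r] A0 that by auto
    then show ?thesis using finite_exponents_gt_1[OF q] assms Av[OF v]
      by (subst Lp_norm_le_iff_exponents) auto
  qed
  have "op_norm M (ereal p) q A \<le> ereal c \<longleftrightarrow> (\<forall>v\<in>Linf M. Lp_norm M q (A v) \<le> ereal (c * Lnorm M p v))"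
  proof -
    have "Lp_norm M q (A v) / Lp_norm M (ereal p) v \<le> ereal c \<longleftrightarrow> Lp_norm M q (A v) \<le> ereal (c * Lnorm M p v)"
      if "v \<in> Linf M" "Lp_norm M (ereal p) v \<noteq> 0" for v
    proof -
      have "0 < Lnorm M p v" using that n[OF that(1)] by (auto simp: zero_ereal_def less_le)
      then show ?thesis unfolding n[OF that(1)] by (subst ereal_divide_le_pos) (auto simp: mult.commute)
    qed
    moreover have "Lp_norm M q (A v) \<le> ereal (c * Lnorm M p v)" if "v \<in> Linf M" "Lp_norm M (ereal p) v = 0" for v
    proof -
      have "Lnorm M p v = 0" using that n[OF that(1)] by (simp add: zero_ereal_def)
      then show ?thesis using zero[OF that(1)] by simp
    qed
    ultimately show ?thesis unfolding op_norm_def SUP_le_iff by blast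
  qed
  also have "\<dots> \<longleftrightarrow> (\<forall>r\<in>finite_exponents q. Lq_bounded M p r c A)"
    unfolding Lq_bounded_def using c by (subst ball_cong[OF refl Lp_norm_le_iff_exponents[OF assms(1) Av q]]) auto
  finally show ?thesis .
qed

lemma Lq_bounded_integral_abs_le:
  assumes "prob_space M" "AE_linear M A" "Lq_bounded M p r c A" "1 < r" "0 < c" "v \<in> Linf M"
  shows "(\<integral>x. \<bar>A v x\<bar> \<partial>M) \<le> 2 * (c * Lnorm M p v)"
proof -
  interpret prob_space M by fact
  show ?thesis
    by (rule L1_le_Lq[of r]) (use assms in \<open>auto simp: AE_linear_def Lq_bounded_def\<close>)
qed

text \<open>On a probability space the \<open>p\<close>-norm is at most the supremum norm, and
  \<open>L1_le_Lq\<close> compares the norms of the image; its factor 2 reappears in the bound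
  \<open>2 * c\<close>.\<close>

lemma Lq_bounded_op_norm_finite:
  assumes "prob_space M" and lin: "AE_linear M A" and bd: "Lq_bounded M p r c A" "1 < r" "0 < c" and p: "1 \<le> p"
  shows "op_norm M \<infinity> 1 A < \<infinity>"
proof -
  interpret prob_space M by fact
  have "op_norm M \<infinity> 1 A \<le> ereal (2 * c)"
    unfolding op_norm_def
  proof (rule SUP_least)
    fix v assume "v \<in> {v \<in> Linf M. Lp_norm M \<infinity> v \<noteq> 0}"
    then have v: "v \<in> Linf M" "Lp_norm M \<infinity> v \<noteq> 0" by auto
    have vm: "v \<in> borel_measurable M" using v by (simp add: Linf_def)
    obtain R where "Lp_norm M \<infinity> v \<le> ereal R" using v(1) Lp_norm_infty_le_iff[OF vm] unfolding Linf_iff by blast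
    moreover have "0 \<le> Lp_norm M \<infinity> v"
    proof -
      have "esssup M (\<lambda>x. 0::ereal) \<le> esssup M (\<lambda>x. ereal \<bar>v x\<bar>)" by (intro esssup_mono) auto
      then show ?thesis by (simp add: Lp_norm_def esssup_const emeasure_space_1)
    qed
    ultimately obtain s where s: "Lp_norm M \<infinity> v = ereal s" "0 < s"
      using v(2) by (cases "Lp_norm M \<infinity> v") (auto simp: zero_ereal_def)
    then have "AE x in M. \<bar>v x\<bar> \<le> s" using Lp_norm_infty_le_iff[OF vm, of s] by simp
    then have "Lnorm M p v \<le> s" using vm p s by (intro Lnorm_le_bound) auto
    then have "2 * (c * Lnorm M p v) \<le> 2 * (c * s)" using bd by (intro mult_left_mono) auto
    then have "(\<integral>x. \<bar>A v x\<bar> \<partial>M) \<le> 2 * c * s"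
      using Lq_bounded_integral_abs_le[OF assms(1) lin bd v(1)] by simp
    moreover have "Lp_norm M 1 (A v) = ereal (\<integral>x. \<bar>A v x\<bar> \<partial>M)"
      using lin v(1) Lp_norm_integrable[of "A v" 1] by (simp add: AE_linear_def one_ereal_def)
    ultimately show "Lp_norm M 1 (A v) / Lp_norm M \<infinity> v \<le> ereal (2 * c)"
      unfolding s(1) using s(2) by (subst ereal_divide_le_pos) (auto simp: mult.commute)
  qed
  then show ?thesis by (auto intro: le_less_trans)
qed

section \<open>The limit operator\<close>

lemma powr_Lipschitz:
  fixes a b K q :: real
  assumes q: "1 \<le> q" and "0 \<le> a" "a \<le> K" "0 \<le> b" "b \<le> K"
  shows "\<bar>a powr q - b powr q\<bar> \<le> q * K powr (q - 1) * \<bar>a - b\<bar>"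
proof -
  have *: "\<bar>b powr q - a powr q\<bar> \<le> q * K powr (q - 1) * \<bar>b - a\<bar>" if ab: "0 \<le> a" "a < b" "b \<le> K" for a b :: real
  proof -
    have "continuous_on {a..b} (\<lambda>x. x powr q)"
      using q ab by (intro continuous_on_powr' continuous_intros) auto
    moreover have "((\<lambda>x. x powr q) has_real_derivative q * z powr (q - 1)) (at z)" if "a < z" for z
      using that ab by (intro has_real_derivative_powr) auto
    ultimately obtain l z where z: "a < z" "z < b" "DERIV (\<lambda>x. x powr q) z :> l" "b powr q - a powr q = (b - a) * l"
      using MVT[OF ab(2), of "\<lambda>x. x powr q"] real_differentiable_def by blast
    have "l = q * z powr (q - 1)"
      using z ab by (intro DERIV_unique[OF z(3)] has_real_derivative_powr) auto
    moreover have "q * z powr (q - 1) \<le> q * K powr (q - 1)"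
      using z ab q by (intro mult_left_mono powr_mono2) auto
    moreover have "0 \<le> q * z powr (q - 1)" using q by simp
    ultimately show ?thesis
      using z(4) ab by (simp add: abs_mult mult.commute mult_left_mono)
  qed
  show ?thesis
    using *[of a b] *[of b a] assms by (cases a b rule: linorder_cases) (auto simp: abs_minus_commute)
qed

text \<open>For \<open>q > 1\<close> a power is not Lipschitz on the whole line, while
  \<open>cv_comp\<close> applies to Lipschitz functions only; truncation at \<open>K\<close> repairs
  this.\<close>

lemma truncated_powr_Lipschitz:
  fixes a b K q :: real
  assumes q: "1 \<le> q" and "0 \<le> K"
  shows "\<bar>min \<bar>a\<bar> K powr q - min \<bar>b\<bar> K powr q\<bar> \<le> q * K powr (q - 1) * \<bar>a - b\<bar>"
proof -
  have "\<bar>min \<bar>a\<bar> K powr q - min \<bar>b\<bar> K powr q\<bar> \<le> q * K powr (q - 1) * \<bar>min \<bar>a\<bar> K - min \<bar>b\<bar> K\<bar>"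
    using assms by (intro powr_Lipschitz) auto
  also have "\<dots> \<le> q * K powr (q - 1) * \<bar>a - b\<bar>"
    using q by (intro mult_left_mono) (auto simp: min_def)
  finally show ?thesis .
qed

lemma AE_linear_sum:
  assumes lin: "AE_linear M A" and "finite I" "\<And>i. i \<in> I \<Longrightarrow> v i \<in> Linf M"
  shows "(\<lambda>y. \<Sum>i\<in>I. a i * v i y) \<in> Linf M \<and> (AE x in M. A (\<lambda>y. \<Sum>i\<in>I. a i * v i y) x = (\<Sum>i\<in>I. a i * A (v i) x))"
  using assms(2,3)
proof (induction I rule: finite_induct)
  case empty
  have z: "(\<lambda>_. 0) \<in> Linf M" by (rule Linf_bounded[where R=0]) auto
  then show ?case using AE_linear_lin[OF lin z z, of 0 0] by simp
next
  case (insert i I)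
  define w where "w y = (\<Sum>i\<in>I. a i * v i y)" for y
  have w: "w \<in> Linf M" "AE x in M. A w x = (\<Sum>i\<in>I. a i * A (v i) x)"
    using insert unfolding w_def by auto
  have vi: "v i \<in> Linf M" using insert by simp
  have eq: "(\<lambda>y. \<Sum>j\<in>insert i I. a j * v j y) = (\<lambda>y. a i * v i y + 1 * w y)"
    using insert by (simp add: w_def)
  have "AE x in M. A (\<lambda>y. a i * v i y + 1 * w y) x = a i * A (v i) x + 1 * A w x"
    by (rule AE_linear_lin[OF lin vi w(1)])
  then have "AE x in M. A (\<lambda>y. a i * v i y + 1 * w y) x = (\<Sum>j\<in>insert i I. a j * A (v j) x)"
    using w(2) by eventually_elim (use insert in simp)
  then show ?case unfolding eq using Linf_lin[OF vi w(1), of "a i" 1] by simp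
qed

context limit_space
begin

lemma cv_zero: "cv (\<lambda>_ _. 0) (\<lambda>_. 0)"
  using cv_finitary[OF finitary_const, of 0] .

lemma cv_sum:
  assumes "finite I" "\<And>i. i \<in> I \<Longrightarrow> cv (f i) (g i)"
  shows "cv (\<lambda>n x. \<Sum>i\<in>I. a i * f i n x) (\<lambda>x. \<Sum>i\<in>I. a i * g i x)"
  using assms
proof (induction I rule: finite_induct)
  case empty
  then show ?case using cv_zero by simp
next
  case (insert i I)
  then show ?case using cv_lin[of "f i" "g i" "\<lambda>n x. \<Sum>i\<in>I. a i * f i n x" "\<lambda>x. \<Sum>i\<in>I. a i * g i x" "a i" 1]
    by simp
qed

lemma cv_truncated_powr:
  assumes "cv f g" "1 \<le> q" "0 < K"
  shows "(\<lambda>n. \<integral>x. min \<bar>f n x\<bar> K powr q \<partial>M n) \<longlonglongrightarrow> (\<integral>x. min \<bar>g x\<bar> K powr q \<partial>N)"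
proof (rule cv_integral, rule cv_comp[OF assms(1), of "q * K powr (q - 1)"])
  show "0 < q * K powr (q - 1)" using assms by simp
  show "\<bar>min \<bar>a\<bar> K powr q - min \<bar>b\<bar> K powr q\<bar> \<le> q * K powr (q - 1) * \<bar>a - b\<bar>" for a b
    using assms by (intro truncated_powr_Lipschitz) auto
qed measurable

definition bounded_seq :: "real \<Rightarrow> (nat \<Rightarrow> 'a \<Rightarrow> real) \<Rightarrow> bool" where
  "bounded_seq R f \<longleftrightarrow> (\<forall>n. f n \<in> borel_measurable (M n) \<and> (\<forall>x\<in>space (M n). \<bar>f n x\<bar> \<le> R))"

lemma bounded_seq_Linf: "bounded_seq R f \<Longrightarrow> f n \<in> Linf (M n)"
  unfolding bounded_seq_def by (auto intro: Linf_bounded)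

lemma bounded_seq_mono: "bounded_seq R f \<Longrightarrow> R \<le> R' \<Longrightarrow> bounded_seq R' f"
  unfolding bounded_seq_def by force

lemma bounded_seq_finitary: "finitary \<Phi> \<Longrightarrow> (\<And>s. \<bar>\<Phi> s\<bar> \<le> R) \<Longrightarrow> bounded_seq R (\<lambda>n x. \<Phi> (\<kappa> n x))"
  unfolding bounded_seq_def by (auto intro: measurable_finitary[OF code_M])

lemma bounded_seq_lin:
  assumes "bounded_seq R f" "bounded_seq S g"
  shows "bounded_seq (\<bar>a\<bar> * R + \<bar>b\<bar> * S) (\<lambda>n x. a * f n x + b * g n x)"
  unfolding bounded_seq_def
proof (intro allI conjI ballI)
  fix n x assume x: "x \<in> space (M n)"
  have "\<bar>a * f n x + b * g n x\<bar> \<le> \<bar>a\<bar> * \<bar>f n x\<bar> + \<bar>b\<bar> * \<bar>g n x\<bar>" by (metis abs_mult abs_triangle_ineq)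
  also have "\<dots> \<le> \<bar>a\<bar> * R + \<bar>b\<bar> * S"
    using assms x unfolding bounded_seq_def by (intro add_mono mult_left_mono) auto
  finally show "\<bar>a * f n x + b * g n x\<bar> \<le> \<bar>a\<bar> * R + \<bar>b\<bar> * S" .
qed (use assms in \<open>auto simp: bounded_seq_def intro!: borel_measurable_add borel_measurable_times\<close>)

lemma cv_lift_bounded_seq:
  assumes "v \<in> Linf N"
  obtains R f where "0 \<le> R" "bounded_seq R f" "cv f v"
proof -
  interpret N: prob_space N by (rule prob_N)
  obtain R where R: "AE x in N. \<bar>v x\<bar> \<le> R" using assms unfolding Linf_iff by blast
  then have R0: "AE x in N. \<bar>v x\<bar> \<le> max R 0" by eventually_elim simp
  obtain \<Psi> where P: "\<And>n. finitary (\<Psi> n)" "\<And>n s. \<bar>\<Psi> n s\<bar> \<le> max R 0" "cv (\<lambda>n x. \<Psi> n (\<kappa> n x)) v"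
    using cv_lift[OF N.integrable_Linf[OF assms] R0] by blast
  have "bounded_seq (max R 0) (\<lambda>n x. \<Psi> n (\<kappa> n x))"
    unfolding bounded_seq_def using P(2) measurable_finitary[OF code_M P(1)] by blast
  then show thesis using that[of "max R 0"] P(3) by simp
qed

end

text \<open>\<open>level\<close> states the closure of the coded family under the operators. The
  index \<open>j\<close> is chosen before \<open>n\<close>, so that one coordinate of the code
  describes the image on every space.\<close>

locale operator_limit = limit_space M \<kappa> N \<kappa>'
  for M :: "nat \<Rightarrow> 'a measure" and \<kappa> and N :: "'b measure" and \<kappa>' +
  fixes A :: "nat \<Rightarrow> ('a \<Rightarrow> real) \<Rightarrow> 'a \<Rightarrow> real" and p q c :: real
  assumes lin: "\<And>n. AE_linear (M n) (A n)" and bd: "\<And>n. Lq_bounded (M n) p q c (A n)"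
    and p: "1 \<le> p" and q: "1 < q" and c: "0 < c"
    and level: "\<And>J s r. s \<subseteq> {..<J} \<Longrightarrow> r \<in> \<rat> \<Longrightarrow> \<exists>j. \<forall>n. \<forall>x\<in>space (M n).
        j \<in> \<kappa> n x \<longleftrightarrow> r < A n (indicator {x\<in>space (M n). \<kappa> n x \<inter> {..<J} = s}) x"
begin

text \<open>A finitary function is a combination of indicators of cylinders with coefficients
  independent of \<open>n\<close>. The images of these indicators have bounded \<open>q\<close>-th
  moments and, by \<open>level\<close>, coded level sets, so they converge.\<close>

lemma cv_operator_finitary:
  assumes "finitary \<Phi>"
  shows "\<exists>h. cv (\<lambda>n. A n (\<lambda>x. \<Phi> (\<kappa> n x))) h"
proof -
  obtain J where J: "\<And>s. \<Phi> s = \<Phi> (s \<inter> {..<J})" using assms unfolding finitary_def by blast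
  define E where "E n s = {x\<in>space (M n). \<kappa> n x \<inter> {..<J} = s}" for n s
  define I where "I n s = (indicator (E n s) :: 'a \<Rightarrow> real)" for n s
  have E: "E n s \<in> sets (M n)" for n s unfolding E_def by (rule sets_code_cylinder[OF code_M])
  have I: "I n s \<in> Linf (M n)" for n s
    unfolding I_def using E by (intro Linf_bounded[where R=1]) (auto simp: indicator_def)
  have "\<exists>h. cv (\<lambda>n. A n (I n s)) h" if s: "s \<subseteq> {..<J}" for s
  proof (rule cv_exists)
    show "integrable (M n) (A n (I n s))" for n by (rule AE_linear_integrable[OF lin I])
    have b: "integrable (M n) (\<lambda>x. \<bar>A n (I n s) x\<bar> powr q)" "(\<integral>x. \<bar>A n (I n s) x\<bar> powr q \<partial>M n) \<le> c powr q" for n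
    proof -
      interpret prob_space "M n" by (rule prob_M)
      show "integrable (M n) (\<lambda>x. \<bar>A n (I n s) x\<bar> powr q)" using bd[of n] I[of n s] by (simp add: Lq_bounded_def)
      have "Lnorm (M n) p (I n s) \<le> 1"
      proof (rule Lnorm_le_bound)
        show "I n s \<in> borel_measurable (M n)" using I[of n s] by (simp add: Linf_iff)
        show "AE x in M n. \<bar>I n s x\<bar> \<le> 1" by (rule AE_I2) (simp add: I_def indicator_def)
      qed (use p in auto)
      then have "c * Lnorm (M n) p (I n s) \<le> c" using c by simp
      then have "(c * Lnorm (M n) p (I n s)) powr q \<le> c powr q" using c q by (intro powr_mono2) auto
      then show "(\<integral>x. \<bar>A n (I n s) x\<bar> powr q \<partial>M n) \<le> c powr q"
        using bd[of n] I[of n s] unfolding Lq_bounded_def by (blast intro: order.trans)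
    qed
    fix e :: real assume "0 < e"
    obtain \<Psi> where "finitary \<Psi>" "\<forall>n. (\<integral>x. \<bar>A n (I n s) x - \<Psi> (\<kappa> n x)\<bar> \<partial>M n) < e"
      using finitary_approx_of_level_sets[OF q AE_linear_integrable[OF lin I] b level[OF s, folded E_def I_def] \<open>0 < e\<close>]
      by blast
    then show "\<exists>\<Psi>. finitary \<Psi> \<and> (\<forall>\<^sub>F n in sequentially. (\<integral>x. \<bar>A n (I n s) x - \<Psi> (\<kappa> n x)\<bar> \<partial>M n) < e)"
      by (intro exI[of _ \<Psi>]) simp
  qed
  then have "\<forall>s\<in>Pow {..<J}. \<exists>h. cv (\<lambda>n. A n (I n s)) h" by blast
  from bchoice[OF this] obtain h where h: "\<And>s. s \<in> Pow {..<J} \<Longrightarrow> cv (\<lambda>n. A n (I n s)) (h s)" by blast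
  have cv: "cv (\<lambda>n x. \<Sum>s\<in>Pow {..<J}. \<Phi> s * A n (I n s) x) (\<lambda>x. \<Sum>s\<in>Pow {..<J}. \<Phi> s * h s x)"
    by (intro cv_sum h) auto
  have fL: "(\<lambda>x. \<Phi> (\<kappa> n x)) \<in> Linf (M n)" for n
  proof -
    obtain R where "\<And>s. \<bar>\<Phi> s\<bar> \<le> R" using finitary_bounded[OF assms] by blast
    then show ?thesis by (rule bounded_seq_Linf[OF bounded_seq_finitary[OF assms], of R n])
  qed
  have "cv (\<lambda>n. A n (\<lambda>x. \<Phi> (\<kappa> n x))) (\<lambda>x. \<Sum>s\<in>Pow {..<J}. \<Phi> s * h s x)"
  proof (rule cv_cong_AE[OF cv])
    show "integrable (M n) (A n (\<lambda>x. \<Phi> (\<kappa> n x)))" for n by (rule AE_linear_integrable[OF lin fL])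
    show "integrable N (\<lambda>x. \<Sum>s\<in>Pow {..<J}. \<Phi> s * h s x)" by (rule cv_integrable(2)[OF cv])
    show "AE x in M n. (\<Sum>s\<in>Pow {..<J}. \<Phi> s * A n (I n s) x) = A n (\<lambda>x. \<Phi> (\<kappa> n x)) x" for n
    proof -
      have sum: "(\<lambda>y. \<Sum>s\<in>Pow {..<J}. \<Phi> s * I n s y) \<in> Linf (M n)"
        "AE x in M n. A n (\<lambda>y. \<Sum>s\<in>Pow {..<J}. \<Phi> s * I n s y) x = (\<Sum>s\<in>Pow {..<J}. \<Phi> s * A n (I n s) x)"
        using AE_linear_sum[OF lin[of n], of "Pow {..<J}" "I n" \<Phi>] I by auto
      have "AE x in M n. (\<Sum>s\<in>Pow {..<J}. \<Phi> s * I n s x) = \<Phi> (\<kappa> n x)"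
      proof (rule AE_I2)
        fix x assume "x \<in> space (M n)"
        then show "(\<Sum>s\<in>Pow {..<J}. \<Phi> s * I n s x) = \<Phi> (\<kappa> n x)"
          by (subst finitary_decomp[of \<Phi>, OF J]) (auto intro!: sum.cong simp: I_def E_def indicator_def)
      qed
      from AE_linear_cong[OF lin sum(1) fL this] sum(2) show ?thesis by eventually_elim simp
    qed
  qed simp
  then show ?thesis by blast
qed

text \<open>The modulus \<open>\<delta>\<close> depends on the common bound \<open>R\<close> but not
  on \<open>n\<close>: closeness in \<open>L^1\<close> gives closeness in \<open>L^p\<close>, the
  operator bound carries it to the images in \<open>L^q\<close>, and \<open>L1_le_Lq\<close> returns
  to \<open>L^1\<close>.\<close>

lemma operator_equicontinuous:
  assumes "0 < e"
  obtains \<delta> where "0 < \<delta>" "\<And>n v w. v \<in> borel_measurable (M n) \<Longrightarrow> w \<in> borel_measurable (M n) \<Longrightarrow>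
      (\<And>x. x \<in> space (M n) \<Longrightarrow> \<bar>v x\<bar> \<le> R) \<Longrightarrow> (\<And>x. x \<in> space (M n) \<Longrightarrow> \<bar>w x\<bar> \<le> R) \<Longrightarrow>
      (\<integral>x. \<bar>v x - w x\<bar> \<partial>M n) < \<delta> \<Longrightarrow> (\<integral>x. \<bar>A n v x - A n w x\<bar> \<partial>M n) < e"
proof -
  \<comment> \<open>Chosen so that \<open>2 * (c * t) = e / 2\<close>. The constant \<open>K\<close>
    comes from \<open>integral_powr_le_L1\<close> for a difference bounded by \<open>2 * R\<close>,
    and \<open>K + 1\<close> keeps the divisor of \<open>\<delta>\<close> positive.\<close>
  define t where "t = e / (4 * c)"
  define K where "K = (2 * R) powr (p - 1)"
  define \<delta> where "\<delta> = t powr p / (K + 1)"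
  have t: "0 < t" using assms c by (simp add: t_def)
  have K: "0 \<le> K" by (simp add: K_def)
  have \<delta>: "0 < \<delta>" using t K by (simp add: \<delta>_def)
  show thesis
  proof (rule that[OF \<delta>])
    fix n v w assume m: "v \<in> borel_measurable (M n)" "w \<in> borel_measurable (M n)"
      and b: "\<And>x. x \<in> space (M n) \<Longrightarrow> \<bar>v x\<bar> \<le> R" "\<And>x. x \<in> space (M n) \<Longrightarrow> \<bar>w x\<bar> \<le> R"
      and less: "(\<integral>x. \<bar>v x - w x\<bar> \<partial>M n) < \<delta>"
    interpret prob_space "M n" by (rule prob_M)
    have L: "v \<in> Linf (M n)" "w \<in> Linf (M n)" using m b by (auto intro: Linf_bounded)
    have d: "(\<lambda>x. v x - w x) \<in> Linf (M n)" using Linf_lin[OF L, of 1 "-1"] by simp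
    have bb: "AE x in M n. \<bar>v x - w x\<bar> \<le> 2 * R"
    proof (rule AE_I2)
      fix x assume "x \<in> space (M n)"
      then show "\<bar>v x - w x\<bar> \<le> 2 * R" using b[of x] by linarith
    qed
    have "(\<integral>x. \<bar>v x - w x\<bar> powr p \<partial>M n) \<le> K * (\<integral>x. \<bar>v x - w x\<bar> \<partial>M n)"
      unfolding K_def using m by (intro integral_powr_le_L1 bb p) auto
    also have "\<dots> \<le> K * \<delta>" using less K by (intro mult_left_mono) auto
    also have "\<dots> = t powr p * (K / (K + 1))" by (simp add: \<delta>_def)
    also have "\<dots> \<le> t powr p * 1" using K by (intro mult_left_mono) auto
    finally have "Lnorm (M n) p (\<lambda>x. v x - w x) \<le> (t powr p) powr (1 / p)"
      using p by (intro powr_mono2) (auto intro!: Bochner_Integration.integral_nonneg)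
    then have "Lnorm (M n) p (\<lambda>x. v x - w x) \<le> t" using p t by (simp add: powr_powr)
    then have "2 * (c * Lnorm (M n) p (\<lambda>x. v x - w x)) \<le> 2 * (c * t)" using c by simp
    also have "\<dots> < e" using c assms by (simp add: t_def)
    finally have "(\<integral>x. \<bar>A n (\<lambda>x. v x - w x) x\<bar> \<partial>M n) < e"
      using Lq_bounded_integral_abs_le[OF prob_M lin bd q c d] by simp
    moreover have "(\<integral>x. \<bar>A n (\<lambda>x. v x - w x) x\<bar> \<partial>M n) = (\<integral>x. \<bar>A n v x - A n w x\<bar> \<partial>M n)"
    proof (rule integral_cong_AE)
      have "AE x in M n. A n (\<lambda>x. 1 * v x + (-1) * w x) x = 1 * A n v x + (-1) * A n w x"
        by (rule AE_linear_lin[OF lin L])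
      then show "AE x in M n. \<bar>A n (\<lambda>x. v x - w x) x\<bar> = \<bar>A n v x - A n w x\<bar>"
        by eventually_elim simp
    qed (use AE_linear_integrable[OF lin d] AE_linear_integrable[OF lin L(1)] AE_linear_integrable[OF lin L(2)] in auto)
    ultimately show "(\<integral>x. \<bar>A n v x - A n w x\<bar> \<partial>M n) < e" by simp
  qed
qed

lemma cv_operator_exists:
  assumes f: "bounded_seq R f" "cv f v"
  shows "\<exists>g. cv (\<lambda>n. A n (f n)) g"
proof (rule cv_exists)
  note AI = AE_linear_integrable[OF lin]
  show "integrable (M n) (A n (f n))" for n by (rule AI[OF bounded_seq_Linf[OF f(1)]])
  fix e :: real assume "0 < e"
  then have e: "0 < e / 2" by simp
  obtain \<delta> where d: "0 < \<delta>" "\<And>n v w. v \<in> borel_measurable (M n) \<Longrightarrow> w \<in> borel_measurable (M n) \<Longrightarrow>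
      (\<And>x. x \<in> space (M n) \<Longrightarrow> \<bar>v x\<bar> \<le> R) \<Longrightarrow> (\<And>x. x \<in> space (M n) \<Longrightarrow> \<bar>w x\<bar> \<le> R) \<Longrightarrow>
      (\<integral>x. \<bar>v x - w x\<bar> \<partial>M n) < \<delta> \<Longrightarrow> (\<integral>x. \<bar>A n v x - A n w x\<bar> \<partial>M n) < e / 2"
    using operator_equicontinuous[OF e, of R] by blast
  obtain \<Phi> where P: "finitary \<Phi>" "\<forall>\<^sub>F n in sequentially. (\<integral>x. \<bar>f n x - \<Phi> (\<kappa> n x)\<bar> \<partial>M n) < \<delta>"
    using f(2) d(1) unfolding cv_def by blast
  \<comment> \<open>Clipping keeps the approximant within the bound \<open>R\<close> for which
    \<open>\<delta>\<close> was chosen.\<close>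
  define \<Psi> where "\<Psi> s = max (- R) (min R (\<Phi> s))" for s
  have Psi: "finitary \<Psi>" unfolding \<Psi>_def by (rule finitary_comp[OF P(1)])
  obtain h where "cv (\<lambda>n. A n (\<lambda>x. \<Psi> (\<kappa> n x))) h" using cv_operator_finitary[OF Psi] by blast
  then obtain \<Xi> where X: "finitary \<Xi>" "\<forall>\<^sub>F n in sequentially. (\<integral>x. \<bar>A n (\<lambda>x. \<Psi> (\<kappa> n x)) x - \<Xi> (\<kappa> n x)\<bar> \<partial>M n) < e / 2"
    using e unfolding cv_def by blast
  have "\<forall>\<^sub>F n in sequentially. (\<integral>x. \<bar>A n (f n) x - \<Xi> (\<kappa> n x)\<bar> \<partial>M n) < e"
    using P(2) X(2)
  proof eventually_elim
    case (elim n)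
    interpret prob_space "M n" by (rule prob_M)
    have R: "0 \<le> R"
    proof -
      obtain x where "x \<in> space (M n)" using not_empty by blast
      then have "\<bar>f n x\<bar> \<le> R" using f(1) by (auto simp: bounded_seq_def)
      then show ?thesis by simp
    qed
    have m: "f n \<in> borel_measurable (M n)" "(\<lambda>x. \<Psi> (\<kappa> n x)) \<in> borel_measurable (M n)"
      using f(1) measurable_finitary[OF code_M Psi] by (auto simp: bounded_seq_def)
    have fR: "\<bar>f n x\<bar> \<le> R" if "x \<in> space (M n)" for x using f(1) that by (auto simp: bounded_seq_def)
    have PR: "\<bar>\<Psi> s\<bar> \<le> R" for s using R by (auto simp: \<Psi>_def)
    have "(\<integral>x. \<bar>f n x - \<Psi> (\<kappa> n x)\<bar> \<partial>M n) \<le> (\<integral>x. \<bar>f n x - \<Phi> (\<kappa> n x)\<bar> \<partial>M n)"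
    proof (rule integral_mono)
      show "\<bar>f n x - \<Psi> (\<kappa> n x)\<bar> \<le> \<bar>f n x - \<Phi> (\<kappa> n x)\<bar>" if "x \<in> space (M n)" for x
        using fR[OF that] by (auto simp: \<Psi>_def)
    qed (use cv_integrable(1)[OF f(2)] integrable_finitary_M[OF Psi] integrable_finitary_M[OF P(1)] in auto)
    then have "(\<integral>x. \<bar>A n (f n) x - A n (\<lambda>x. \<Psi> (\<kappa> n x)) x\<bar> \<partial>M n) < e / 2"
      using elim(1) by (intro d(2) m fR PR) auto
    then show ?case
      using L1_triangle[OF AI[OF bounded_seq_Linf[OF f(1)]] AI[OF bounded_seq_Linf[OF bounded_seq_finitary[OF Psi PR]]]
          integrable_finitary_M[OF X(1)], of n] elim(2) by simp
  qed
  then show "\<exists>\<Xi>. finitary \<Xi> \<and> (\<forall>\<^sub>F n in sequentially. (\<integral>x. \<bar>A n (f n) x - \<Xi> (\<kappa> n x)\<bar> \<partial>M n) < e)"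
    using X(1) by blast
qed

lemma cv_operator_independent:
  assumes f: "bounded_seq R f" "cv f v" and f': "bounded_seq R f'" "cv f' v" and g: "cv (\<lambda>n. A n (f n)) g"
  shows "cv (\<lambda>n. A n (f' n)) g"
proof (rule cv_perturb)
  show "integrable (M n) (A n (f' n))" for n by (rule AE_linear_integrable[OF lin bounded_seq_Linf[OF f'(1)]])
  show "integrable N g" by (rule cv_integrable(2)[OF g])
  fix e :: real assume e: "0 < e"
  obtain \<delta> where d: "0 < \<delta>" "\<And>n v w. v \<in> borel_measurable (M n) \<Longrightarrow> w \<in> borel_measurable (M n) \<Longrightarrow>
      (\<And>x. x \<in> space (M n) \<Longrightarrow> \<bar>v x\<bar> \<le> R) \<Longrightarrow> (\<And>x. x \<in> space (M n) \<Longrightarrow> \<bar>w x\<bar> \<le> R) \<Longrightarrow>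
      (\<integral>x. \<bar>v x - w x\<bar> \<partial>M n) < \<delta> \<Longrightarrow> (\<integral>x. \<bar>A n v x - A n w x\<bar> \<partial>M n) < e"
    using operator_equicontinuous[OF e, of R] by blast
  have "(\<lambda>n. \<integral>x. \<bar>f' n x - f n x\<bar> \<partial>M n) \<longlonglongrightarrow> (\<integral>x. \<bar>v x - v x\<bar> \<partial>N)"
    by (intro cv_integral cv_abs cv_diff f f')
  then have "\<forall>\<^sub>F n in sequentially. (\<integral>x. \<bar>f' n x - f n x\<bar> \<partial>M n) < \<delta>"
    by (rule order_tendstoD(2)) (use d in simp)
  then have "\<forall>\<^sub>F n in sequentially. (\<integral>x. \<bar>A n (f' n) x - A n (f n) x\<bar> \<partial>M n) < e"
    by eventually_elim (rule d(2), use f(1) f'(1) in \<open>auto simp: bounded_seq_def\<close>)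
  then show "\<exists>f'' g'. cv f'' g' \<and> (\<forall>\<^sub>F n in sequentially. (\<integral>x. \<bar>A n (f' n) x - f'' n x\<bar> \<partial>M n) < e) \<and>
      (\<integral>x. \<bar>g x - g' x\<bar> \<partial>N) < e"
    using g e by (intro exI[of _ "\<lambda>n. A n (f n)"] exI[of _ g]) simp
qed

text \<open>An arbitrary choice of a bounded sequence and of a representative of the limit; by
  \<open>cv_lim_op\<close> and \<open>cv_unique\<close> the choice matters only on a null
  set.\<close>

definition lim_op :: "('b \<Rightarrow> real) \<Rightarrow> 'b \<Rightarrow> real" where
  "lim_op v = (SOME g. \<exists>R f. bounded_seq R f \<and> cv f v \<and> cv (\<lambda>n. A n (f n)) g)"

lemma cv_lim_op:
  assumes f: "bounded_seq R f" "cv f v"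
  shows "cv (\<lambda>n. A n (f n)) (lim_op v)"
proof -
  have "\<exists>g. \<exists>R f. bounded_seq R f \<and> cv f v \<and> cv (\<lambda>n. A n (f n)) g"
    using f cv_operator_exists[OF f] by blast
  then have "\<exists>R f. bounded_seq R f \<and> cv f v \<and> cv (\<lambda>n. A n (f n)) (lim_op v)"
    unfolding lim_op_def by (rule someI_ex)
  then obtain R' f' where f': "bounded_seq R' f'" "cv f' v" "cv (\<lambda>n. A n (f' n)) (lim_op v)" by blast
  show ?thesis
    by (rule cv_operator_independent[OF bounded_seq_mono[OF f'(1)] f'(2) bounded_seq_mono[OF f(1)] f(2) f'(3),
          of "max R R'"]) auto
qed

text \<open>Each identity holds for \<open>A n\<close> along lifted sequences and passes to
  \<open>N\<close> because limits are unique almost everywhere.\<close>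

lemma AE_linear_lim_op: "AE_linear N lim_op"
  unfolding AE_linear_def
proof (intro conjI ballI allI impI)
  fix v assume "v \<in> Linf N"
  then obtain R f where "bounded_seq R f" "cv f v" using cv_lift_bounded_seq by blast
  then show "integrable N (lim_op v)" by (rule cv_integrable(2)[OF cv_lim_op])
next
  fix v w assume vw: "v \<in> Linf N" "w \<in> Linf N" and eq: "AE x in N. v x = w x"
  obtain R f where f: "bounded_seq R f" "cv f v" using cv_lift_bounded_seq[OF vw(1)] by blast
  have "cv f w"
    by (rule cv_cong_AE[OF f(2) cv_integrable(1)[OF f(2)] prob_space.integrable_Linf[OF prob_N vw(2)] _ eq]) simp
  then show "AE x in N. lim_op v x = lim_op w x"
    using cv_unique[OF cv_lim_op[OF f] cv_lim_op[OF f(1)]] by blast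
next
  fix v w and a b :: real assume vw: "v \<in> Linf N" "w \<in> Linf N"
  obtain R f where f: "bounded_seq R f" "cv f v" using cv_lift_bounded_seq[OF vw(1)] by blast
  obtain S g where g: "bounded_seq S g" "cv g w" using cv_lift_bounded_seq[OF vw(2)] by blast
  have 1: "cv (\<lambda>n. A n (\<lambda>y. a * f n y + b * g n y)) (lim_op (\<lambda>y. a * v y + b * w y))"
    by (rule cv_lim_op[OF bounded_seq_lin[OF f(1) g(1)] cv_lin[OF f(2) g(2)]])
  have 2: "cv (\<lambda>n x. a * A n (f n) x + b * A n (g n) x) (\<lambda>x. a * lim_op v x + b * lim_op w x)"
    by (intro cv_lin cv_lim_op[OF f] cv_lim_op[OF g])
  have "cv (\<lambda>n. A n (\<lambda>y. a * f n y + b * g n y)) (\<lambda>x. a * lim_op v x + b * lim_op w x)"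
  proof (rule cv_cong_AE[OF 2 cv_integrable(1)[OF 1] cv_integrable(2)[OF 2]])
    show "AE x in M n. a * A n (f n) x + b * A n (g n) x = A n (\<lambda>y. a * f n y + b * g n y) x" for n
      using AE_linear_lin[OF lin bounded_seq_Linf[OF f(1)] bounded_seq_Linf[OF g(1)], of n a b] by eventually_elim simp
  qed simp
  from cv_unique[OF 1 this]
  show "AE x in N. lim_op (\<lambda>y. a * v y + b * w y) x = a * lim_op v x + b * lim_op w x" .
qed

text \<open>The right-hand side converges, since the lifted functions are uniformly bounded. The
  left-hand side is only lower semicontinuous: powers are truncated at height \<open>K\<close> to
  pass to the limit, and Fatou's lemma removes the truncation.\<close>

lemma Lq_bounded_lim_op:
  assumes r: "1 < r" and bdr: "\<And>n. Lq_bounded (M n) p r c (A n)"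
  shows "Lq_bounded N p r c lim_op"
  unfolding Lq_bounded_def
proof
  fix v assume v: "v \<in> Linf N"
  obtain R f where R: "0 \<le> R" and f: "bounded_seq R f" "cv f v" using cv_lift_bounded_seq[OF v] by blast
  define g where "g = lim_op v"
  have g: "cv (\<lambda>n. A n (f n)) g" unfolding g_def by (rule cv_lim_op[OF f])
  have [measurable]: "g \<in> borel_measurable N" using cv_integrable(2)[OF g] by auto
  define b where "b = (c * Lnorm N p v) powr r"
  \<comment> \<open>Clipping \<open>f n\<close> at \<open>R\<close> changes nothing, so by
    uniqueness of limits \<open>v\<close> is bounded by \<open>R\<close> almost everywhere. The
    level \<open>R + 1\<close> is positive even for \<open>R = 0\<close>, as
    \<open>cv_truncated_powr\<close> requires.\<close>
  have vR: "AE x in N. min \<bar>v x\<bar> (R + 1) = \<bar>v x\<bar>"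
  proof -
    have clip: "cv (\<lambda>n x. max (- R) (min R (f n x))) (\<lambda>x. max (- R) (min R (v x)))"
      by (rule cv_comp[OF f(2), of 1]) (auto simp: max_def min_def)
    have "cv f (\<lambda>x. max (- R) (min R (v x)))"
    proof (rule cv_cong_AE[OF clip cv_integrable(1)[OF f(2)] cv_integrable(2)[OF clip]])
      show "AE x in M n. max (- R) (min R (f n x)) = f n x" for n
      proof (rule AE_I2)
        fix x assume "x \<in> space (M n)"
        then have "\<bar>f n x\<bar> \<le> R" using f(1) by (simp add: bounded_seq_def)
        then show "max (- R) (min R (f n x)) = f n x" by linarith
      qed
    qed simp
    from cv_unique[OF f(2) this] show ?thesis by eventually_elim (use R in auto)
  qed
  have "(\<lambda>n. \<integral>x. min \<bar>f n x\<bar> (R + 1) powr p \<partial>M n) \<longlonglongrightarrow> (\<integral>x. min \<bar>v x\<bar> (R + 1) powr p \<partial>N)"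
    using R p by (intro cv_truncated_powr f) auto
  also have "(\<lambda>n. \<integral>x. min \<bar>f n x\<bar> (R + 1) powr p \<partial>M n) = (\<lambda>n. \<integral>x. \<bar>f n x\<bar> powr p \<partial>M n)"
    using f(1) by (intro ext Bochner_Integration.integral_cong refl arg_cong2[where f="(powr)"])
      (auto simp: bounded_seq_def min_def dest!: spec bspec)
  also have "(\<integral>x. min \<bar>v x\<bar> (R + 1) powr p \<partial>N) = (\<integral>x. \<bar>v x\<bar> powr p \<partial>N)"
    using v by (intro integral_cong_AE) (use vR in \<open>auto simp: Linf_iff\<close>)
  finally have "(\<lambda>n. (c * Lnorm (M n) p (f n)) powr r) \<longlonglongrightarrow> b"
    unfolding b_def using p r c by (intro tendsto_powr' tendsto_mult tendsto_const) (auto intro!: always_eventually)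
  moreover have "(\<integral>x. min \<bar>A n (f n) x\<bar> K powr r \<partial>M n) \<le> (c * Lnorm (M n) p (f n)) powr r" if K: "0 < K" for n K
  proof -
    interpret prob_space "M n" by (rule prob_M)
    have i: "integrable (M n) (\<lambda>x. \<bar>A n (f n) x\<bar> powr r)"
      and le: "(\<integral>x. \<bar>A n (f n) x\<bar> powr r \<partial>M n) \<le> (c * Lnorm (M n) p (f n)) powr r"
      using bdr[of n] bounded_seq_Linf[OF f(1)] by (auto simp: Lq_bounded_def)
    have [measurable]: "A n (f n) \<in> borel_measurable (M n)"
      using AE_linear_integrable[OF lin bounded_seq_Linf[OF f(1)]] by auto
    have "(\<integral>x. min \<bar>A n (f n) x\<bar> K powr r \<partial>M n) \<le> (\<integral>x. \<bar>A n (f n) x\<bar> powr r \<partial>M n)"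
    proof (rule integral_mono[OF _ i])
      show le': "min \<bar>A n (f n) x\<bar> K powr r \<le> \<bar>A n (f n) x\<bar> powr r" for x
        using K r by (intro powr_mono2) auto
      show "integrable (M n) (\<lambda>x. min \<bar>A n (f n) x\<bar> K powr r)"
        by (rule Bochner_Integration.integrable_bound[OF i]) (use le' in auto)
    qed
    then show ?thesis using le by simp
  qed
  ultimately have le: "(\<integral>x. min \<bar>g x\<bar> K powr r \<partial>N) \<le> b" if "0 < K" for K
    using that r by (intro LIMSEQ_le[OF cv_truncated_powr[OF g]]) auto
  have nn: "(\<integral>\<^sup>+x. ennreal (\<bar>g x\<bar> powr r) \<partial>N) \<le> ennreal b"
  proof -
    interpret N: prob_space N by (rule prob_N)
    have "(\<integral>\<^sup>+x. ennreal (\<bar>g x\<bar> powr r) \<partial>N) = (\<integral>\<^sup>+x. liminf (\<lambda>k. ennreal (min \<bar>g x\<bar> (real (Suc k)) powr r)) \<partial>N)"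
    proof (rule nn_integral_cong)
      fix x
      have "(\<lambda>k. ennreal (min \<bar>g x\<bar> (real (Suc k)) powr r)) \<longlonglongrightarrow> ennreal (\<bar>g x\<bar> powr r)"
      proof (rule tendsto_eventually)
        obtain m :: nat where m: "\<bar>g x\<bar> < m" using reals_Archimedean2 by blast
        show "\<forall>\<^sub>F k in sequentially. ennreal (min \<bar>g x\<bar> (real (Suc k)) powr r) = ennreal (\<bar>g x\<bar> powr r)"
          using eventually_ge_at_top[of m]
        proof eventually_elim
          case (elim k)
          then have "\<bar>g x\<bar> \<le> real (Suc k)" using m by simp
          then show ?case by (simp add: min_absorb1)
        qed
      qed
      then show "ennreal (\<bar>g x\<bar> powr r) = liminf (\<lambda>k. ennreal (min \<bar>g x\<bar> (real (Suc k)) powr r))"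
        by (rule lim_imp_Liminf[OF trivial_limit_sequentially, symmetric])
    qed
    also have "\<dots> \<le> liminf (\<lambda>k. \<integral>\<^sup>+x. ennreal (min \<bar>g x\<bar> (real (Suc k)) powr r) \<partial>N)"
      by (intro nn_integral_liminf) measurable
    also have "\<dots> \<le> liminf (\<lambda>k. ennreal b)"
    proof (rule Liminf_mono, rule always_eventually, rule allI)
      fix k
      have "integrable N (\<lambda>x. min \<bar>g x\<bar> (real (Suc k)) powr r)"
        using r by (intro N.integrable_const_bound[where B="real (Suc k) powr r"] AE_I2) (auto intro!: powr_mono2)
      then show "(\<integral>\<^sup>+x. ennreal (min \<bar>g x\<bar> (real (Suc k)) powr r) \<partial>N) \<le> ennreal b"
        using le[of "real (Suc k)"] by (subst nn_integral_eq_integral) (auto intro!: ennreal_leI)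
    qed
    finally show ?thesis by (simp add: Liminf_const)
  qed
  have "integrable N (\<lambda>x. \<bar>g x\<bar> powr r)"
    using le_less_trans[OF nn ennreal_less_top] by (intro integrableI_nonneg) auto
  moreover have "(\<integral>x. \<bar>g x\<bar> powr r \<partial>N) \<le> b"
    using nn by (intro integral_real_bounded) (auto simp: b_def)
  ultimately show "integrable N (\<lambda>x. \<bar>lim_op v x\<bar> powr r) \<and> (\<integral>x. \<bar>lim_op v x\<bar> powr r \<partial>N) \<le> (c * Lnorm N p v) powr r"
    by (simp add: g_def b_def)
qed

end

section \<open>Convergence of profiles\<close>

abbreviation prof_law :: "'a measure \<Rightarrow> (('a \<Rightarrow> real) \<Rightarrow> 'a \<Rightarrow> real) \<Rightarrow> nat \<Rightarrow> (nat \<Rightarrow> 'a \<Rightarrow> real) \<Rightarrow> (nat \<Rightarrow> real) measure" where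
  "prof_law M A k v \<equiv> distr M (Rspace (2*k)) (\<lambda>x. \<lambda>i\<in>{..<2*k}. if i < k then v i x else A (v (i - k)) x)"

lemma profile_eq:
  "profile M A k = {prof_law M A k v |v. \<forall>i<k. v i \<in> borel_measurable M \<and> (\<forall>x\<in>space M. \<bar>v i x\<bar> \<le> 1)}"
  unfolding profile_def ..

lemma profile_nonempty: "profile M A k \<noteq> {}"
proof -
  have "prof_law M A k (\<lambda>_ _. 0) \<in> profile M A k" unfolding profile_eq by (intro CollectI exI[of _ "\<lambda>_ _. 0"]) auto
  then show ?thesis by blast
qed

text \<open>In the constant \<open>max 1 (2*c)\<close>, the 1 bounds the given functions and
  \<open>2 * c\<close> bounds the \<open>L^1\<close> norms of their images.\<close>

lemma profile_bounded_laws: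
  assumes "prob_space M" and lin: "AE_linear M A" and bd: "Lq_bounded M p q c A" and pqc: "1 \<le> p" "1 < q" "0 < c"
  shows "profile M A k \<subseteq> bounded_laws (2*k) (max 1 (2*c))"
proof
  interpret prob_space M by fact
  fix \<mu> assume "\<mu> \<in> profile M A k"
  then obtain v where \<mu>: "\<mu> = prof_law M A k v" and v: "\<And>i. i < k \<Longrightarrow> v i \<in> borel_measurable M"
    "\<And>i x. i < k \<Longrightarrow> x \<in> space M \<Longrightarrow> \<bar>v i x\<bar> \<le> 1" unfolding profile_eq by blast
  have vL: "v i \<in> Linf M" if "i < k" for i using v that by (intro Linf_bounded[where R=1]) auto
  define h where "h i x = (if i < k then v i x else A (v (i - k)) x)" for i x
  have h: "integrable M (h i)" and hb: "(\<integral>x. \<bar>h i x\<bar> \<partial>M) \<le> max 1 (2*c)" if "i < 2 * k" for i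
  proof -
    have "integrable M (h i) \<and> (\<integral>x. \<bar>h i x\<bar> \<partial>M) \<le> max 1 (2*c)"
    proof (cases "i < k")
      case True
      then have e: "h i = v i" by (simp add: h_def fun_eq_iff)
      have i: "integrable M (v i)" by (rule integrable_Linf[OF vL[OF True]])
      then have "(\<integral>x. \<bar>v i x\<bar> \<partial>M) \<le> (\<integral>x. 1 \<partial>M)" using v(2)[OF True] by (intro integral_mono) auto
      then show ?thesis using i by (simp add: e prob_space)
    next
      case False
      then have ik: "i - k < k" using that by simp
      have e: "h i = A (v (i - k))" using False by (simp add: h_def fun_eq_iff)
      have "Lnorm M p (v (i - k)) \<le> 1"
        using v[OF ik] pqc by (intro Lnorm_le_bound AE_I2) auto
      then have "2 * (c * Lnorm M p (v (i - k))) \<le> 2 * c" using pqc by simp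
      then show ?thesis
        using Lq_bounded_integral_abs_le[OF assms(1) lin bd pqc(2,3) vL[OF ik]] AE_linear_integrable[OF lin vL[OF ik]]
        by (simp add: e)
    qed
    then show "integrable M (h i)" "(\<integral>x. \<bar>h i x\<bar> \<partial>M) \<le> max 1 (2*c)" by auto
  qed
  have m: "(\<lambda>x. \<lambda>i\<in>{..<2*k}. h i x) \<in> M \<rightarrow>\<^sub>M Rspace (2*k)"
    using h by (intro measurable_restrict) auto
  have \<mu>': "\<mu> = distr M (Rspace (2*k)) (\<lambda>x. \<lambda>i\<in>{..<2*k}. h i x)" by (simp add: \<mu> h_def)
  have comp: "(\<lambda>x. x i) \<in> borel_measurable (Rspace (2*k))" if "i < 2*k" for i
    using that by (intro measurable_component_singleton) auto
  have "integrable \<mu> (\<lambda>x. x i) \<and> (\<integral>x. \<bar>x i\<bar> \<partial>\<mu>) \<le> max 1 (2*c)" if i: "i < 2*k" for i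
  proof
    show "integrable \<mu> (\<lambda>x. x i)"
      unfolding \<mu>' by (subst integrable_distr_eq[OF m comp[OF i]]) (use h[OF i] i in simp)
    have "(\<integral>x. \<bar>x i\<bar> \<partial>\<mu>) = (\<integral>x. \<bar>h i x\<bar> \<partial>M)"
      unfolding \<mu>' by (subst integral_distr[OF m]) (use comp[OF i] i in \<open>auto intro!: borel_measurable_abs\<close>)
    then show "(\<integral>x. \<bar>x i\<bar> \<partial>\<mu>) \<le> max 1 (2*c)" using hb[OF i] by simp
  qed
  then show "\<mu> \<in> bounded_laws (2*k) (max 1 (2*c))"
    unfolding bounded_laws_def using prob_space_distr[OF m] by (simp add: \<mu>')
qed

context operator_limit
begin

lemma prof_law_tendsto:
  assumes f: "\<And>i. i < k \<Longrightarrow> bounded_seq R (f i)" "\<And>i. i < k \<Longrightarrow> cv (f i) (w i)" and "0 < e"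
  shows "\<forall>\<^sub>F n in sequentially. lp_close (2*k) (prof_law (M n) (A n) k (\<lambda>i. f i n)) (prof_law N lim_op k w) e"
proof -
  define F where "F i n x = (if i < k then f i n x else A n (f (i - k) n) x)" for i n x
  define G where "G i x = (if i < k then w i x else lim_op (w (i - k)) x)" for i x
  have "cv (F i) (G i)" if "i < 2*k" for i
  proof (cases "i < k")
    case True
    then have "F i = f i" "G i = w i" by (auto simp: F_def G_def fun_eq_iff)
    then show ?thesis using f(2)[OF True] by simp
  next
    case False
    then have ik: "i - k < k" using that by simp
    have "F i = (\<lambda>n. A n (f (i - k) n))" "G i = lim_op (w (i - k))"
      using False by (auto simp: F_def G_def fun_eq_iff)
    then show ?thesis using cv_lim_op[OF f(1)[OF ik] f(2)[OF ik]] by simp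
  qed
  from cv_law[of "2*k" F G, OF this \<open>0 < e\<close>] show ?thesis by (simp add: F_def G_def)
qed

text \<open>Profiles demand the bound 1 at every point, hence the clipping of the limit, which
  alters it on a null set only. The moment exponent 2 is an arbitrary choice above 1, as bounded
  functions have all moments.\<close>

lemma cv_exists_of_level_sets:
  assumes f: "bounded_seq 1 f"
    and lev: "\<And>r. r \<in> \<rat> \<Longrightarrow> \<exists>j. \<forall>n. \<forall>x\<in>space (M n). j \<in> \<kappa> n x \<longleftrightarrow> r < f n x"
  obtains w where "cv f w" "w \<in> borel_measurable N" "\<And>x. \<bar>w x\<bar> \<le> 1"
proof -
  have b: "integrable (M n) (f n)" "integrable (M n) (\<lambda>x. \<bar>f n x\<bar> powr 2)" "(\<integral>x. \<bar>f n x\<bar> powr 2 \<partial>M n) \<le> 1" for n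
  proof -
    interpret prob_space "M n" by (rule prob_M)
    have m: "f n \<in> borel_measurable (M n)" "AE x in M n. \<bar>f n x\<bar> \<le> 1" using f by (auto simp: bounded_seq_def intro: AE_I2)
    show "integrable (M n) (f n)" "integrable (M n) (\<lambda>x. \<bar>f n x\<bar> powr 2)" "(\<integral>x. \<bar>f n x\<bar> powr 2 \<partial>M n) \<le> 1"
      using integrable_AE_bounded[OF m] AE_bounded_powr[OF m, of 2] by auto
  qed
  have "\<exists>g. cv f g"
  proof (rule cv_exists[OF b(1)])
    fix e :: real assume "0 < e"
    obtain \<Phi> where "finitary \<Phi>" "\<forall>n. (\<integral>x. \<bar>f n x - \<Phi> (\<kappa> n x)\<bar> \<partial>M n) < e"
      using finitary_approx_of_level_sets[OF _ b lev \<open>0 < e\<close>] by auto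
    then show "\<exists>\<Phi>. finitary \<Phi> \<and> (\<forall>\<^sub>F n in sequentially. (\<integral>x. \<bar>f n x - \<Phi> (\<kappa> n x)\<bar> \<partial>M n) < e)" by auto
  qed
  then obtain g where g: "cv f g" by blast
  have clip: "cv (\<lambda>n x. max (- 1) (min 1 (f n x))) (\<lambda>x. max (- 1) (min 1 (g x)))"
    by (rule cv_comp[OF g, of 1]) (auto simp: max_def min_def)
  have "cv f (\<lambda>x. max (- 1) (min 1 (g x)))"
  proof (rule cv_cong_AE[OF clip cv_integrable(1)[OF g] cv_integrable(2)[OF clip]])
    show "AE x in M n. max (- 1) (min 1 (f n x)) = f n x" for n
    proof (rule AE_I2)
      fix x assume "x \<in> space (M n)"
      then have "\<bar>f n x\<bar> \<le> 1" using f by (simp add: bounded_seq_def)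
      then show "max (- 1) (min 1 (f n x)) = f n x" by linarith
    qed
  qed simp
  then show thesis by (rule that) (use cv_integrable(2)[OF g] in auto)
qed

text \<open>The functions realising \<open>\<nu>\<close> are lifted with the bound 1 preserved, so
  the lifts are admissible in the profiles of \<open>A n\<close>. The threshold for \<open>n\<close>
  depends on \<open>\<nu>\<close>; uniformity comes from the finite nets in
  \<open>profile_haus_dist_le\<close>.\<close>

lemma profile_limit_approx:
  assumes \<nu>: "\<nu> \<in> profile N lim_op k" and "0 < e"
  shows "\<forall>\<^sub>F n in sequentially. \<exists>\<mu>\<in>profile (M n) (A n) k. lp_close (2*k) \<mu> \<nu> e"
proof -
  obtain w where w: "\<nu> = prof_law N lim_op k w" "\<And>i. i < k \<Longrightarrow> w i \<in> borel_measurable N"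
    "\<And>i x. i < k \<Longrightarrow> x \<in> space N \<Longrightarrow> \<bar>w i x\<bar> \<le> 1" using \<nu> unfolding profile_eq by blast
  interpret N: prob_space N by (rule prob_N)
  have "\<exists>f. bounded_seq 1 f \<and> cv f (w i)" if i: "i < k" for i
  proof -
    have b: "AE x in N. \<bar>w i x\<bar> \<le> 1" using w(3)[OF i] by (intro AE_I2)
    obtain \<Psi> where P: "\<And>n. finitary (\<Psi> n)" "\<And>n s. \<bar>\<Psi> n s\<bar> \<le> 1" "cv (\<lambda>n x. \<Psi> n (\<kappa> n x)) (w i)"
      using cv_lift[OF N.integrable_AE_bounded[OF w(2)[OF i] b] b] by blast
    have "bounded_seq 1 (\<lambda>n x. \<Psi> n (\<kappa> n x))"
      unfolding bounded_seq_def using P(2) measurable_finitary[OF code_M P(1)] by blast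
    then show ?thesis using P(3) by blast
  qed
  then obtain f where f: "\<And>i. i < k \<Longrightarrow> bounded_seq 1 (f i)" "\<And>i. i < k \<Longrightarrow> cv (f i) (w i)" by metis
  have conv: "\<forall>\<^sub>F n in sequentially. lp_close (2*k) (prof_law (M n) (A n) k (\<lambda>i. f i n)) (prof_law N lim_op k w) e"
    by (rule prof_law_tendsto[of k 1 f w]) (use f \<open>0 < e\<close> in auto)
  then show ?thesis
  proof eventually_elim
    case (elim n)
    have "prof_law (M n) (A n) k (\<lambda>i. f i n) \<in> profile (M n) (A n) k"
      unfolding profile_eq using f(1) by (intro CollectI exI[of _ "\<lambda>i. f i n"]) (auto simp: bounded_seq_def)
    then show ?case using elim w(1) by blast
  qed
qed

text \<open>Each law is replaced by a representative of its cell at cost \<open>e\<close>, and the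
  representative by a nearby law of the other profile, again at cost \<open>e\<close>. As there are
  finitely many cells, one threshold for \<open>n\<close> serves all laws.\<close>

lemma profile_haus_dist_le:
  assumes e: "0 < e" and U: "finite \<U>" "bounded_laws (2*k) (max 1 (2*c)) \<subseteq> \<Union>\<U>"
      "\<And>U \<mu> \<nu>. U \<in> \<U> \<Longrightarrow> \<mu> \<in> U \<Longrightarrow> \<nu> \<in> U \<Longrightarrow> lp_close (2*k) \<mu> \<nu> e"
    and stable: "\<And>U. U \<in> \<U> \<Longrightarrow> (\<forall>\<^sub>F n in sequentially. profile (M n) (A n) k \<inter> U = {}) \<or>
      (\<exists>f. (\<forall>i<k. bounded_seq 1 (f i) \<and> (\<forall>r\<in>\<rat>. \<exists>j. \<forall>n. \<forall>x\<in>space (M n). j \<in> \<kappa> n x \<longleftrightarrow> r < f i n x)) \<and>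
        (\<forall>\<^sub>F n in sequentially. prof_law (M n) (A n) k (\<lambda>i. f i n) \<in> U))"
  shows "\<forall>\<^sub>F n in sequentially. haus_dist (2*k) (profile (M n) (A n) k) (profile N lim_op k) \<le> 2 * e"
proof -
  have bM: "profile (M n) (A n) k \<subseteq> bounded_laws (2*k) (max 1 (2*c))" for n
    by (rule profile_bounded_laws[OF prob_M lin bd p q c])
  have bN: "profile N lim_op k \<subseteq> bounded_laws (2*k) (max 1 (2*c))"
    by (rule profile_bounded_laws[OF prob_N AE_linear_lim_op Lq_bounded_lim_op[OF q bd] p q c])
  have props: "prob_space \<mu>" "finite_measure \<mu>" "sets \<mu> = sets (Rspace (2*k))"
    if "\<mu> \<in> bounded_laws (2*k) (max 1 (2*c))" for \<mu>
    using that by (auto simp: bounded_laws_def prob_space.finite_measure)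
  have trans: "lp_close (2*k) \<mu> \<rho> (2 * e)"
    if "lp_close (2*k) \<mu> \<nu> e" "lp_close (2*k) \<nu> \<rho> e" "\<mu> \<in> bounded_laws (2*k) (max 1 (2*c))" "\<rho> \<in> bounded_laws (2*k) (max 1 (2*c))" for \<mu> \<nu> \<rho>
    using lp_close_trans[OF that(1,2)] props that(3,4) by simp
  have 1: "\<forall>\<^sub>F n in sequentially. \<forall>\<mu>\<in>profile (M n) (A n) k \<inter> U. \<exists>\<nu>\<in>profile N lim_op k. lp_close (2*k) \<mu> \<nu> (2 * e)"
    if UU: "U \<in> \<U>" for U
    using stable[OF UU]
  proof
    assume "\<forall>\<^sub>F n in sequentially. profile (M n) (A n) k \<inter> U = {}"
    then show ?thesis by eventually_elim simp
  next
    assume "\<exists>f. (\<forall>i<k. bounded_seq 1 (f i) \<and> (\<forall>r\<in>\<rat>. \<exists>j. \<forall>n. \<forall>x\<in>space (M n). j \<in> \<kappa> n x \<longleftrightarrow> r < f i n x)) \<and>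
        (\<forall>\<^sub>F n in sequentially. prof_law (M n) (A n) k (\<lambda>i. f i n) \<in> U)"
    then obtain f where f: "\<And>i. i < k \<Longrightarrow> bounded_seq 1 (f i)"
      and lev: "\<And>i r. i < k \<Longrightarrow> r \<in> \<rat> \<Longrightarrow> \<exists>j. \<forall>n. \<forall>x\<in>space (M n). j \<in> \<kappa> n x \<longleftrightarrow> r < f i n x"
      and ev: "\<forall>\<^sub>F n in sequentially. prof_law (M n) (A n) k (\<lambda>i. f i n) \<in> U" by blast
    have "\<exists>w. cv (f i) w \<and> w \<in> borel_measurable N \<and> (\<forall>x. \<bar>w x\<bar> \<le> 1)" if "i < k" for i
      by (rule cv_exists_of_level_sets[OF f[OF that] lev[OF that]]) (assumption | intro exI conjI allI)+
    then obtain w where w: "\<And>i. i < k \<Longrightarrow> cv (f i) (w i)" "\<And>i. i < k \<Longrightarrow> w i \<in> borel_measurable N"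
      "\<And>i x. i < k \<Longrightarrow> \<bar>w i x\<bar> \<le> 1" by metis
    have \<nu>: "prof_law N lim_op k w \<in> profile N lim_op k"
      unfolding profile_eq using w by (intro CollectI exI[of _ w]) auto
    have conv: "\<forall>\<^sub>F n in sequentially. lp_close (2*k) (prof_law (M n) (A n) k (\<lambda>i. f i n)) (prof_law N lim_op k w) e"
      by (rule prof_law_tendsto[of k 1 f w]) (use f w(1) e in auto)
    from ev this show ?thesis
    proof eventually_elim
      case (elim n)
      show ?case
      proof
        fix \<mu> assume \<mu>: "\<mu> \<in> profile (M n) (A n) k \<inter> U"
        then have "lp_close (2*k) \<mu> (prof_law (M n) (A n) k (\<lambda>i. f i n)) e" using elim(1) U(3)[OF UU] by blast
        then have "lp_close (2*k) \<mu> (prof_law N lim_op k w) (2 * e)"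
          by (rule trans[OF _ elim(2)]) (use \<mu> bM \<nu> bN in auto)
        then show "\<exists>\<nu>\<in>profile N lim_op k. lp_close (2*k) \<mu> \<nu> (2 * e)" using \<nu> by blast
      qed
    qed
  qed
  have 2: "\<forall>\<^sub>F n in sequentially. \<forall>\<nu>\<in>profile N lim_op k \<inter> U. \<exists>\<mu>\<in>profile (M n) (A n) k. lp_close (2*k) \<mu> \<nu> (2 * e)"
    if UU: "U \<in> \<U>" for U
  proof (cases "profile N lim_op k \<inter> U = {}")
    case False
    \<comment> \<open>One law per cell suffices: what approximates \<open>\<nu>'\<close> within
      \<open>e\<close> approximates every law of the cell within \<open>2 * e\<close>.\<close>
    then obtain \<nu>' where n': "\<nu>' \<in> profile N lim_op k" "\<nu>' \<in> U" by blast
    show ?thesis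
      using profile_limit_approx[OF n'(1) e]
    proof eventually_elim
      case (elim n)
      then obtain \<mu> where \<mu>: "\<mu> \<in> profile (M n) (A n) k" "lp_close (2*k) \<mu> \<nu>' e" by blast
      show ?case
      proof
        fix \<nu> assume \<nu>: "\<nu> \<in> profile N lim_op k \<inter> U"
        have "lp_close (2*k) \<mu> \<nu> (2 * e)"
          by (rule trans[OF \<mu>(2) U(3)[OF UU n'(2)]]) (use \<nu> \<mu> bM bN in auto)
        then show "\<exists>\<mu>\<in>profile (M n) (A n) k. lp_close (2*k) \<mu> \<nu> (2 * e)" using \<mu>(1) by blast
      qed
    qed
  qed simp
  have "\<forall>\<^sub>F n in sequentially. \<forall>U\<in>\<U>. (\<forall>\<mu>\<in>profile (M n) (A n) k \<inter> U. \<exists>\<nu>\<in>profile N lim_op k. lp_close (2*k) \<mu> \<nu> (2 * e)) \<and>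
     (\<forall>\<nu>\<in>profile N lim_op k \<inter> U. \<exists>\<mu>\<in>profile (M n) (A n) k. lp_close (2*k) \<mu> \<nu> (2 * e))"
  proof (rule eventually_ball_finite[OF U(1)], rule ballI)
    fix U assume "U \<in> \<U>"
    from eventually_conj[OF 1[OF this] 2[OF this]]
    show "\<forall>\<^sub>F n in sequentially. (\<forall>\<mu>\<in>profile (M n) (A n) k \<inter> U. \<exists>\<nu>\<in>profile N lim_op k. lp_close (2*k) \<mu> \<nu> (2 * e)) \<and>
     (\<forall>\<nu>\<in>profile N lim_op k \<inter> U. \<exists>\<mu>\<in>profile (M n) (A n) k. lp_close (2*k) \<mu> \<nu> (2 * e))" .
  qed
  then show ?thesis
  proof eventually_elim
    case (elim n)
    show ?case
    proof (rule haus_dist_le)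
      show "prob_space \<mu>" if "\<mu> \<in> profile (M n) (A n) k \<union> profile N lim_op k" for \<mu>
        using that bM bN props(1) by blast
      show "\<exists>\<nu>\<in>profile N lim_op k. lp_close (2*k) \<mu> \<nu> (2 * e)" if "\<mu> \<in> profile (M n) (A n) k" for \<mu>
        using that bM[of n] U(2) elim by blast
      show "\<exists>\<mu>\<in>profile (M n) (A n) k. lp_close (2*k) \<mu> \<nu> (2 * e)" if "\<nu> \<in> profile N lim_op k" for \<nu>
        using that bN U(2) elim by blast
    qed (use e in \<open>auto simp: profile_nonempty\<close>)
  qed
qed

end

section \<open>A countable language naming the generated family of sets\<close>

datatype set_code =
  Whole | Level nat rat | Op_Level set_code rat | Meet set_code set_code | Complement set_code

instance set_code :: countable
  by countable_datatype

text \<open>Terms are interpreted rather than sets enumerated, because the same name must denote a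
  set on every space; the indices required by \<open>operator_limit\<close> are then independent of
  \<open>n\<close>.\<close>

primrec code_set :: "'a measure \<Rightarrow> (('a \<Rightarrow> real) \<Rightarrow> 'a \<Rightarrow> real) \<Rightarrow> (nat \<Rightarrow> 'a \<Rightarrow> real) \<Rightarrow> set_code \<Rightarrow> 'a set" where
  "code_set M A F Whole = space M"
| "code_set M A F (Level i r) = {x\<in>space M. of_rat r < F i x}"
| "code_set M A F (Op_Level t r) = {x\<in>space M. of_rat r < A (indicator (code_set M A F t)) x}"
| "code_set M A F (Meet s t) = code_set M A F s \<inter> code_set M A F t"
| "code_set M A F (Complement t) = space M - code_set M A F t"

definition codes :: "'a measure \<Rightarrow> (('a \<Rightarrow> real) \<Rightarrow> 'a \<Rightarrow> real) \<Rightarrow> (nat \<Rightarrow> 'a \<Rightarrow> real) \<Rightarrow> 'a \<Rightarrow> nat set" where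
  "codes M A F x = {j. x \<in> code_set M A F (from_nat j)}"

text \<open>A cylinder of codes is a Boolean combination of coded sets and so has a term of its own,
  whose index need not be below \<open>J\<close>. Hence \<open>Op_Level\<close> applies to it, which
  closes the family.\<close>

primrec cylinder_code :: "nat \<Rightarrow> nat set \<Rightarrow> set_code" where
  "cylinder_code 0 s = Whole"
| "cylinder_code (Suc J) s = Meet (cylinder_code J s) (if J \<in> s then from_nat J else Complement (from_nat J))"

lemma code_set_subset: "code_set M A F t \<subseteq> space M"
  by (induction t) auto

lemma code_set_cylinder_code:
  "code_set M A F (cylinder_code J s) = {x\<in>space M. \<forall>j<J. j \<in> codes M A F x \<longleftrightarrow> j \<in> s}"
  using code_set_subset[of M A F] by (induction J) (auto simp: codes_def less_Suc_eq)

lemma sets_code_set: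
  assumes "AE_linear M A" "\<And>i. F i \<in> borel_measurable M"
  shows "code_set M A F t \<in> sets M"
proof (induction t)
  case (Op_Level t r)
  have "indicator (code_set M A F t) \<in> Linf M"
    using Op_Level by (intro Linf_bounded[where R=1]) (auto simp: indicator_def)
  then have [measurable]: "A (indicator (code_set M A F t)) \<in> borel_measurable M"
    using AE_linear_integrable[OF assms(1)] by auto
  show ?case by simp
next
  case (Level i r)
  have [measurable]: "F i \<in> borel_measurable M" by (rule assms)
  show ?case by simp
qed auto

lemma code_measurable_codes:
  assumes "AE_linear M A" "\<And>i. F i \<in> borel_measurable M"
  shows "code_measurable M (codes M A F)"
  unfolding code_measurable_def
proof
  fix j
  have "{x\<in>space M. j \<in> codes M A F x} = code_set M A F (from_nat j)"
    using code_set_subset[of M A F] by (auto simp: codes_def)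
  then show "{x\<in>space M. j \<in> codes M A F x} \<in> sets M" using sets_code_set[OF assms] by simp
qed

lemma codes_level:
  "r \<in> \<rat> \<Longrightarrow> \<exists>j. \<forall>M A F. \<forall>x\<in>space M. j \<in> codes M A F x \<longleftrightarrow> r < F i x"
proof (elim Rats_cases)
  fix r' assume "r = of_rat r'"
  then show ?thesis by (intro exI[of _ "to_nat (Level i r')"]) (simp add: codes_def)
qed

lemma codes_op_level:
  assumes s: "s \<subseteq> {..<J}" and "r \<in> \<rat>"
  shows "\<exists>j. \<forall>M A F. \<forall>x\<in>space M. j \<in> codes M A F x \<longleftrightarrow>
    r < A (indicator {x\<in>space M. codes M A F x \<inter> {..<J} = s}) x"
  using \<open>r \<in> \<rat>\<close>
proof (cases rule: Rats_cases)
  case (of_rat r')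
  have "{x\<in>space M. codes M A F x \<inter> {..<J} = s} = code_set M A F (cylinder_code J s)" for M :: "'a measure" and A F
    unfolding code_set_cylinder_code using s by auto
  then show ?thesis
    by (intro exI[of _ "to_nat (Op_Level (cylinder_code J s) r')"]) (simp add: codes_def of_rat)
qed

lemma exists_operator_limit:
  fixes M :: "nat \<Rightarrow> 'a measure" and F :: "nat \<Rightarrow> nat \<Rightarrow> 'a \<Rightarrow> real"
  assumes M: "\<And>n. prob_space (M n)" and lin: "\<And>n. AE_linear (M n) (A n)" and bd: "\<And>n. Lq_bounded (M n) p q c (A n)"
    and pqc: "1 \<le> p" "1 < q" "0 < c" and F: "\<And>n i. F n i \<in> borel_measurable (M n)"
  obtains r \<kappa> \<kappa>' and N :: "(nat \<Rightarrow> real) measure" where "strict_mono r"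
    "operator_limit (\<lambda>n. M (r n)) \<kappa> N \<kappa>' (\<lambda>n. A (r n)) p q c"
    "\<And>i t. t \<in> \<rat> \<Longrightarrow> \<exists>j. \<forall>n. \<forall>x\<in>space (M (r n)). j \<in> \<kappa> n x \<longleftrightarrow> t < F (r n) i x"
proof -
  define \<kappa> where "\<kappa> n = codes (M n) (A n) (F n)" for n
  obtain r and N :: "(nat \<Rightarrow> real) measure" where r: "strict_mono r"
    and lim: "limit_space (\<lambda>n. M (r n)) (\<lambda>n. \<kappa> (r n)) N (\<lambda>w. {j. w j = 1})"
    by (rule exists_limit_space[of M \<kappa>]) (auto simp: \<kappa>_def intro: M code_measurable_codes lin F)
  show thesis
  proof (rule that[OF r])
    show "operator_limit (\<lambda>n. M (r n)) (\<lambda>n. \<kappa> (r n)) N (\<lambda>w. {j. w j = 1}) (\<lambda>n. A (r n)) p q c"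
    proof (intro operator_limit.intro lim operator_limit_axioms.intro lin bd pqc)
      fix J :: nat and s and t :: real assume "s \<subseteq> {..<J}" "t \<in> \<rat>"
      from codes_op_level[OF this, where 'a='a] obtain j where
        "\<forall>(M :: 'a measure) A F. \<forall>x\<in>space M. j \<in> codes M A F x \<longleftrightarrow>
          t < A (indicator {x\<in>space M. codes M A F x \<inter> {..<J} = s}) x" by (rule exE)
      then show "\<exists>j. \<forall>n. \<forall>x\<in>space (M (r n)). j \<in> \<kappa> (r n) x \<longleftrightarrow>
          t < A (r n) (indicator {x\<in>space (M (r n)). \<kappa> (r n) x \<inter> {..<J} = s}) x"
        unfolding \<kappa>_def by (intro exI[of _ j]) simp
    qed
    fix i and t :: real assume "t \<in> \<rat>"
    from codes_level[OF this, where 'a='a, of i] obtain j where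
      "\<forall>(M :: 'a measure) A F. \<forall>x\<in>space M. j \<in> codes M A F x \<longleftrightarrow> t < F i x" by (rule exE)
    then show "\<exists>j. \<forall>n. \<forall>x\<in>space (M (r n)). j \<in> \<kappa> (r n) x \<longleftrightarrow> t < F (r n) i x"
      unfolding \<kappa>_def by (intro exI[of _ j]) simp
  qed
qed

section \<open>Atomless spaces and compactness\<close>

context prob_space
begin

text \<open>If \<open>T\<close> is a part of \<open>F\<close> of positive but smaller measure, one
  of \<open>T\<close> and \<open>F - T\<close> has at most half the measure of \<open>F\<close>; the
  halving is iterated.\<close>

lemma atomless_small_subset:
  assumes "atomless M" "E \<in> sets M" "0 < prob E" "0 < e"
  shows "\<exists>F\<in>sets M. F \<subseteq> E \<and> 0 < prob F \<and> prob F < e"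
proof -
  have *: "\<exists>F\<in>sets M. F \<subseteq> E \<and> 0 < prob F \<and> prob F \<le> prob E / 2 ^ k" for k
  proof (induction k)
    case 0
    then show ?case using assms by auto
  next
    case (Suc k)
    then obtain F where F: "F \<in> sets M" "F \<subseteq> E" "0 < prob F" "prob F \<le> prob E / 2 ^ k" by blast
    obtain T where T: "T \<in> sets M" "T \<subseteq> F" "0 < prob T" "prob T < prob F"
      using assms(1) F unfolding atomless_def by blast
    have d: "prob (F - T) = prob F - prob T" using F T by (intro finite_measure_Diff) auto
    show ?case
    proof (cases "prob T \<le> prob F / 2")
      case True
      then show ?thesis using F T by (intro bexI[of _ T]) auto
    next
      case False
      then show ?thesis using F T d by (intro bexI[of _ "F - T"]) auto
    qed
  qed
  have "(\<lambda>k. prob E / 2 ^ k) \<longlonglongrightarrow> 0" by (rule LIMSEQ_divide_realpow_zero) simp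
  then have "\<forall>\<^sub>F k in sequentially. prob E / 2 ^ k < e" using \<open>0 < e\<close> by (rule order_tendstoD)
  then obtain k where "prob E / 2 ^ k < e" by (auto simp: eventually_sequentially)
  with *[of k] show ?thesis by (meson le_less_trans)
qed

text \<open>Sierpinski's theorem: each step enlarges the current subset by at least half of what is possible.\<close>

lemma atomless_subset_prob:
  assumes al: "atomless M" and E: "E \<in> sets M" and a: "0 \<le> a" "a \<le> prob E"
  shows "\<exists>F\<in>sets M. F \<subseteq> E \<and> prob F = a"
proof -
  define P where "P F \<longleftrightarrow> F \<in> sets M \<and> F \<subseteq> E \<and> prob F \<le> a" for F
  define Q where "Q F F' \<longleftrightarrow> F \<subseteq> F' \<and> (\<forall>H. P H \<and> F \<subseteq> H \<longrightarrow> (prob F + prob H) / 2 \<le> prob F')" for F F'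
  have "\<exists>f. \<forall>n. P (f n) \<and> Q (f n) (f (Suc n))"
  proof (rule dependent_nat_choice)
    show "\<exists>F. P F" using a by (intro exI[of _ "{}"]) (auto simp: P_def)
    fix F and n :: nat assume F: "P F"
    define S where "S = (SUP H\<in>{H. P H \<and> F \<subseteq> H}. prob H)"
    have bdd: "bdd_above (prob ` {H. P H \<and> F \<subseteq> H})" by (rule bdd_aboveI[of _ a]) (auto simp: P_def)
    have le: "prob H \<le> S" if "P H" "F \<subseteq> H" for H
      unfolding S_def by (rule cSUP_upper[OF _ bdd]) (use that in auto)
    show "\<exists>F'. P F' \<and> Q F F'"
    proof (cases "S \<le> prob F")
      case True
      then have "Q F F" unfolding Q_def using le by force
      then show ?thesis using F by blast
    next
      case False
      then have "(prob F + S) / 2 < S" by simp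
      then obtain F' where F': "P F'" "F \<subseteq> F'" "(prob F + S) / 2 < prob F'"
        unfolding S_def using F by (subst (asm) less_cSUP_iff[OF _ bdd]) auto
      have "Q F F'" unfolding Q_def using F' le by force
      then show ?thesis using F' by blast
    qed
  qed
  then obtain f where f: "\<And>n. P (f n)" "\<And>n. Q (f n) (f (Suc n))" by blast
  define U where "U = (\<Union>n. f n)"
  have fs: "f n \<in> sets M" "f n \<subseteq> E" "prob (f n) \<le> a" for n using f(1)[of n] by (auto simp: P_def)
  have inc: "incseq f" using f(2) by (auto simp: incseq_Suc_iff Q_def)
  have lim: "(\<lambda>n. prob (f n)) \<longlonglongrightarrow> prob U"
    unfolding U_def using fs inc by (intro finite_Lim_measure_incseq) auto
  have U: "U \<in> sets M" "U \<subseteq> E" "prob U \<le> a"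
    using fs by (auto simp: U_def) (rule LIMSEQ_le_const2[OF lim[unfolded U_def]], auto)
  have "\<not> prob U < a"
  proof
    assume l: "prob U < a"
    have "prob (E - U) = prob E - prob U" using U E by (intro finite_measure_Diff) auto
    then have "0 < prob (E - U)" using l a by simp
    then obtain G where G: "G \<in> sets M" "G \<subseteq> E - U" "0 < prob G" "prob G < a - prob U"
      using atomless_small_subset[OF al, of "E - U" "a - prob U"] U E l by auto
    have UG: "prob (U \<union> G) = prob U + prob G" using U G by (intro finite_measure_Union) auto
    have "P (U \<union> G)" using U G UG by (auto simp: P_def)
    moreover have "f n \<subseteq> U \<union> G" for n by (auto simp: U_def)
    \<comment> \<open>\<open>U \<union> G\<close> is a competitor at every step, so each step gains
      at least half of the distance to its measure. In the limit this leaves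
      \<open>prob (U \<union> G) \<le> prob U\<close>.\<close>
    ultimately have "(prob (f n) + prob (U \<union> G)) / 2 \<le> prob (f (Suc n))" for n
      using f(2)[of n] unfolding Q_def by blast
    then have "(prob U + prob (U \<union> G)) / 2 \<le> prob U"
      by (intro LIMSEQ_le[OF tendsto_divide[OF tendsto_add[OF lim tendsto_const] tendsto_const] LIMSEQ_Suc[OF lim]]) auto
    then show False using UG G by simp
  qed
  then show ?thesis using U by (intro bexI[of _ U]) auto
qed

text \<open>The parts are cut one after another from the complement of their union, which has
  measure at least \<open>1 / real K\<close> as long as fewer than \<open>K\<close> parts
  exist.\<close>

lemma atomless_equipartition:
  assumes al: "atomless M" and K: "0 < K"
  obtains D where "\<And>i. D i \<in> sets M" "\<And>i. i < K \<Longrightarrow> prob (D i) = 1 / real K" "prob (\<Union>i<K. D i) = 1"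
proof -
  have "\<exists>D. (\<forall>i. D i \<in> sets M) \<and> (\<forall>i<m. prob (D i) = 1 / real K) \<and> prob (\<Union>i<m. D i) = real m / real K" if "m \<le> K" for m
    using that
  proof (induction m)
    case 0
    show ?case by (intro exI[of _ "\<lambda>_. {}"]) auto
  next
    case (Suc m)
    then obtain D where D: "\<And>i. D i \<in> sets M" "\<And>i. i < m \<Longrightarrow> prob (D i) = 1 / real K"
      "prob (\<Union>i<m. D i) = real m / real K" by auto
    define U where "U = (\<Union>i<m. D i)"
    have U: "U \<in> sets M" using D by (auto simp: U_def)
    have "prob (space M - U) = 1 - real m / real K" using prob_compl[OF U] D by (simp add: U_def)
    also have "\<dots> \<ge> 1 / real K" using Suc.prems K by (simp add: field_simps)
    finally obtain F where F: "F \<in> sets M" "F \<subseteq> space M - U" "prob F = 1 / real K"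
      using atomless_subset_prob[OF al, of "space M - U" "1 / real K"] U by auto
    have "(\<Union>i<Suc m. (D(m := F)) i) = U \<union> F" by (auto simp: U_def less_Suc_eq)
    moreover have "prob (U \<union> F) = prob U + prob F" using U F by (intro finite_measure_Union) auto
    ultimately have "prob (\<Union>i<Suc m. (D(m := F)) i) = real (Suc m) / real K"
      using D(3) F(3) by (simp add: U_def add_divide_distrib)
    then show ?case using D F by (intro exI[of _ "D(m := F)"]) (auto simp: less_Suc_eq)
  qed
  from this[of K] show thesis using that K by auto
qed

end

section \<open>Transfer of atomlessness to the limit space\<close>

context limit_space
begin

lemma finitary_prob:
  assumes "prob_space P" "code_measurable P k" and fin: "finitary (\<lambda>s. of_bool (R s))"
  shows "{x\<in>space P. R (k x)} \<in> sets P" "measure P {x\<in>space P. R (k x)} = (\<integral>x. of_bool (R (k x)) \<partial>P)"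
proof -
  interpret P: prob_space P by fact
  have "(\<lambda>x. of_bool (R (k x)) :: real) \<in> borel_measurable P" by (rule measurable_finitary[OF assms(2) fin])
  then have "{x\<in>space P. of_bool (R (k x)) = (1::real)} \<in> sets P" by measurable
  then show s: "{x\<in>space P. R (k x)} \<in> sets P" by simp
  have "(\<integral>x. of_bool (R (k x)) \<partial>P) = (\<integral>x. indicat_real {x\<in>space P. R (k x)} x \<partial>P)"
    by (intro Bochner_Integration.integral_cong) (auto simp: indicator_def)
  then show "measure P {x\<in>space P. R (k x)} = (\<integral>x. of_bool (R (k x)) \<partial>P)"
    using s by (simp add: Int_absorb1 sets.sets_into_space)
qed

lemma finitary_prob_tendsto:
  assumes fin: "finitary (\<lambda>s. of_bool (R s))"
  shows "(\<lambda>n. measure (M n) {x\<in>space (M n). R (\<kappa> n x)}) \<longlonglongrightarrow> measure N {x\<in>space N. R (\<kappa>' x)}"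
  unfolding finitary_prob(2)[OF prob_M code_M fin] finitary_prob(2)[OF prob_N code_N fin]
  by (rule finitary_tendsto[OF fin])

text \<open>The parts of the partitions are coded sets, with indices independent of
  \<open>n\<close>, so their measures carry over to \<open>N\<close>. A set \<open>S\<close> of
  measure above \<open>1 / K\<close> meets some part in positive measure, and the intersection is
  too small to have the full measure of \<open>S\<close>.\<close>

lemma atomless_limit:
  assumes part: "\<And>K. 0 < K \<Longrightarrow> \<exists>j. \<forall>n. (\<forall>i<K. measure (M n) {x\<in>space (M n). j i \<in> \<kappa> n x} = 1 / real K) \<and>
    measure (M n) {x\<in>space (M n). \<exists>i<K. j i \<in> \<kappa> n x} = 1"
  shows "atomless N"
  unfolding atomless_def
proof (intro ballI impI)
  interpret N: prob_space N by (rule prob_N)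
  fix S assume S: "S \<in> sets N" "0 < measure N S"
  obtain K :: nat where K: "0 < K" "1 / real K < measure N S"
    using nat_approx_posE[OF S(2)] by (metis zero_less_Suc)
  obtain j where j: "\<And>n i. i < K \<Longrightarrow> measure (M n) {x\<in>space (M n). j i \<in> \<kappa> n x} = 1 / real K"
    "\<And>n. measure (M n) {x\<in>space (M n). \<exists>i<K. j i \<in> \<kappa> n x} = 1" using part[OF K(1)] by blast
  define T where "T i = {x\<in>space N. j i \<in> \<kappa>' x}" for i
  have T: "T i \<in> sets N" for i
    unfolding T_def by (rule finitary_prob(1)[OF prob_N code_N finitary_mem])
  have pT: "measure N (T i) = 1 / real K" if "i < K" for i
    using finitary_prob_tendsto[OF finitary_mem, of "\<lambda>b. b" "j i"] unfolding j(1)[OF that] T_def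
    by (simp add: LIMSEQ_const_iff)
  have "finitary (\<lambda>s. of_bool (\<exists>i<K. j i \<in> s \<inter> j ` {..<K}))"
    by (rule finitary_finite_set) simp
  also have "(\<lambda>s. of_bool (\<exists>i<K. j i \<in> s \<inter> j ` {..<K}) :: real) = (\<lambda>s. of_bool (\<exists>i<K. j i \<in> s))"
    by (intro ext arg_cong[where f=of_bool]) auto
  finally have "finitary (\<lambda>s. of_bool (\<exists>i<K. j i \<in> s))" .
  from finitary_prob_tendsto[OF this] have "measure N {x\<in>space N. \<exists>i<K. j i \<in> \<kappa>' x} = 1"
    unfolding j(2) by (simp add: LIMSEQ_const_iff)
  also have "{x\<in>space N. \<exists>i<K. j i \<in> \<kappa>' x} = (\<Union>i<K. T i)" by (auto simp: T_def)
  finally have U: "measure N (\<Union>i<K. T i) = 1" .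
  have Us: "(\<Union>i<K. T i) \<in> sets N" using T by auto
  have "measure N S = measure N (S \<inter> (\<Union>i<K. T i))"
  proof -
    have "AE x in N. x \<in> (\<Union>i<K. T i)" using U Us by (simp add: N.prob_eq_1)
    then show ?thesis using S(1) Us by (intro N.finite_measure_eq_AE) (auto elim: eventually_mono)
  qed
  also have "S \<inter> (\<Union>i<K. T i) = (\<Union>i<K. S \<inter> T i)" by auto
  also have "measure N (\<Union>i<K. S \<inter> T i) \<le> (\<Sum>i<K. measure N (S \<inter> T i))"
    using S(1) T by (intro N.finite_measure_subadditive_finite) auto
  finally have le: "measure N S \<le> (\<Sum>i<K. measure N (S \<inter> T i))" .
  have "\<exists>i<K. 0 < measure N (S \<inter> T i)"
  proof (rule ccontr)
    assume "\<not> (\<exists>i<K. 0 < measure N (S \<inter> T i))"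
    then have "(\<Sum>i<K. measure N (S \<inter> T i)) \<le> 0" by (intro sum_nonpos) (metis lessThan_iff not_less)
    then show False using le S(2) by simp
  qed
  then obtain i where i: "i < K" "0 < measure N (S \<inter> T i)" by blast
  have "measure N (S \<inter> T i) \<le> measure N (T i)" using T by (intro N.finite_measure_mono) auto
  then have "measure N (S \<inter> T i) < measure N S" using pT[OF i(1)] K by simp
  then show "\<exists>T\<in>sets N. T \<subseteq> S \<and> 0 < measure N T \<and> measure N T < measure N S"
    using i S(1) T by (intro bexI[of _ "S \<inter> T i"]) auto
qed

end

section \<open>Extraction of the subsequence and compactness\<close>

lemma of_bool_convergent_cases:
  assumes "(\<lambda>n. of_bool (P n) :: real) \<longlonglongrightarrow> l"
  shows "(\<forall>\<^sub>F n in sequentially. P n) \<or> (\<forall>\<^sub>F n in sequentially. \<not> P n)"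
proof (cases "0 < l")
  case True
  with assms have "\<forall>\<^sub>F n in sequentially. 0 < (of_bool (P n) :: real)" by (rule order_tendstoD)
  then show ?thesis by (auto elim: eventually_mono)
next
  case False
  then have "l < 1" by simp
  with assms have "\<forall>\<^sub>F n in sequentially. (of_bool (P n) :: real) < 1" by (rule order_tendstoD)
  then show ?thesis by (auto elim: eventually_mono)
qed

text \<open>Tannery's theorem, that is, dominated convergence for series: the weights are a summable
  majorant since the Hausdorff distances are at most 1.\<close>

lemma dM_tendsto_0:
  assumes P: "\<And>n k \<mu>. \<mu> \<in> profile (M n) (A n) k \<Longrightarrow> prob_space \<mu>" "\<And>k \<mu>. \<mu> \<in> profile N B k \<Longrightarrow> prob_space \<mu>"
    and lim: "\<And>k. (\<lambda>n. haus_dist (2*k) (profile (M n) (A n) k) (profile N B k)) \<longlonglongrightarrow> 0"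
  shows "(\<lambda>n. dM (M n) (A n) N B) \<longlonglongrightarrow> 0"
proof -
  define a where "a k n = (1/2) ^ Suc k * haus_dist (2 * Suc k) (profile (M n) (A n) (Suc k)) (profile N B (Suc k))" for k n
  have b: "\<bar>haus_dist (2*k) (profile (M n) (A n) k) (profile N B k)\<bar> \<le> 1" for k n
  proof -
    have "prob_space \<mu>" if "\<mu> \<in> profile (M n) (A n) k \<union> profile N B k" for \<mu> using P that by blast
    from haus_dist_bounds[of "profile (M n) (A n) k" "profile N B k" "2*k", OF profile_nonempty profile_nonempty this]
    show ?thesis by (simp add: abs_le_iff)
  qed
  have "(\<lambda>n. a k n) \<longlonglongrightarrow> (1/2) ^ Suc k * 0" for k
    unfolding a_def by (intro tendsto_mult tendsto_const lim)
  then have l: "(\<lambda>n. a k n) \<longlonglongrightarrow> 0" for k by simp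
  have "norm (a k n) \<le> (1/2) ^ Suc k" for k n
    using mult_left_mono[OF b[of "Suc k" n], of "(1/2) ^ Suc k"] by (simp add: a_def abs_mult)
  then have bd: "\<forall>\<^sub>F (k, n) in at_top \<times>\<^sub>F sequentially. norm (a k n) \<le> (1/2) ^ Suc k"
    by (intro always_eventually) auto
  have sm: "summable (\<lambda>k. (1/2::real) ^ Suc k)"
    by (subst summable_Suc_iff) (intro summable_geometric, simp)
  have "(\<lambda>n. suminf (\<lambda>k. a k n)) \<longlonglongrightarrow> (\<Sum>k. 0)"
    using tannerys_theorem[of a "\<lambda>_. 0" sequentially "\<lambda>k. (1/2) ^ Suc k", OF l bd sm] by simp
  then show ?thesis by (simp add: dM_def a_def)
qed

text \<open>The auxiliary functions \<open>G\<close> are carried along so that properties of their level sets pass to the limit space.\<close>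

lemma subsequence_limit:
  fixes M :: "nat \<Rightarrow> 'a measure" and G :: "nat \<Rightarrow> nat \<Rightarrow> 'a \<Rightarrow> real" and p c :: real and q :: ereal
  assumes PO: "\<And>n. P_operator (M n) (A n)" and norm: "\<And>n. op_norm (M n) (ereal p) q (A n) \<le> ereal c"
    and c: "0 < c" and p: "1 \<le> p" and q: "1 < q" and G: "\<And>n i. G n i \<in> borel_measurable (M n)"
  obtains r \<kappa> \<kappa>' B and N :: "(nat \<Rightarrow> real) measure" where "strict_mono r"
    "P_operator N B" "op_norm N (ereal p) q B \<le> ereal c"
    "(\<lambda>n. dM (M (r n)) (A (r n)) N B) \<longlonglongrightarrow> 0" "limit_space (\<lambda>n. M (r n)) \<kappa> N \<kappa>'"
    "\<And>i t. t \<in> \<rat> \<Longrightarrow> \<exists>j. \<forall>n. \<forall>x\<in>space (M (r n)). j \<in> \<kappa> n x \<longleftrightarrow> t < G (r n) i x"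
proof -
  have M: "prob_space (M n)" and lin: "AE_linear (M n) (A n)" for n
    using PO[of n] by (auto simp: P_operator_AE_linear)
  have bds: "Lq_bounded (M n) p t c (A n)" if "t \<in> finite_exponents q" for n t
    using norm[of n] that unfolding op_norm_bound_iff[OF M lin p q c] by blast
  \<comment> \<open>One finite exponent is enough for uniform integrability and thus for the
    construction; the whole family \<open>bds\<close> returns for the norm of the limit.\<close>
  obtain q' where q': "q' \<in> finite_exponents q" using finite_exponents_nonempty by blast
  then have q1: "1 < q'" using finite_exponents_gt_1 q by blast
  note bd = bds[OF q']

  \<comment> \<open>Nets of every mesh \<open>1 / (real m + 1)\<close> are fixed for each
    \<open>k\<close> before any subsequence is taken; each has finitely many cells, so the pairs
    collected in \<open>W\<close> are countable in number.\<close>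
  define net where "net k m \<U> \<longleftrightarrow> finite \<U> \<and> bounded_laws (2*k) (max 1 (2*c)) \<subseteq> \<Union>\<U> \<and>
    (\<forall>U\<in>\<U>. \<forall>\<mu>\<in>U. \<forall>\<nu>\<in>U. lp_close (2*k) \<mu> \<nu> (1 / (real m + 1)))" for k m :: nat and \<U>
  have "\<exists>\<U>. net k m \<U>" for k m
  proof -
    have "0 < 1 / (real m + 1)" by simp
    from bounded_laws_totally_bounded[OF this, of "2*k" "max 1 (2*c)"] show ?thesis
      unfolding net_def by metis
  qed
  then obtain \<U> where \<U>: "\<And>k m. net k m (\<U> k m)" by metis
  define W where "W = (\<Union>k m. {k} \<times> \<U> k m)"
  have W: "countable W"
    unfolding W_def using \<U> by (intro countable_UN) (auto simp: net_def intro: countable_finite)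
  have memW: "(k, U) \<in> W" if "U \<in> \<U> k m" for k m U using that by (auto simp: W_def)

  \<comment> \<open>Whether a profile meets a cell is read as a number 0 or 1. A subsequence along
    which these numbers converge for all of \<open>W\<close> makes each answer eventually
    constant.\<close>
  define meets where "meets n w \<longleftrightarrow> profile (M n) (A n) (fst w) \<inter> snd w \<noteq> {}" for n w
  obtain r1 :: "nat \<Rightarrow> nat" where r1: "strict_mono r1"
    and lim1: "\<And>w. w \<in> W \<Longrightarrow> \<exists>l. (\<lambda>n. of_bool (meets (r1 n) w) :: real) \<longlonglongrightarrow> l"
    by (rule function_convergent_subsequence[OF W, of "\<lambda>n w. of_bool (meets n w) :: real" 1]) auto
  have stable: "(\<forall>\<^sub>F n in sequentially. meets (r1 n) w) \<or> (\<forall>\<^sub>F n in sequentially. \<not> meets (r1 n) w)" if "w \<in> W" for w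
    by (rule exE[OF lim1[OF that]]) (rule of_bool_convergent_cases)

  \<comment> \<open>Measurability and the bound are imposed for all \<open>i\<close>, and the law is
    prescribed only if the cell is met; zero functions fill the remaining cases. All choices can
    then be made at once and listed as one sequence of functions.\<close>
  define meets_at where "meets_at n w v \<longleftrightarrow> (\<forall>i. v i \<in> borel_measurable (M n) \<and> (\<forall>x\<in>space (M n). \<bar>v i x\<bar> \<le> 1)) \<and>
      (meets n w \<longrightarrow> prof_law (M n) (A n) (fst w) v \<in> snd w)" for n w v
  have "\<exists>v. meets_at n w v" for n w
  proof (cases "meets n w")
    case True
    define k where "k = fst w"
    obtain v where v: "prof_law (M n) (A n) k v \<in> snd w" "\<forall>i<k. v i \<in> borel_measurable (M n) \<and> (\<forall>x\<in>space (M n). \<bar>v i x\<bar> \<le> 1)"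
      using True unfolding meets_def profile_eq k_def by blast
    define v' where "v' i = (if i < k then v i else (\<lambda>_. 0))" for i
    have "(\<lambda>i\<in>{..<2*k}. if i < k then v' i x else A n (v' (i - k)) x) = (\<lambda>i\<in>{..<2*k}. if i < k then v i x else A n (v (i - k)) x)" for x
      by (rule restrict_ext) (auto simp: v'_def)
    then have "prof_law (M n) (A n) k v' \<in> snd w" using v(1) by simp
    moreover have "\<forall>i. v' i \<in> borel_measurable (M n) \<and> (\<forall>x\<in>space (M n). \<bar>v' i x\<bar> \<le> 1)"
      using v(2) by (simp add: v'_def)
    ultimately have "meets_at n w v'" unfolding meets_at_def k_def by blast
    then show ?thesis by blast
  next
    case False
    then show ?thesis by (intro exI[of _ "\<lambda>_ _. 0"]) (simp add: meets_at_def)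
  qed
  then have "\<exists>V. \<forall>n w. meets_at n w (V n w)" by (intro choice allI)
  then obtain V where V: "\<And>n w i. V n w i \<in> borel_measurable (M n)"
    "\<And>n w i x. x \<in> space (M n) \<Longrightarrow> \<bar>V n w i x\<bar> \<le> 1"
    "\<And>n w. meets n w \<Longrightarrow> prof_law (M n) (A n) (fst w) (V n w) \<in> snd w" unfolding meets_at_def by blast

  \<comment> \<open>A single sequence must carry both families: even indices run through the chosen
    functions of all cells by the pairing function, odd indices through the auxiliary
    functions.\<close>
  define F where "F n i = (if even i then V (r1 n) (from_nat_into W (fst (prod_decode (i div 2)))) (snd (prod_decode (i div 2)))
    else G (r1 n) (i div 2))" for n i
  have F: "F n i \<in> borel_measurable (M (r1 n))" for n i using V(1) G by (auto simp: F_def)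
  obtain r2 \<kappa> \<kappa>' and N :: "(nat \<Rightarrow> real) measure" where r2: "strict_mono r2"
    and op: "operator_limit (\<lambda>n. M (r1 (r2 n))) \<kappa> N \<kappa>' (\<lambda>n. A (r1 (r2 n))) p q' c"
    and lev: "\<And>i t. t \<in> \<rat> \<Longrightarrow> \<exists>j. \<forall>n. \<forall>x\<in>space (M (r1 (r2 n))). j \<in> \<kappa> n x \<longleftrightarrow> t < F (r2 n) i x"
    by (rule exists_operator_limit[of "\<lambda>n. M (r1 n)" "\<lambda>n. A (r1 n)" p q' c F, OF M lin bd p q1 c F]) (rule that)
  interpret O: operator_limit "\<lambda>n. M (r1 (r2 n))" \<kappa> N \<kappa>' "\<lambda>n. A (r1 (r2 n))" p q' c by (rule op)
  define r where "r n = r1 (r2 n)" for n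
  have r: "strict_mono r" using r1 r2 unfolding strict_mono_def r_def by blast
  have levV: "\<exists>j. \<forall>n. \<forall>x\<in>space (M (r1 (r2 n))). j \<in> \<kappa> n x \<longleftrightarrow> t < V (r1 (r2 n)) w i x" if "w \<in> W" "t \<in> \<rat>" for w i t
  proof -
    obtain a where a: "from_nat_into W a = w" using from_nat_into_surj[OF W \<open>w \<in> W\<close>] by blast
    have "F m (2 * prod_encode (a, i)) = V (r1 m) w i" for m by (simp add: F_def a)
    then show ?thesis using lev[OF \<open>t \<in> \<rat>\<close>, of "2 * prod_encode (a, i)"] by simp
  qed
  have levG: "\<exists>j. \<forall>n. \<forall>x\<in>space (M (r n)). j \<in> \<kappa> n x \<longleftrightarrow> t < G (r n) i x" if "t \<in> \<rat>" for i t
    using lev[OF that, of "2 * i + 1"] by (simp add: F_def r_def)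

  have haus: "\<forall>\<^sub>F n in sequentially. haus_dist (2*k) (profile (M (r1 (r2 n))) (A (r1 (r2 n))) k) (profile N O.lim_op k) \<le> 2 * (1 / (real m + 1))" for k m
  proof (rule O.profile_haus_dist_le[of _ "\<U> k m"])
    show "finite (\<U> k m)" "bounded_laws (2*k) (max 1 (2*c)) \<subseteq> \<Union>(\<U> k m)"
      using \<U>[of k m] by (auto simp: net_def)
    show "lp_close (2*k) \<mu> \<nu> (1 / (real m + 1))" if "U \<in> \<U> k m" "\<mu> \<in> U" "\<nu> \<in> U" for U \<mu> \<nu>
      using \<U>[of k m] that by (auto simp: net_def)
    fix U assume U: "U \<in> \<U> k m"
    define w where "w = (k, U)"
    have w: "w \<in> W" unfolding w_def by (rule memW[OF U])
    show "(\<forall>\<^sub>F n in sequentially. profile (M (r1 (r2 n))) (A (r1 (r2 n))) k \<inter> U = {}) \<or>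
      (\<exists>f. (\<forall>i<k. O.bounded_seq 1 (f i) \<and> (\<forall>t\<in>\<rat>. \<exists>j. \<forall>n. \<forall>x\<in>space (M (r1 (r2 n))). j \<in> \<kappa> n x \<longleftrightarrow> t < f i n x)) \<and>
        (\<forall>\<^sub>F n in sequentially. prof_law (M (r1 (r2 n))) (A (r1 (r2 n))) k (\<lambda>i. f i n) \<in> U))"
      using stable[OF w]
    proof
      assume "\<forall>\<^sub>F n in sequentially. \<not> meets (r1 n) w"
      from eventually_subseq[OF r2 this] show ?thesis by (simp add: meets_def w_def)
    next
      assume "\<forall>\<^sub>F n in sequentially. meets (r1 n) w"
      from eventually_subseq[OF r2 this]
      have ev: "\<forall>\<^sub>F n in sequentially. prof_law (M (r1 (r2 n))) (A (r1 (r2 n))) k (\<lambda>i. V (r1 (r2 n)) w i) \<in> U"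
      proof eventually_elim
        case (elim n)
        have fw: "fst w = k" "snd w = U" by (simp_all add: w_def)
        from V(3)[OF elim] show ?case unfolding fw .
      qed
      have "O.bounded_seq 1 (\<lambda>n. V (r1 (r2 n)) w i)" for i
        unfolding O.bounded_seq_def using V by simp
      then show ?thesis
        using ev levV[OF w] by (intro disjI2 exI[of _ "\<lambda>i n. V (r1 (r2 n)) w i"]) simp
    qed
  qed simp
  have prob: "prob_space \<mu>" if "\<mu> \<in> profile (M n) (A n) k" for n k \<mu>
    using profile_bounded_laws[OF M lin bd p q1 c] that unfolding bounded_laws_def by blast
  have probN: "prob_space \<mu>" if "\<mu> \<in> profile N O.lim_op k" for k \<mu>
    using profile_bounded_laws[OF O.prob_N O.AE_linear_lim_op O.Lq_bounded_lim_op[OF q1 bd] p q1 c] that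
    unfolding bounded_laws_def by blast
  have "(\<lambda>n. dM (M (r n)) (A (r n)) N O.lim_op) \<longlonglongrightarrow> 0"
  proof (rule dM_tendsto_0)
    fix k
    show "(\<lambda>n. haus_dist (2*k) (profile (M (r n)) (A (r n)) k) (profile N O.lim_op k)) \<longlonglongrightarrow> 0"
    proof (rule tendstoI)
      fix e :: real assume "0 < e"
      obtain m :: nat where "2 / e < m" using reals_Archimedean2 by blast
      then have m: "2 * (1 / (real m + 1)) < e" using \<open>0 < e\<close> by (simp add: field_simps)
      from haus[of k m] show "\<forall>\<^sub>F n in sequentially. dist (haus_dist (2*k) (profile (M (r n)) (A (r n)) k) (profile N O.lim_op k)) 0 < e"
      proof eventually_elim
        case (elim n)
        have "0 \<le> haus_dist (2*k) (profile (M (r n)) (A (r n)) k) (profile N O.lim_op k)"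
          using prob probN by (intro haus_dist_bounds) (auto simp: profile_nonempty)
        then show ?case using elim m by (simp add: r_def)
      qed
    qed
  qed (use prob probN in auto)
  moreover have "op_norm N (ereal p) q O.lim_op \<le> ereal c"
    unfolding op_norm_bound_iff[OF O.prob_N O.AE_linear_lim_op p q c]
    using O.Lq_bounded_lim_op[OF finite_exponents_gt_1[OF q] bds] by blast
  moreover have "P_operator N O.lim_op"
    unfolding P_operator_AE_linear
    using O.prob_N O.AE_linear_lim_op Lq_bounded_op_norm_finite[OF O.prob_N O.AE_linear_lim_op O.Lq_bounded_lim_op[OF q1 bd] q1 c p]
    by blast
  moreover have "limit_space (\<lambda>n. M (r n)) \<kappa> N \<kappa>'" unfolding r_def by (rule O.limit_space_axioms)
  ultimately show thesis using that[OF r] levG by blast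
qed

text \<open>Compactness is expressed sequentially. The limit is realised on a fixed type whatever
  type the sequence lives on; taking that type for \<open>'a\<close> as well gives sequential
  compactness within one type.\<close>

theorem theorem2p12:
  fixes c p :: real and q :: ereal
  assumes "0 < c" and "1 \<le> p" and "1 < q"
  shows "(\<forall>(M :: nat \<Rightarrow> 'a measure) A.
            (\<forall>n. P_operator (M n) (A n) \<and> op_norm (M n) (ereal p) q (A n) \<le> ereal c) \<longrightarrow>
            (\<exists>(N :: (nat \<Rightarrow> real) measure) B r.
               P_operator N B \<and> op_norm N (ereal p) q B \<le> ereal c \<and> strict_mono r \<and>
               (\<lambda>n. dM (M (r n)) (A (r n)) N B) \<longlonglongrightarrow> 0))
       \<and> (\<forall>(M :: nat \<Rightarrow> 'a measure) A.
            (\<forall>n. P_operator (M n) (A n) \<and> atomless (M n) \<and> op_norm (M n) (ereal p) q (A n) \<le> ereal c) \<longrightarrow>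
            (\<exists>(N :: (nat \<Rightarrow> real) measure) B r.
               P_operator N B \<and> atomless N \<and> op_norm N (ereal p) q B \<le> ereal c \<and> strict_mono r \<and>
               (\<lambda>n. dM (M (r n)) (A (r n)) N B) \<longlonglongrightarrow> 0))"
proof (intro conjI allI impI)
  fix M :: "nat \<Rightarrow> 'a measure" and A
  assume *: "\<forall>n. P_operator (M n) (A n) \<and> op_norm (M n) (ereal p) q (A n) \<le> ereal c"
  obtain r B and N :: "(nat \<Rightarrow> real) measure" where "strict_mono r" "P_operator N B" "op_norm N (ereal p) q B \<le> ereal c"
    "(\<lambda>n. dM (M (r n)) (A (r n)) N B) \<longlonglongrightarrow> 0"
    by (rule subsequence_limit[of M A p q c "\<lambda>_ _ _. 0"]) (use * assms in auto)
  then show "\<exists>(N :: (nat \<Rightarrow> real) measure) B r.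
               P_operator N B \<and> op_norm N (ereal p) q B \<le> ereal c \<and> strict_mono r \<and>
               (\<lambda>n. dM (M (r n)) (A (r n)) N B) \<longlonglongrightarrow> 0" by blast
next
  fix M :: "nat \<Rightarrow> 'a measure" and A
  assume *: "\<forall>n. P_operator (M n) (A n) \<and> atomless (M n) \<and> op_norm (M n) (ereal p) q (A n) \<le> ereal c"
  then have prob: "prob_space (M n)" and al: "atomless (M n)" for n by (auto simp: P_operator_def)
  have "\<exists>D. (\<forall>i. D i \<in> sets (M n)) \<and> (0 < K \<longrightarrow> (\<forall>i<K. measure (M n) (D i) = 1 / real K) \<and> measure (M n) (\<Union>i<K. D i) = 1)" for n K
  proof (cases "0 < K")
    case True
    show ?thesis
      by (rule prob_space.atomless_equipartition[OF prob al True, of n]) blast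
  next
    case False
    then show ?thesis by (intro exI[of _ "\<lambda>_. {}"]) auto
  qed
  then obtain D where D: "\<And>n K i. D n K i \<in> sets (M n)"
    "\<And>n K i. 0 < K \<Longrightarrow> i < K \<Longrightarrow> measure (M n) (D n K i) = 1 / real K"
    "\<And>n K. 0 < K \<Longrightarrow> measure (M n) (\<Union>i<K. D n K i) = 1" by metis
  \<comment> \<open>Indicators turn the parts of all equipartitions into level sets at the rational
    0, so that they receive indices in the code.\<close>
  define G where "G n i = (indicator (D n (fst (prod_decode i)) (snd (prod_decode i))) :: 'a \<Rightarrow> real)" for n i
  have G: "G n i \<in> borel_measurable (M n)" for n i using D(1) by (auto simp: G_def)
  obtain r \<kappa> \<kappa>' B and N :: "(nat \<Rightarrow> real) measure" where r: "strict_mono r" "P_operator N B" "op_norm N (ereal p) q B \<le> ereal c"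
    "(\<lambda>n. dM (M (r n)) (A (r n)) N B) \<longlonglongrightarrow> 0" and ls: "limit_space (\<lambda>n. M (r n)) \<kappa> N \<kappa>'"
    and lev: "\<And>i t. t \<in> \<rat> \<Longrightarrow> \<exists>j. \<forall>n. \<forall>x\<in>space (M (r n)). j \<in> \<kappa> n x \<longleftrightarrow> t < G (r n) i x"
    by (rule subsequence_limit[of M A p q c G]) (use * assms G in blast)+
  have "atomless N"
  proof (rule limit_space.atomless_limit[OF ls])
    fix K :: nat assume K: "0 < K"
    have "\<exists>j. \<forall>n. \<forall>x\<in>space (M (r n)). j \<in> \<kappa> n x \<longleftrightarrow> x \<in> D (r n) K i" for i
    proof -
      have "0 < G n (prod_encode (K, i)) x \<longleftrightarrow> x \<in> D n K i" for n x by (simp add: G_def indicator_def)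
      then show ?thesis using lev[of 0 "prod_encode (K, i)"] by simp
    qed
    then obtain j where j: "\<And>i n x. x \<in> space (M (r n)) \<Longrightarrow> j i \<in> \<kappa> n x \<longleftrightarrow> x \<in> D (r n) K i" by metis
    have "{x\<in>space (M (r n)). j i \<in> \<kappa> n x} = D (r n) K i" for n i
      using j sets.sets_into_space[OF D(1)] by blast
    moreover have "{x\<in>space (M (r n)). \<exists>i<K. j i \<in> \<kappa> n x} = (\<Union>i<K. D (r n) K i)" for n
      using j sets.sets_into_space[OF D(1)] by blast
    ultimately show "\<exists>j. \<forall>n. (\<forall>i<K. measure (M (r n)) {x\<in>space (M (r n)). j i \<in> \<kappa> n x} = 1 / real K) \<and>
        measure (M (r n)) {x\<in>space (M (r n)). \<exists>i<K. j i \<in> \<kappa> n x} = 1"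
      using D(2,3) K by (intro exI[of _ j]) simp
  qed
  then show "\<exists>(N :: (nat \<Rightarrow> real) measure) B r.
               P_operator N B \<and> atomless N \<and> op_norm N (ereal p) q B \<le> ereal c \<and> strict_mono r \<and>
               (\<lambda>n. dM (M (r n)) (A (r n)) N B) \<longlonglongrightarrow> 0" using r by blast
qed

end
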